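(* Let $\mathcal K=\mathcal T_{\{1,\dots,9\}}$ be the 9-web defined by the level curves of $U_1,\dots,U_9$ and, for distinct $j_1,\dots,j_p\in\{1,\dots,9\}$, let $\mathcal T_{\widehat{j_1\dots j_p}}$ be the $(9-p)$-subweb of $\mathcal K$ defined by the level curves of the $U_j$ with $j\in\{1,\dots,9\}\setminus\{j_1,\dots,j_p\}$. Then: 1. $\mathcal K$ is an exceptional 9-web; 2. $\mathcal T_{\widehat{69}}$ is an exceptional 7-web; 3. $\mathcal T_{\widehat{679}}$ is an exceptional 6-web; 4. $\mathcal T_{\widehat{248}}$ is an exceptional 6-web; 5. the two exceptional 6-webs $\mathcal T_{\widehat{679}}$ and $\mathcal T_{\widehat{248}}$ are not equivalent up to local diffeomorphism; 6. $\mathcal T_{\widehat{369}}$ is a maximal-rank hexagonal 6-web.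
   Context: The functions $U_i$ are the rational functions $$U_1=x,\quad U_2=y,\quad U_3=\frac{x}{y},\quad U_4=\frac{1-y}{1-x},\quad U_5=\frac{x(1-y)}{y(1-x)},\quad U_6=xy,$$ $$U_7=\frac{x(1-y)}{x-1},\quad U_8=\frac{1-y}{y(x-1)},\quad U_9=\frac{x(1-y)^2}{y(1-x)^2}$$ on $\mathbb C^2$. For $J\subset\{1,\dots,9\}$, $\mathcal T_J$ is the $|J|$-web whose foliations are given by the level curves of the $U_j$, $j\in J$. Its singular locus is the union of the polar loci of the $U_j$ ($j\in J$) with the sets $\{dU_i\wedge dU_j=0\}$ ($i\ne j$ in $J$). The notions below are local, for the germ of the web at points outside the singular locus. - Abelian relations and rank: for a web with $N$ foliations defined by $U_j$, $j\in J$, $|J|=N$, an abelian relation at a point $\omega$ is a tuple $(g_j)_{j\in J}$, with $g_j$ a holomorphic germ at $U_j(\omega)$, such that $\sum_{j\in J}g_j(U_j)\,dU_j=0$ near $\omega$. The rank of the web is the dimension of the complex vector space of abelian relations; it is at most $(N-1)(N-2)/2$, and the web is of maximal rank if equality holds. - Linearisable: there is a local biholomorphism to an open set of $\mathbb C^2$ carrying all leaves of the web to pieces of straight lines. - Exceptional: of maximal rank and not linearisable. - Hexagonal: every 3-subweb is locally equivalent, by a local biholomorphism, to the 3-web formed by three families of parallel lines (equivalently, every 3-subweb has rank 1). - Equivalent: two webs are equivalent (up to local diffeomorphism) if there is a local biholomorphism carrying a germ of the first, at a point outside its singular locus, to a germ of the second, at a point outside its singular locus, mapping the foliations of the first to the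 foliations of the second (in some order). *)

theory Defs
  imports "HOL-Analysis.Analysis" "HOL-Library.Function_Algebras"
begin

section \<open>The functions and their singular locus\<close>

fun U :: "nat \<Rightarrow> complex \<times> complex \<Rightarrow> complex" where
  "U j (x, y) =
    [x,
     y,
     x / y,
     (1 - y) / (1 - x),
     (x * (1 - y)) / (y * (1 - x)),
     x * y,
     (x * (1 - y)) / (x - 1),
     (1 - y) / (y * (x - 1)),
     (x * (1 - y)\<^sup>2) / (y * (1 - x)\<^sup>2)] ! (j - 1)"

text \<open>The fractions above are in lowest terms, so the polar locus of \<open>U j\<close> is the zero set of its
  denominator. (\<open>U j\<close> itself is total and has no meaning there, as \<open>z / 0 = 0\<close>.)\<close>

fun U_denom :: "nat \<Rightarrow> complex \<times> complex \<Rightarrow> complex" where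
  "U_denom j (x, y) =
    [1, 1, y, 1 - x, y * (1 - x), 1, x - 1, y * (x - 1), y * (1 - x)\<^sup>2] ! (j - 1)"

definition polar_locus :: "nat \<Rightarrow> (complex \<times> complex) set" where
  "polar_locus j = {p. U_denom j p = 0}"

text \<open>The differential of \<open>U j\<close>. Outside the polar locus it is complex linear.\<close>

definition dU :: "nat \<Rightarrow> complex \<times> complex \<Rightarrow> complex \<times> complex \<Rightarrow> complex" where
  "dU j p = frechet_derivative (U j) (at p)"

definition wedge :: "('v \<Rightarrow> complex) \<Rightarrow> ('v \<Rightarrow> complex) \<Rightarrow> 'v \<Rightarrow> 'v \<Rightarrow> complex" where
  "wedge \<alpha> \<beta> v w = \<alpha> v * \<beta> w - \<alpha> w * \<beta> v"

definition singular_locus :: "nat set \<Rightarrow> (complex \<times> complex) set" where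
  "singular_locus J =
     (\<Union>j\<in>J. polar_locus j) \<union>
     (\<Union>i\<in>J. \<Union>j\<in>J - {i}. {p. \<forall>v w. wedge (dU i p) (dU j p) v w = 0})"

definition regular_locus :: "nat set \<Rightarrow> (complex \<times> complex) set" where
  "regular_locus J = - singular_locus J"

definition is_web :: "nat \<Rightarrow> nat set \<Rightarrow> bool" where
  "is_web N J \<longleftrightarrow> J \<subseteq> {1..9} \<and> card J = N \<and> regular_locus J \<noteq> {}"


section \<open>Germs of functions of one complex variable\<close>

quotient_type germ = "complex \<Rightarrow> complex" / "\<lambda>f g. \<forall>\<^sub>F z in nhds 0. f z = g z"
  by (rule equivpI) (auto simp: reflp_def symp_def transp_def elim: eventually_elim2 eventually_mono)

instantiation germ :: ab_group_add
begin

lift_definition zero_germ :: germ is "\<lambda>z. 0" .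

lift_definition plus_germ :: "germ \<Rightarrow> germ \<Rightarrow> germ" is "\<lambda>f g z. f z + g z"
  by (erule (1) eventually_elim2) simp

lift_definition minus_germ :: "germ \<Rightarrow> germ \<Rightarrow> germ" is "\<lambda>f g z. f z - g z"
  by (erule (1) eventually_elim2) simp

lift_definition uminus_germ :: "germ \<Rightarrow> germ" is "\<lambda>f z. - f z"
  by (elim eventually_mono) simp

instance
  by standard (transfer, simp add: algebra_simps)+

end

lift_definition scale_germ :: "complex \<Rightarrow> germ \<Rightarrow> germ" is "\<lambda>c f z. c * f z"
  by (elim eventually_mono) simp

text \<open>The germ of \<open>f\<close> at \<open>a\<close>, written in the local coordinate \<open>t = z - a\<close>, so that the germs at any
  base point live in one vector space.\<close>

definition germ_at :: "complex \<Rightarrow> (complex \<Rightarrow> complex) \<Rightarrow> germ" where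
  "germ_at a f = abs_germ (\<lambda>t. f (a + t))"

definition scale_germs :: "complex \<Rightarrow> (nat \<Rightarrow> germ) \<Rightarrow> nat \<Rightarrow> germ" where
  "scale_germs c \<gamma> = (\<lambda>j. scale_germ c (\<gamma> j))"

lemma vector_space_scale_germ: "vector_space scale_germ"
  by standard (transfer, simp add: algebra_simps)+

lemma vector_space_scale_germs: "vector_space scale_germs"
proof -
  interpret vector_space scale_germ by (rule vector_space_scale_germ)
  show ?thesis
    by standard (auto simp: scale_germs_def fun_eq_iff scale_right_distrib scale_left_distrib)
qed


section \<open>Abelian relations and rank\<close>

text \<open>A tuple indexed by \<open>J\<close> is a function on \<^typ>\<open>nat\<close> that vanishes outside \<open>J\<close>. Near \<open>\<omega>\<close> the sum
  depends only on the germs of the \<open>g j\<close> at \<open>U j \<omega>\<close>, so the choice of representatives is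
  immaterial.\<close>

definition abelian_relations :: "nat set \<Rightarrow> complex \<times> complex \<Rightarrow> (nat \<Rightarrow> germ) set" where
  "abelian_relations J \<omega> =
     {\<gamma>. (\<forall>j. j \<notin> J \<longrightarrow> \<gamma> j = 0) \<and>
         (\<exists>g. (\<forall>j\<in>J. g j analytic_on {U j \<omega>} \<and> \<gamma> j = germ_at (U j \<omega>) (g j)) \<and>
              (\<forall>\<^sub>F p in nhds \<omega>. \<forall>v. (\<Sum>j\<in>J. g j (U j p) * dU j p v) = 0))}"

definition web_rank :: "nat set \<Rightarrow> complex \<times> complex \<Rightarrow> nat" where
  "web_rank J \<omega> = vector_space.dim scale_germs (abelian_relations J \<omega>)"

definition maximal_rank_at :: "nat set \<Rightarrow> complex \<times> complex \<Rightarrow> bool" where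
  "maximal_rank_at J \<omega> \<longleftrightarrow> web_rank J \<omega> = (card J - 1) * (card J - 2) div 2"


section \<open>Local biholomorphisms acting on webs\<close>

definition holomorphic_map ::
    "(complex \<times> complex \<Rightarrow> complex \<times> complex) \<Rightarrow> (complex \<times> complex) set \<Rightarrow> bool" where
  "holomorphic_map \<phi> W \<longleftrightarrow>
     (\<forall>p\<in>W. \<exists>D. (\<phi> has_derivative D) (at p) \<and>
        (\<forall>c v. D (map_prod ((*) c) ((*) c) v) = map_prod ((*) c) ((*) c) (D v)))"

definition biholomorphism ::
    "(complex \<times> complex \<Rightarrow> complex \<times> complex) \<Rightarrow> (complex \<times> complex) set \<Rightarrow> bool" where
  "biholomorphism \<phi> W \<longleftrightarrow>
     open W \<and> open (\<phi> ` W) \<and> inj_on \<phi> W \<and>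
     holomorphic_map \<phi> W \<and> holomorphic_map (inv_into W \<phi>) (\<phi> ` W)"

text \<open>For a submersion \<open>u\<close>, the germ at \<open>p\<close> of the level set of \<open>u\<close> through \<open>p\<close> is the germ at \<open>p\<close> of
  the leaf through \<open>p\<close>. Hence \<open>carries_foliation\<close> and \<open>carries_to_lines\<close> below say that \<open>\<phi>\<close> maps the leaves of \<open>u\<close> in \<open>W\<close> to
  leaves of \<open>v\<close>, respectively to pieces of complex affine lines.\<close>

definition carries_foliation where
  "carries_foliation \<phi> W (u :: complex \<times> complex \<Rightarrow> complex) (v :: complex \<times> complex \<Rightarrow> complex) \<longleftrightarrow>
     (\<forall>p\<in>W. \<forall>\<^sub>F q in nhds p. u q = u p \<longleftrightarrow> v (\<phi> q) = v (\<phi> p))"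

definition complex_line :: "(complex \<times> complex) set \<Rightarrow> bool" where
  "complex_line L \<longleftrightarrow> (\<exists>a b c. (a, b) \<noteq> (0, 0) \<and> L = {(x, y). a * x + b * y = c})"

definition carries_to_lines where
  "carries_to_lines \<phi> W (u :: complex \<times> complex \<Rightarrow> complex) \<longleftrightarrow>
     (\<forall>p\<in>W. \<exists>L. complex_line L \<and> (\<forall>\<^sub>F q in nhds p. u q = u p \<longleftrightarrow> \<phi> q \<in> L))"

definition linearisable_at :: "nat set \<Rightarrow> complex \<times> complex \<Rightarrow> bool" where
  "linearisable_at J \<omega> \<longleftrightarrow>
     (\<exists>\<phi> W. \<omega> \<in> W \<and> W \<subseteq> regular_locus J \<and> biholomorphism \<phi> W \<and>
        (\<forall>j\<in>J. carries_to_lines \<phi> W (U j)))"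

definition linear_form :: "complex \<times> complex \<Rightarrow> complex \<times> complex \<Rightarrow> complex" where
  "linear_form d p = fst d * fst p + snd d * snd p"

text \<open>Local equivalence with a web formed by families of parallel lines. The families are the level
  sets of linear forms, and different families have different directions.\<close>

definition parallelisable_at :: "nat set \<Rightarrow> complex \<times> complex \<Rightarrow> bool" where
  "parallelisable_at J \<omega> \<longleftrightarrow>
     (\<exists>\<phi> W d. \<omega> \<in> W \<and> W \<subseteq> regular_locus J \<and> biholomorphism \<phi> W \<and>
        (\<forall>i\<in>J. \<forall>j\<in>J. i \<noteq> j \<longrightarrow> fst (d i) * snd (d j) \<noteq> fst (d j) * snd (d i)) \<and>
        (\<forall>j\<in>J. carries_foliation \<phi> W (U j) (linear_form (d j))))"


section \<open>Properties of webs\<close>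

definition maximal_rank_web :: "nat set \<Rightarrow> bool" where
  "maximal_rank_web J \<longleftrightarrow> (\<forall>\<omega>\<in>regular_locus J. maximal_rank_at J \<omega>)"

definition exceptional_web :: "nat set \<Rightarrow> bool" where
  "exceptional_web J \<longleftrightarrow>
     (\<forall>\<omega>\<in>regular_locus J. maximal_rank_at J \<omega> \<and> \<not> linearisable_at J \<omega>)"

definition hexagonal_web :: "nat set \<Rightarrow> bool" where
  "hexagonal_web J \<longleftrightarrow>
     (\<forall>\<omega>\<in>regular_locus J. \<forall>K\<subseteq>J. card K = 3 \<longrightarrow> parallelisable_at K \<omega>)"

definition equivalent_webs :: "nat set \<Rightarrow> nat set \<Rightarrow> bool" where
  "equivalent_webs J J' \<longleftrightarrow>
     (\<exists>\<phi> W \<sigma>. W \<noteq> {} \<and> W \<subseteq> regular_locus J \<and> biholomorphism \<phi> W \<and>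
        \<phi> ` W \<subseteq> regular_locus J' \<and>
        bij_betw \<sigma> J J' \<and> (\<forall>j\<in>J. carries_foliation \<phi> W (U j) (U (\<sigma> j))))"

abbreviation \<K> :: "nat set" where
  "\<K> \<equiv> {1..9}"

abbreviation T_hat :: "nat set \<Rightarrow> nat set" where
  "T_hat js \<equiv> \<K> - js"

end

theory Submission
  imports Defs "HOL-Complex_Analysis.Complex_Analysis"
begin

text \<open>The rank of a web is decided by closed one-forms constant along its leaves; linearisability and
equivalence are decided by second-order data of the leaves.

\<^bold>\<open>Rank.\<close> In a web of \<open>N\<close> foliations, the leading coefficients of an abelian relation that vanishes to
order \<open>k\<close> satisfy a linear relation between the \<open>(k + 1)\<close>-st powers of the differentials of the \<open>U j\<close> at
the base point. These are pairwise independent linear forms in two variables, and any \<open>k + 2\<close> of the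
powers are linearly independent. So order \<open>k\<close> contributes at most \<open>N - k - 2\<close> dimensions, and the sum of
these numbers is \<open>(N - 1) (N - 2) / 2\<close>.

For the lower bound, all \<open>U j\<close> and all \<open>U j - 1\<close> are, up to sign, products of integer powers of
\<open>x\<close>, \<open>y\<close>, \<open>x - 1\<close>, \<open>y - 1\<close>, \<open>x - y\<close>, \<open>x y - 1\<close>. Iterated integrals of \<open>dz / z\<close> and \<open>dz / (z - 1)\<close> therefore
pull back to iterated integrals of the logarithmic differentials of these six polynomials. When all
of them start at the images of the base point, a combination of iterated integrals of one length
vanishes identically as soon as its symbol does, because its derivative is a combination of
combinations of smaller length and its value at the base point is zero. Neither branches of
logarithms nor correction terms of lower weight enter. This gives 12 relations of weight one, 9 of
weight two and 2 of weight three for the nine-web. Four more come from rational identities such as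
\<open>U 2 + U 4 + U 7 = 1\<close>, and one comes from the functions \<open>artanh (sqrt U)\<close> for \<open>U = U 3, U 6, U 9\<close>:
28 in all. They are linearly independent because iterated integrals are linearly independent over the
rational functions of \<open>sqrt z\<close>, which holds because the derivative of a rational function has no simple
pole.

\<^bold>\<open>Hexagonality.\<close> A relation of a three-web whose components do not vanish at the base point makes the
primitives of two components into coordinates in which the foliations are three families of parallel
lines. All 20 three-subwebs of the last web have such a relation of weight one or of rational type.

\<^bold>\<open>Linearisability and equivalence.\<close> Give a leaf with parametrisation \<open>c\<close> the number \<open>det (c', c'')\<close>; on
the line of tangent vectors \<open>v = c'\<close> it is homogeneous of degree 3 in \<open>v\<close>. A local biholomorphism with
2-jet \<open>L + Q / 2\<close> multiplies it by \<open>det L\<close> and adds \<open>det (L v, Q v)\<close>, a cubic form in \<open>v\<close>. So the existence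
of a cubic form that takes the prescribed value on each tangent direction is an invariant of webs,
and it holds trivially, with the form 0, for webs of lines. The leaves of \<open>U 1\<close>, \<open>U 2\<close>, \<open>U 3\<close>, \<open>U 4\<close> are
straight with four distinct directions; a cubic form vanishing on four directions is zero, but the
leaves of \<open>U 5\<close> are curved. Hence no web that contains these five foliations is linearisable. The
foliations 1, 2, 4, 5, 8 do admit an interpolating cubic form at every point, whereas no five
foliations of the web 1, 3, 5, 6, 7, 9 do so on an open set. The second fact shows that this web is
not linearisable, and both together show that the two six-webs are not equivalent.\<close>

section \<open>Partial derivatives and the regular locus\<close>

definition x_factor :: "nat \<Rightarrow> complex \<Rightarrow> complex" where
  "x_factor j x = [x, 1, x, 1 / (1 - x), x / (1 - x), x, x / (x - 1), 1 / (x - 1), x / (1 - x)\<^sup>2] ! (j - 1)"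

definition y_factor :: "nat \<Rightarrow> complex \<Rightarrow> complex" where
  "y_factor j y = [1, y, 1 / y, 1 - y, (1 - y) / y, y, 1 - y, (1 - y) / y, (1 - y)\<^sup>2 / y] ! (j - 1)"

text \<open>The \<open>U j\<close> are products of a function of \<open>x\<close> and a function of \<open>y\<close>, so their differentials and, later,
the shape of their leaves can be read off from one-variable derivatives.\<close>

definition x_factor_deriv :: "nat \<Rightarrow> complex \<Rightarrow> complex" where
  "x_factor_deriv j x = [1, 0, 1, 1 / (1 - x)\<^sup>2, 1 / (1 - x)\<^sup>2, 1, - 1 / (x - 1)\<^sup>2, - 1 / (x - 1)\<^sup>2,
     (1 + x) / (1 - x) ^ 3] ! (j - 1)"

definition y_factor_deriv :: "nat \<Rightarrow> complex \<Rightarrow> complex" where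
  "y_factor_deriv j y = [0, 1, - 1 / y\<^sup>2, - 1, - 1 / y\<^sup>2, 1, - 1, - 1 / y\<^sup>2, 1 - 1 / y\<^sup>2] ! (j - 1)"

lemma web_index_cases: "j \<in> {1..9} \<longleftrightarrow> j = 1 \<or> j = 2 \<or> j = 3 \<or> j = 4 \<or> j = 5 \<or> j = 6 \<or> j = 7 \<or> j = 8 \<or> j = (9::nat)"
  by auto

lemma U_eq_product:
  assumes "j \<in> {1..9}"
  shows "U j = (\<lambda>p. x_factor j (fst p) * y_factor j (snd p))"
  using assms unfolding web_index_cases by (elim disjE) (auto simp: fun_eq_iff x_factor_def y_factor_def)

lemma has_field_derivative_x_factor:
  assumes "j \<in> {1..9}" "(x, y) \<notin> polar_locus j"
  shows "(x_factor j has_field_derivative x_factor_deriv j x) (at x)" "(y_factor j has_field_derivative y_factor_deriv j y) (at y)"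
proof -
  have d4: "((\<lambda>x. 1 / (1 - x)) has_field_derivative 1 / (1 - x)\<^sup>2) (at x)" if "x \<noteq> 1"
    using that by (auto intro!: derivative_eq_intros simp: divide_simps power2_eq_square)
  have d5: "((\<lambda>x. x / (1 - x)) has_field_derivative 1 / (1 - x)\<^sup>2) (at x)" if "x \<noteq> 1"
    using that by (auto intro!: derivative_eq_intros simp: divide_simps power2_eq_square)
  have d7: "((\<lambda>x. x / (x - 1)) has_field_derivative - 1 / (x - 1)\<^sup>2) (at x)" if "x \<noteq> 1"
    using that by (auto intro!: derivative_eq_intros simp: divide_simps power2_eq_square)
  have d8: "((\<lambda>x. 1 / (x - 1)) has_field_derivative - 1 / (x - 1)\<^sup>2) (at x)" if "x \<noteq> 1"
    using that by (auto intro!: derivative_eq_intros simp: divide_simps power2_eq_square)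
  have d9: "((\<lambda>x. x / (1 - x)\<^sup>2) has_field_derivative (1 + x) / (1 - x) ^ 3) (at x)" if "x \<noteq> 1"
    using that by (auto intro!: derivative_eq_intros simp: divide_simps power2_eq_square power3_eq_cube)
      (simp add: algebra_simps)
  have e3: "((\<lambda>y. 1 / y) has_field_derivative - 1 / y\<^sup>2) (at y)" if "y \<noteq> 0"
    using that by (auto intro!: derivative_eq_intros simp: divide_simps power2_eq_square)
  have e5: "((\<lambda>y. (1 - y) / y) has_field_derivative - 1 / y\<^sup>2) (at y)" if "y \<noteq> 0"
    using that by (auto intro!: derivative_eq_intros simp: divide_simps power2_eq_square)
  have e9: "((\<lambda>y. (1 - y)\<^sup>2 / y) has_field_derivative 1 - 1 / y\<^sup>2) (at y)" if "y \<noteq> 0"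
    using that by (auto intro!: derivative_eq_intros simp: divide_simps power2_eq_square)
      (simp add: algebra_simps)
  have e4: "((\<lambda>y. 1 - y) has_field_derivative - 1) (at y)"
    by (auto intro!: derivative_eq_intros)
  show "(x_factor j has_field_derivative x_factor_deriv j x) (at x)"
    using assms unfolding web_index_cases polar_locus_def x_factor_def x_factor_deriv_def
    by (elim disjE) (simp_all add: d4 d5 d7[simplified] d8[simplified] d9)
  show "(y_factor j has_field_derivative y_factor_deriv j y) (at y)"
    using assms unfolding web_index_cases polar_locus_def y_factor_def y_factor_deriv_def
    by (elim disjE) (simp_all add: e3[simplified] e5[simplified] e9 e4)
qed

definition Ux :: "nat \<Rightarrow> complex \<times> complex \<Rightarrow> complex" where
  "Ux j p = x_factor_deriv j (fst p) * y_factor j (snd p)"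

definition Uy :: "nat \<Rightarrow> complex \<times> complex \<Rightarrow> complex" where
  "Uy j p = x_factor j (fst p) * y_factor_deriv j (snd p)"

lemma has_derivative_U:
  assumes "j \<in> {1..9}" "p \<notin> polar_locus j"
  shows "(U j has_derivative (\<lambda>v. Ux j p * fst v + Uy j p * snd v)) (at p)"
proof -
  obtain x y where p: "p = (x, y)" by (cases p)
  note D = has_field_derivative_x_factor[of j x y] assms[unfolded p]
  have f: "((\<lambda>p. x_factor j (fst p)) has_derivative (\<lambda>v. x_factor_deriv j x * fst v)) (at (x, y))"
    using D has_derivative_compose[of fst fst "(x, y)" UNIV "x_factor j" "\<lambda>h. x_factor_deriv j x * h"]
    by (simp add: has_field_derivative_def has_derivative_fst[OF has_derivative_ident])
  have g: "((\<lambda>p. y_factor j (snd p)) has_derivative (\<lambda>v. y_factor_deriv j y * snd v)) (at (x, y))"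
    using D has_derivative_compose[of snd snd "(x, y)" UNIV "y_factor j" "\<lambda>h. y_factor_deriv j y * h"]
    by (simp add: has_field_derivative_def has_derivative_snd[OF has_derivative_ident])
  have "((\<lambda>p. x_factor j (fst p) * y_factor j (snd p)) has_derivative
      (\<lambda>v. x_factor j x * (y_factor_deriv j y * snd v) + (x_factor_deriv j x * fst v) * y_factor j y)) (at (x, y))"
    using has_derivative_mult[OF f g] by simp
  then show ?thesis
    by (simp add: U_eq_product[OF assms(1)] p Ux_def Uy_def algebra_simps)
qed

lemma dU_eq:
  assumes "j \<in> {1..9}" "p \<notin> polar_locus j"
  shows "dU j p = (\<lambda>v. Ux j p * fst v + Uy j p * snd v)"
  unfolding dU_def using has_derivative_U[OF assms] frechet_derivative_at by metis

definition jacobian :: "nat \<Rightarrow> nat \<Rightarrow> complex \<times> complex \<Rightarrow> complex" where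
  "jacobian i j p = Ux i p * Uy j p - Uy i p * Ux j p"

lemma wedge_zero_iff:
  assumes "i \<in> {1..9}" "j \<in> {1..9}" "p \<notin> polar_locus i" "p \<notin> polar_locus j"
  shows "(\<forall>v w. wedge (dU i p) (dU j p) v w = 0) \<longleftrightarrow> jacobian i j p = 0"
proof -
  have eq: "wedge (dU i p) (dU j p) v w = jacobian i j p * (fst v * snd w - snd v * fst w)" for v w
    unfolding dU_eq[OF assms(1,3)] dU_eq[OF assms(2,4)] by (simp add: wedge_def jacobian_def algebra_simps)
  show ?thesis
  proof
    assume "\<forall>v w. wedge (dU i p) (dU j p) v w = 0"
    from this[THEN spec, of "(1, 0)", THEN spec, of "(0, 1)"] show "jacobian i j p = 0"
      unfolding eq by simp
  qed (simp add: eq)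
qed

lemma regular_locus_iff:
  assumes "J \<subseteq> {1..9}"
  shows "p \<in> regular_locus J \<longleftrightarrow>
    (\<forall>j\<in>J. p \<notin> polar_locus j) \<and> (\<forall>i\<in>J. \<forall>j\<in>J. i \<noteq> j \<longrightarrow> jacobian i j p \<noteq> 0)"
proof -
  have J: "j \<in> J \<Longrightarrow> j \<in> {1..9}" for j using assms by blast
  have gen: "q \<in> - ((\<Union>j\<in>J. A j) \<union> (\<Union>i\<in>J. \<Union>j\<in>J - {i}. {p. Q i j p})) \<longleftrightarrow>
      (\<forall>j\<in>J. q \<notin> A j) \<and> (\<forall>i\<in>J. \<forall>j\<in>J. i \<noteq> j \<longrightarrow> \<not> Q i j q)"
    for A :: "nat \<Rightarrow> (complex \<times> complex) set" and Q q
  proof -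
    have "q \<in> (\<Union>i\<in>J. \<Union>j\<in>J - {i}. {p. Q i j p}) \<longleftrightarrow> (\<exists>i\<in>J. \<exists>j\<in>J. i \<noteq> j \<and> Q i j q)"
      unfolding UN_iff mem_Collect_eq by (rule bex_cong[OF refl]) (simp add: Bex_def, metis)
    then show ?thesis
      unfolding Compl_iff Un_iff by (simp add: imp_conv_disj)
  qed
  have "p \<in> regular_locus J \<longleftrightarrow> (\<forall>j\<in>J. p \<notin> polar_locus j) \<and>
      (\<forall>i\<in>J. \<forall>j\<in>J. i \<noteq> j \<longrightarrow> \<not> (\<forall>v w. wedge (dU i p) (dU j p) v w = 0))"
    unfolding regular_locus_def singular_locus_def by (rule gen)
  also have "\<dots> \<longleftrightarrow> (\<forall>j\<in>J. p \<notin> polar_locus j) \<and> (\<forall>i\<in>J. \<forall>j\<in>J. i \<noteq> j \<longrightarrow> jacobian i j p \<noteq> 0)"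
    using wedge_zero_iff[OF J J] by (intro conj_cong refl ball_cong imp_cong) (simp only: simp_thms)
  finally show ?thesis .
qed

text \<open>Every regular point of each of the five webs lies here, and so do all its neighbours; on this open
set no \<open>U j\<close> has a pole or a zero.\<close>

definition off_axes :: "(complex \<times> complex) set" where
  "off_axes = {(x, y). x \<noteq> 0 \<and> y \<noteq> 0 \<and> x \<noteq> 1 \<and> y \<noteq> 1}"

lemma off_axes_not_polar: "p \<in> off_axes \<Longrightarrow> j \<in> {1..9} \<Longrightarrow> p \<notin> polar_locus j"
  unfolding off_axes_def polar_locus_def web_index_cases by (elim disjE) auto

lemma open_off_axes: "open off_axes"
proof -
  have "off_axes = (- {0, 1}) \<times> (- {0, 1})" by (auto simp: off_axes_def)
  then show ?thesis by (metis open_Times open_Compl finite_imp_closed finite.intros)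
qed

lemma regular_locus_antimono: "J \<subseteq> K \<Longrightarrow> regular_locus K \<subseteq> regular_locus J"
  unfolding regular_locus_def singular_locus_def
  by (rule Compl_anti_mono, rule Un_mono, rule UN_mono, assumption, rule order_refl,
      rule UN_mono, assumption, rule UN_mono, rule Diff_mono, assumption, (rule order_refl)+)

lemma jacobian_nonzero:
  assumes "p \<in> regular_locus J" "J \<subseteq> {1..9}" "i \<in> J" "j \<in> J" "i \<noteq> j"
  shows "jacobian i j p \<noteq> 0"
  using assms regular_locus_iff by blast

lemmas partial_defs = jacobian_def Ux_def Uy_def x_factor_def y_factor_def x_factor_deriv_def y_factor_deriv_def

text \<open>The foliations 1 and 5 are tangent along \<open>x = 0\<close>, 2 and 4 along \<open>y = 1\<close>, and 4 and 5 along the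
diagonal; the lines \<open>x = 1\<close> and \<open>y = 0\<close> are polar.\<close>

lemma regular_1245:
  assumes "(x, y) \<in> regular_locus J" "J \<subseteq> {1..9}" "{1, 2, 4, 5} \<subseteq> J"
  shows "(x, y) \<in> off_axes" "x \<noteq> y"
proof -
  note R = regular_locus_iff[OF assms(2), THEN iffD1, OF assms(1)]
  have y: "y \<noteq> 0" "x \<noteq> 1"
    using R[THEN conjunct1, THEN bspec, of 5] assms(3) by (auto simp: polar_locus_def)
  have j: "jacobian 1 5 (x, y) \<noteq> 0" "jacobian 2 4 (x, y) \<noteq> 0" "jacobian 4 5 (x, y) \<noteq> 0"
    using assms by - (rule jacobian_nonzero[OF assms(1,2)]; use assms(3) in simp)+
  have "x \<noteq> 0" using j(1) by (auto simp: partial_defs)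
  moreover have "y \<noteq> 1" using j(2) by (auto simp: partial_defs)
  ultimately show "(x, y) \<in> off_axes" using y by (auto simp: off_axes_def)
  show "x \<noteq> y" using j(3) y by (auto simp: partial_defs power2_eq_square)
qed

text \<open>The foliations 1 and 5 are tangent along \<open>x = 0\<close>, 5 and 7 along \<open>y = 1\<close>, 3 and 5 along the diagonal, and
6 and 7 along \<open>x y = 1\<close>; the lines \<open>x = 1\<close> and \<open>y = 0\<close> are polar.\<close>

lemma regular_13567:
  assumes "(x, y) \<in> regular_locus J" "J \<subseteq> {1..9}" "{1, 3, 5, 6, 7} \<subseteq> J"
  shows "(x, y) \<in> off_axes" "x \<noteq> y" "x * y \<noteq> 1"
proof -
  note R = regular_locus_iff[OF assms(2), THEN iffD1, OF assms(1)]
  have y: "y \<noteq> 0" "x \<noteq> 1"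
    using R[THEN conjunct1, THEN bspec, of 5] assms(3) by (auto simp: polar_locus_def)
  have j: "jacobian 1 5 (x, y) \<noteq> 0" "jacobian 5 7 (x, y) \<noteq> 0" "jacobian 3 5 (x, y) \<noteq> 0" "jacobian 6 7 (x, y) \<noteq> 0"
    using assms by - (rule jacobian_nonzero[OF assms(1,2)]; use assms(3) in simp)+
  have x: "x \<noteq> 0" using j(1) by (auto simp: partial_defs)
  have y1: "y \<noteq> 1" using j(2) by (auto simp: partial_defs)
  show "(x, y) \<in> off_axes" using y x y1 by (auto simp: off_axes_def)
  show "x \<noteq> y" using j(3) y by (auto simp: partial_defs power2_eq_square)
  have "jacobian 6 7 (x, y) = x * (1 - x * y) / (x - 1)\<^sup>2"
    using y by (simp add: partial_defs divide_simps power2_eq_square) algebra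
  then show "x * y \<noteq> 1" using j(4) by auto
qed

text \<open>The curve \<open>x y = 1\<close> is the level set 1 of both \<open>U 7\<close> and \<open>U 8\<close>, so the two foliations are tangent along it.\<close>

lemma regular_78:
  assumes "(x, y) \<in> regular_locus J" "J \<subseteq> {1..9}" "{7, 8} \<subseteq> J"
  shows "x * y \<noteq> 1"
proof -
  note R = regular_locus_iff[OF assms(2), THEN iffD1, OF assms(1)]
  have y: "y \<noteq> 0" "x \<noteq> 1"
    using R[THEN conjunct1, THEN bspec, of 8] assms(3) by (auto simp: polar_locus_def)
  have j: "jacobian 7 8 (x, y) \<noteq> 0" 
    using assms by - (rule jacobian_nonzero[OF assms(1,2)]; use assms(3) in simp)+
  have "jacobian 7 8 (x, y) = (1 - y) * (1 - x * y) / (y\<^sup>2 * (x - 1) ^ 3)"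
    using y by (simp add: partial_defs divide_simps power2_eq_square power3_eq_cube) algebra
  then show ?thesis using j by auto
qed

lemma regular_point: "(3, 5) \<in> regular_locus {1..9}"
proof -
  have np: "(3, 5) \<notin> polar_locus j" if "j \<in> {1..9}" for j
    using that by (intro off_axes_not_polar) (auto simp: off_axes_def)
  have "i < j \<longrightarrow> jacobian i j (3, 5) \<noteq> 0" if "i \<in> {1..9}" "j \<in> {1..9}" for i j
    using that unfolding web_index_cases by (elim disjE) (simp_all add: partial_defs field_simps)
  moreover have "jacobian i j p = - jacobian j i p" for i j p
    by (simp add: jacobian_def)
  ultimately have "\<forall>i\<in>{1..9}. \<forall>j\<in>{1..9}. i \<noteq> j \<longrightarrow> jacobian i j (3, 5) \<noteq> 0"
    by (metis nat_neq_iff neg_equal_0_iff_equal)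
  then show ?thesis using np by (subst regular_locus_iff) auto
qed

lemma is_web_if:
  assumes "J \<subseteq> {1..9}" "card J = N"
  shows "is_web N J"
  using regular_point regular_locus_antimono[OF assms(1)] assms by (auto simp: is_web_def)

lemma isCont_Ux:
  assumes "p \<in> off_axes" "j \<in> {1..9}"
  shows "isCont (Ux j) p" "isCont (Uy j) p"
proof -
  obtain x y where p: "p = (x, y)" by (cases p)
  show "isCont (Ux j) p" "isCont (Uy j) p"
    using assms unfolding web_index_cases p off_axes_def
    by (elim disjE; auto simp: Ux_def[abs_def] Uy_def[abs_def] x_factor_def y_factor_def x_factor_deriv_def y_factor_deriv_def intro!: continuous_intros)+
qed

lemma open_regular:
  assumes "J \<subseteq> {1..9}" "p \<in> off_axes" "p \<in> regular_locus J"
  shows "\<forall>\<^sub>F q in nhds p. q \<in> regular_locus J"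
proof -
  have fin: "finite J" using assms(1) finite_subset by blast
  have g: "\<forall>\<^sub>F q in nhds p. q \<in> off_axes"
    using open_off_axes assms(2) by (simp add: eventually_nhds_in_open)
  have "\<forall>\<^sub>F q in nhds p. i \<noteq> j \<longrightarrow> jacobian i j q \<noteq> 0" if "i \<in> J" "j \<in> J" for i j
  proof (cases "i = j")
    case False
    have "isCont (jacobian i j) p"
      unfolding jacobian_def[abs_def] using that assms by (intro continuous_intros isCont_Ux) auto
    moreover have "jacobian i j p \<noteq> 0" using jacobian_nonzero assms that False by blast
    ultimately have "\<forall>\<^sub>F q in nhds p. jacobian i j q \<in> - {0}"
      by (intro topological_tendstoD[of "jacobian i j" "jacobian i j p"])
         (auto simp: isCont_def tendsto_nhds_iff open_Compl)
    then show ?thesis by (auto elim: eventually_mono)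
  qed auto
  then have "\<forall>\<^sub>F q in nhds p. \<forall>i\<in>J. \<forall>j\<in>J. i \<noteq> j \<longrightarrow> jacobian i j q \<noteq> 0"
    using fin by (auto intro!: eventually_ball_finite)
  with g show ?thesis
    by eventually_elim (use assms(1) off_axes_not_polar in \<open>auto simp: regular_locus_iff\<close>)
qed

section \<open>The upper bound for the rank\<close>

text \<open>Differentiating the relation in the direction of the kernel of one of the forms removes that form
and lowers the exponent by one, so induction applies to the remaining forms.\<close>

lemma powers_of_forms_independent:
  fixes \<alpha> \<beta> c :: "'i \<Rightarrow> complex"
  assumes "finite S" "card S \<le> n + 1"
    and "\<And>i j. i \<in> S \<Longrightarrow> j \<in> S \<Longrightarrow> i \<noteq> j \<Longrightarrow> \<alpha> i * \<beta> j \<noteq> \<alpha> j * \<beta> i"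
    and "\<And>i. i \<in> S \<Longrightarrow> (\<alpha> i, \<beta> i) \<noteq> (0, 0)"
    and "\<And>x y. (\<Sum>i\<in>S. c i * (\<alpha> i * x + \<beta> i * y) ^ n) = 0"
    and "i \<in> S"
  shows "c i = 0"
  using assms
proof (induction n arbitrary: S c i)
  case 0
  then have "S = {i}" using card_le_Suc0_iff_eq[of S] by auto
  then show ?case using "0.prems"(5)[of 0 0] by simp
next
  case (Suc n)
  have vanish: "c j = 0" if j: "j \<in> S" "j \<noteq> i" for j
  proof -
    let ?S = "S - {i}"
    have deriv0: "(\<Sum>k\<in>?S. (c k * (\<alpha> k * \<beta> i - \<alpha> i * \<beta> k)) * (\<alpha> k * x + \<beta> k * y) ^ n) = 0" for x y
    proof -
      have "((\<lambda>s. \<Sum>k\<in>S. c k * (\<alpha> k * (x + s * \<beta> i) + \<beta> k * (y - s * \<alpha> i)) ^ Suc n) has_field_derivative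
          (\<Sum>k\<in>S. c k * (of_nat (Suc n) * (\<alpha> k * x + \<beta> k * y) ^ n * (\<alpha> k * \<beta> i - \<alpha> i * \<beta> k)))) (at 0)"
      proof (rule DERIV_sum)
        fix k
        have eq: "\<alpha> k * (x + s * \<beta> i) + \<beta> k * (y - s * \<alpha> i) = (\<alpha> k * x + \<beta> k * y) + s * (\<alpha> k * \<beta> i - \<alpha> i * \<beta> k)" for s
          by (simp add: algebra_simps)
        show "((\<lambda>s. c k * (\<alpha> k * (x + s * \<beta> i) + \<beta> k * (y - s * \<alpha> i)) ^ Suc n) has_field_derivative
          c k * (of_nat (Suc n) * (\<alpha> k * x + \<beta> k * y) ^ n * (\<alpha> k * \<beta> i - \<alpha> i * \<beta> k))) (at 0)"
          unfolding eq by (auto intro!: derivative_eq_intros simp del: power_Suc of_nat_Suc)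
      qed
      moreover have "((\<lambda>s. \<Sum>k\<in>S. c k * (\<alpha> k * (x + s * \<beta> i) + \<beta> k * (y - s * \<alpha> i)) ^ Suc n) has_field_derivative 0) (at 0)"
        using Suc.prems(5) by simp
      ultimately have "(\<Sum>k\<in>S. c k * (of_nat (Suc n) * (\<alpha> k * x + \<beta> k * y) ^ n * (\<alpha> k * \<beta> i - \<alpha> i * \<beta> k))) = 0"
        using DERIV_unique by blast
      also have "(\<Sum>k\<in>S. c k * (of_nat (Suc n) * (\<alpha> k * x + \<beta> k * y) ^ n * (\<alpha> k * \<beta> i - \<alpha> i * \<beta> k)))
          = of_nat (Suc n) * (\<Sum>k\<in>S. (c k * (\<alpha> k * \<beta> i - \<alpha> i * \<beta> k)) * (\<alpha> k * x + \<beta> k * y) ^ n)"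
        by (simp only: sum_distrib_left) (intro sum.cong refl, simp only: ac_simps)
      finally have "(\<Sum>k\<in>S. (c k * (\<alpha> k * \<beta> i - \<alpha> i * \<beta> k)) * (\<alpha> k * x + \<beta> k * y) ^ n) = 0"
        using of_nat_neq_0[of n] by (simp del: of_nat_Suc)
      then show ?thesis
        using Suc.prems(1,6) by (simp add: sum.remove)
    qed
    have "c j * (\<alpha> j * \<beta> i - \<alpha> i * \<beta> j) = 0"
    proof (rule Suc.IH[of ?S "\<lambda>k. c k * (\<alpha> k * \<beta> i - \<alpha> i * \<beta> k)" j])
      show "card ?S \<le> n + 1" using Suc.prems(1,2,6) by simp
      show "\<And>x y. (\<Sum>k\<in>?S. (c k * (\<alpha> k * \<beta> i - \<alpha> i * \<beta> k)) * (\<alpha> k * x + \<beta> k * y) ^ n) = 0"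
        by (rule deriv0)
    qed (use Suc.prems j in auto)
    moreover have "\<alpha> j * \<beta> i - \<alpha> i * \<beta> j \<noteq> 0" using Suc.prems(3)[of j i] Suc.prems(6) j by simp
    ultimately show ?thesis by simp
  qed
  have sum1: "(\<Sum>k\<in>S. c k * (\<alpha> k * x + \<beta> k * y) ^ Suc n) = c i * (\<alpha> i * x + \<beta> i * y) ^ Suc n" for x y
    using Suc.prems(1,6) by (simp add: sum.remove[of S i] vanish)
  show ?case
    using Suc.prems(4)[OF Suc.prems(6)] Suc.prems(5)[of 1 0] Suc.prems(5)[of 0 1]
    unfolding sum1 by auto
qed

lemma homogeneous_system_solvable:
  fixes \<Phi> :: "'s \<Rightarrow> 'i \<Rightarrow> 'a :: field"
  assumes "finite F" "finite S" "card F < card S"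
  shows "\<exists>u. (\<exists>s\<in>S. u s \<noteq> 0) \<and> (\<forall>i\<in>F. (\<Sum>s\<in>S. u s * \<Phi> s i) = 0)"
  using assms
proof (induction F arbitrary: S \<Phi> rule: finite_induct)
  case empty
  then obtain s where "s \<in> S" by fastforce
  then show ?case by (intro exI[of _ "\<lambda>_. 1"]) auto
next
  case (insert i F)
  show ?case
  proof (cases "\<forall>s\<in>S. \<Phi> s i = 0")
    case True
    have "card F < card S" using insert by auto
    from insert.IH[OF insert.prems(1) this, of \<Phi>] obtain u where
      "\<exists>s\<in>S. u s \<noteq> 0" "\<forall>i\<in>F. (\<Sum>s\<in>S. u s * \<Phi> s i) = 0" by blast
    then show ?thesis using True by (intro exI[of _ u]) auto
  next
    case False
    then obtain s0 where s0: "s0 \<in> S" "\<Phi> s0 i \<noteq> 0" by blast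
    \<comment> \<open>elimination of the unknown belonging to \<open>s0\<close> by means of the equation \<open>i\<close>\<close>
    define \<Psi> where "\<Psi> s l = \<Phi> s l - \<Phi> s i / \<Phi> s0 i * \<Phi> s0 l" for s l
    have "card F < card (S - {s0})" using insert s0 by simp
    from insert.IH[OF _ this, of \<Psi>] insert.prems obtain u where
      u: "\<exists>s\<in>S - {s0}. u s \<noteq> 0" "\<forall>i\<in>F. (\<Sum>s\<in>S - {s0}. u s * \<Psi> s i) = 0" by auto
    define c where "c = (\<Sum>s\<in>S - {s0}. u s * (\<Phi> s i / \<Phi> s0 i))"
    define w where "w = u(s0 := - c)"
    have split: "(\<Sum>s\<in>S. w s * \<Phi> s l) = (\<Sum>s\<in>S - {s0}. u s * \<Psi> s l)" for l
    proof -
      have "(\<Sum>s\<in>S. w s * \<Phi> s l) = - c * \<Phi> s0 l + (\<Sum>s\<in>S - {s0}. w s * \<Phi> s l)"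
        using s0 insert.prems by (simp add: sum.remove w_def)
      also have "(\<Sum>s\<in>S - {s0}. w s * \<Phi> s l) = (\<Sum>s\<in>S - {s0}. u s * \<Phi> s l)"
        by (intro sum.cong) (auto simp: w_def)
      also have "- c * \<Phi> s0 l + \<dots> = (\<Sum>s\<in>S - {s0}. u s * \<Psi> s l)"
        by (simp add: \<Psi>_def right_diff_distrib sum_subtractf c_def sum_distrib_right mult.assoc)
      finally show ?thesis .
    qed
    have "\<Psi> s i = 0" for s using s0 by (simp add: \<Psi>_def)
    then have "\<forall>l\<in>insert i F. (\<Sum>s\<in>S. w s * \<Phi> s l) = 0"
      unfolding split using u(2) by simp
    moreover have "\<exists>s\<in>S. w s \<noteq> 0" using u(1) by (auto simp: w_def)
    ultimately show ?thesis by blast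
  qed
qed

text \<open>The functionals bound the dimension from above, since a homogeneous system with fewer equations
than unknowns has a solution; the independent set bounds it from below. The functionals are linear
on the subspace only: Taylor coefficients of a germ are additive for analytic germs.\<close>

lemma (in vector_space) dim_eq_if_separating_functionals:
  fixes \<Phi> :: "'b \<Rightarrow> 'i \<Rightarrow> 'a"
  assumes A: "subspace A"
    and add: "\<And>x y i. x \<in> A \<Longrightarrow> y \<in> A \<Longrightarrow> \<Phi> (x + y) i = \<Phi> x i + \<Phi> y i"
    and scale: "\<And>c x i. x \<in> A \<Longrightarrow> \<Phi> (c *s x) i = c * \<Phi> x i"
    and inj: "\<And>x. x \<in> A \<Longrightarrow> \<forall>i\<in>F. \<Phi> x i = 0 \<Longrightarrow> x = 0"
    and F: "finite F"
    and B: "B \<subseteq> A" "independent B" "finite B" "card B = card F"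
  shows "dim A = card F"
proof (rule dim_unique[OF B(1) _ B(2) B(4)])
  have lin: "(\<Sum>s\<in>S. u s *s s) \<in> A \<and> \<Phi> (\<Sum>s\<in>S. u s *s s) i = (\<Sum>s\<in>S. u s * \<Phi> s i)"
    if "finite S" "S \<subseteq> A" for S u i
    using that
  proof (induction S rule: finite_induct)
    case empty
    have "\<Phi> (0 *s 0) i = 0 * \<Phi> 0 i" using A subspace_0 scale by blast
    then show ?case using A by (simp add: subspace_0)
  next
    case (insert x S)
    then show ?case using A
      by (simp add: subspace_add subspace_scale add scale)
  qed
  show "A \<subseteq> span B"
  proof (rule ccontr)
    assume "\<not> A \<subseteq> span B"
    then obtain x where x: "x \<in> A" "x \<notin> span B" by blast
    let ?S = "insert x B"
    have ind: "independent ?S" using x B by (intro independent_insertI)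
    have "x \<notin> B" using x span_base by blast
    then have "card F < card ?S" using B by simp
    from homogeneous_system_solvable[OF F _ this, of \<Phi>] B obtain u where
      u: "\<exists>s\<in>?S. u s \<noteq> 0" "\<forall>i\<in>F. (\<Sum>s\<in>?S. u s * \<Phi> s i) = 0" by auto
    have "?S \<subseteq> A" "finite ?S" using B x by auto
    from lin[OF this(2,1), of u] u(2) have "(\<Sum>s\<in>?S. u s *s s) = 0"
      using inj by metis
    with ind u(1) show False
      using independentD[of ?S ?S u] B by auto
  qed
qed

lift_definition germ_coeff :: "nat \<Rightarrow> germ \<Rightarrow> complex" is "\<lambda>k f. (deriv ^^ k) f 0 / fact k"
  by (metis higher_deriv_cong_ev)

lemma germ_coeff_germ_at:
  assumes "f analytic_on {a}"
  shows "germ_coeff k (germ_at a f) = fps_nth (fps_expansion f a) k"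
proof -
  have "(\<lambda>t. f (a + t)) has_fps_expansion fps_expansion f a"
    using analytic_at_imp_has_fps_expansion[OF assms] .
  then have "fps_nth (fps_expansion f a) k = (deriv ^^ k) (\<lambda>t. f (a + t)) 0 / fact k"
    by (rule fps_nth_fps_expansion)
  then show ?thesis unfolding germ_at_def by (simp add: germ_coeff.abs_eq)
qed

lemma germ_at_eq_0_if_coeffs:
  assumes "f analytic_on {a}" "\<And>k. germ_coeff k (germ_at a f) = 0"
  shows "germ_at a f = 0"
proof -
  have "fps_expansion f a = 0"
    using assms germ_coeff_germ_at[OF assms(1)] by (simp add: fps_eq_iff)
  then have "\<forall>\<^sub>F t in nhds 0. f (a + t) = 0"
    using analytic_at_imp_has_fps_expansion[OF assms(1)] by (simp add: has_fps_expansion_0_iff)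
  then show ?thesis
    unfolding germ_at_def zero_germ_def by (simp add: germ.abs_eq_iff)
qed

lemma germ_at_add: "germ_at a f + germ_at a g = germ_at a (\<lambda>z. f z + g z)"
  unfolding germ_at_def by (simp add: plus_germ.abs_eq)

lemma germ_at_scale: "scale_germ c (germ_at a f) = germ_at a (\<lambda>z. c * f z)"
  unfolding germ_at_def by (simp add: scale_germ.abs_eq)

lemma germ_at_zero: "germ_at a (\<lambda>z. 0) = 0"
  unfolding germ_at_def zero_germ_def by simp

lemma eventually_dU:
  assumes "\<omega> \<in> off_axes"
  shows "\<forall>\<^sub>F p in nhds \<omega>. \<forall>j\<in>{1..9}. dU j p = (\<lambda>v. Ux j p * fst v + Uy j p * snd v)"
proof -
  have "\<forall>\<^sub>F p in nhds \<omega>. p \<in> off_axes"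
    using open_off_axes assms by (simp add: eventually_nhds_in_open)
  then show ?thesis
    by eventually_elim (auto simp: dU_eq off_axes_not_polar)
qed

lemma abelian_relations_off_axes:
  assumes "\<omega> \<in> off_axes" "J \<subseteq> {1..9}"
  shows "\<gamma> \<in> abelian_relations J \<omega> \<longleftrightarrow> (\<forall>j. j \<notin> J \<longrightarrow> \<gamma> j = 0) \<and>
    (\<exists>g. (\<forall>j\<in>J. g j analytic_on {U j \<omega>} \<and> \<gamma> j = germ_at (U j \<omega>) (g j)) \<and>
      (\<forall>\<^sub>F p in nhds \<omega>. \<forall>v. (\<Sum>j\<in>J. g j (U j p) * (Ux j p * fst v + Uy j p * snd v)) = 0))"
proof -
  have eq: "(\<forall>\<^sub>F p in nhds \<omega>. \<forall>v. (\<Sum>j\<in>J. g j (U j p) * dU j p v) = 0) \<longleftrightarrow>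
      (\<forall>\<^sub>F p in nhds \<omega>. \<forall>v. (\<Sum>j\<in>J. g j (U j p) * (Ux j p * fst v + Uy j p * snd v)) = 0)" for g
  proof (rule eventually_cong[OF eventually_dU[OF assms(1)]])
    fix p assume *: "\<forall>j\<in>{1..9}. dU j p = (\<lambda>v. Ux j p * fst v + Uy j p * snd v)"
    have "(\<Sum>j\<in>J. g j (U j p) * dU j p v) = (\<Sum>j\<in>J. g j (U j p) * (Ux j p * fst v + Uy j p * snd v))" for v
      using assms(2) * by (intro sum.cong refl) (auto simp: subset_iff)
    then show "(\<forall>v. (\<Sum>j\<in>J. g j (U j p) * dU j p v) = 0) \<longleftrightarrow>
      (\<forall>v. (\<Sum>j\<in>J. g j (U j p) * (Ux j p * fst v + Uy j p * snd v)) = 0)" by simp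
  qed
  show ?thesis unfolding abelian_relations_def eq mem_Collect_eq ..
qed

lemma subspace_abelian_relations: "module.subspace scale_germs (abelian_relations J \<omega>)"
proof -
  interpret vector_space scale_germs by (rule vector_space_scale_germs)
  interpret g: vector_space scale_germ by (rule vector_space_scale_germ)
  show ?thesis
  proof (rule subspaceI)
    show "0 \<in> abelian_relations J \<omega>"
      unfolding abelian_relations_def
      by (auto intro!: exI[of _ "\<lambda>_ _. 0"] simp: germ_at_zero)
  next
    fix \<gamma> \<delta> assume \<gamma>: "\<gamma> \<in> abelian_relations J \<omega>" and \<delta>: "\<delta> \<in> abelian_relations J \<omega>"
    obtain g h where g: "\<forall>j\<in>J. g j analytic_on {U j \<omega>} \<and> \<gamma> j = germ_at (U j \<omega>) (g j)"
        "\<forall>\<^sub>F p in nhds \<omega>. \<forall>v. (\<Sum>j\<in>J. g j (U j p) * dU j p v) = 0"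
      and h: "\<forall>j\<in>J. h j analytic_on {U j \<omega>} \<and> \<delta> j = germ_at (U j \<omega>) (h j)"
        "\<forall>\<^sub>F p in nhds \<omega>. \<forall>v. (\<Sum>j\<in>J. h j (U j p) * dU j p v) = 0"
      using \<gamma> \<delta> unfolding abelian_relations_def by blast
    have "\<forall>\<^sub>F p in nhds \<omega>. \<forall>v. (\<Sum>j\<in>J. (g j (U j p) + h j (U j p)) * dU j p v) = 0"
      using g(2) h(2) by eventually_elim (simp add: distrib_right sum.distrib)
    then show "\<gamma> + \<delta> \<in> abelian_relations J \<omega>"
      using g(1) h(1) \<gamma> \<delta> unfolding abelian_relations_def
      by (auto intro!: exI[of _ "\<lambda>j z. g j z + h j z"] analytic_on_add simp: germ_at_add)
  next
    fix c \<gamma> assume \<gamma>: "\<gamma> \<in> abelian_relations J \<omega>"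
    obtain g where g: "\<forall>j\<in>J. g j analytic_on {U j \<omega>} \<and> \<gamma> j = germ_at (U j \<omega>) (g j)"
        "\<forall>\<^sub>F p in nhds \<omega>. \<forall>v. (\<Sum>j\<in>J. g j (U j p) * dU j p v) = 0"
      using \<gamma> unfolding abelian_relations_def by blast
    have "\<forall>\<^sub>F p in nhds \<omega>. \<forall>v. (\<Sum>j\<in>J. (c * g j (U j p)) * dU j p v) = 0"
      using g(2) by eventually_elim (simp add: mult.assoc flip: sum_distrib_left)
    then show "scale_germs c \<gamma> \<in> abelian_relations J \<omega>"
      using g(1) \<gamma> unfolding abelian_relations_def
      by (auto intro!: exI[of _ "\<lambda>j z. c * g j z"] analytic_intros simp: scale_germs_def germ_at_scale)
  qed
qed

lemma DERIV_U_along_line: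
  assumes "j \<in> {1..9}" "\<omega> \<in> off_axes"
  shows "((\<lambda>t. U j (fst \<omega> + t * fst v, snd \<omega> + t * snd v)) has_field_derivative
    (Ux j \<omega> * fst v + Uy j \<omega> * snd v)) (at 0)"
proof -
  have "((\<lambda>t. (fst \<omega> + t * fst v, snd \<omega> + t * snd v)) has_derivative (\<lambda>t. (t * fst v, t * snd v))) (at 0)"
    by (rule has_derivative_eq_rhs, (rule derivative_intros)+) auto
  moreover have "(U j has_derivative (\<lambda>v. Ux j \<omega> * fst v + Uy j \<omega> * snd v))
      (at (fst \<omega> + 0 * fst v, snd \<omega> + 0 * snd v))"
    using has_derivative_U[OF assms(1) off_axes_not_polar[OF assms(2,1)]] by simp
  ultimately have "((\<lambda>t. U j (fst \<omega> + t * fst v, snd \<omega> + t * snd v)) has_derivative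
      (\<lambda>t. Ux j \<omega> * fst (t * fst v, t * snd v) + Uy j \<omega> * snd (t * fst v, t * snd v))) (at 0)"
    by (rule has_derivative_compose)
  then show ?thesis
    unfolding has_field_derivative_def by (rule has_derivative_eq_rhs) (auto simp: algebra_simps)
qed

text \<open>On the line through \<open>\<omega>\<close> in direction \<open>(x, y)\<close>, each \<open>U j\<close> grows linearly with slope its differential.
Dividing the abelian relation by the \<open>k\<close>-th power of the parameter and passing to the limit leaves
the leading coefficients times the powers of the slopes.\<close>

lemma leading_jets_relation:
  assumes \<omega>: "\<omega> \<in> off_axes" and J: "J \<subseteq> {1..9}"
    and g: "\<And>j. j \<in> J \<Longrightarrow> g j analytic_on {U j \<omega>}"
    and rel: "\<forall>\<^sub>F p in nhds \<omega>. \<forall>v. (\<Sum>j\<in>J. g j (U j p) * (Ux j p * fst v + Uy j p * snd v)) = 0"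
    and low: "\<And>j i. j \<in> J \<Longrightarrow> i < k \<Longrightarrow> fps_nth (fps_expansion (g j) (U j \<omega>)) i = 0"
  shows "(\<Sum>j\<in>J. fps_nth (fps_expansion (g j) (U j \<omega>)) k * (Ux j \<omega> * x + Uy j \<omega> * y) ^ Suc k) = 0"
proof -
  define q where "q t = (fst \<omega> + t * x, snd \<omega> + t * y)" for t :: complex
  define c where "c j = fps_nth (fps_expansion (g j) (U j \<omega>)) k" for j
  define u where "u j t = U j (q t) - U j \<omega>" for j t
  define w where "w j t = u j t / t" for j t
  define h where "h j z = (if z = 0 then c j else g j (U j \<omega> + z) / z ^ k)" for j z
  have q0: "q 0 = \<omega>" by (simp add: q_def)
  have contq: "isCont q 0" unfolding q_def by (intro continuous_intros)
  have gh: "g j (U j \<omega> + z) = z ^ k * h j z" if "j \<in> J" for j z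
  proof (cases "z = 0")
    case True
    have "g j (U j \<omega>) = fps_nth (fps_expansion (g j) (U j \<omega>)) 0" by (simp add: fps_expansion_def)
    then show ?thesis using low[OF that, of 0] True by (cases "k = 0") (auto simp: h_def c_def)
  qed (simp add: h_def)
  have conth: "isCont (h j) 0" if "j \<in> J" for j
  proof (cases "fps_expansion (g j) (U j \<omega>) = 0")
    case True
    have "\<forall>\<^sub>F t in nhds 0. g j (U j \<omega> + t) = 0"
      using analytic_at_imp_has_fps_expansion[OF g[OF that]] True by (simp add: has_fps_expansion_0_iff)
    then have "\<forall>\<^sub>F t in nhds 0. h j t = 0"
      by eventually_elim (auto simp: h_def c_def True)
    then show ?thesis using isCont_cong[of "h j" "\<lambda>_. 0" 0] by simp
  next
    case False
    have "k \<le> subdegree (fps_expansion (g j) (U j \<omega>))"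
      using low[OF that] False by (intro subdegree_geI) auto
    from has_fps_expansion_shift[OF analytic_at_imp_has_fps_expansion[OF g[OF that]] this c_def]
    show ?thesis unfolding h_def[abs_def] by (rule has_fps_expansion_imp_continuous)
  qed
  have w_lim: "(w j \<longlongrightarrow> Ux j \<omega> * x + Uy j \<omega> * y) (at 0)" if "j \<in> J" for j
    using DERIV_U_along_line[of j \<omega> "(x, y)"] J that \<omega> unfolding DERIV_def
    by (auto simp: w_def[abs_def] u_def q_def)
  have u_lim: "(u j \<longlongrightarrow> 0) (at 0)" if "j \<in> J" for j
  proof -
    have "isCont (\<lambda>t. U j (fst \<omega> + t * x, snd \<omega> + t * y)) 0"
      using DERIV_isCont[OF DERIV_U_along_line[of j \<omega> "(x, y)"]] J that \<omega> by auto
    then have "((\<lambda>t. U j (q t)) \<longlongrightarrow> U j \<omega>) (at 0)"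
      unfolding isCont_def q_def by simp
    then show ?thesis unfolding u_def[abs_def] using LIM_zero by blast
  qed
  have h_lim: "((\<lambda>t. h j (u j t)) \<longlongrightarrow> c j) (at 0)" if "j \<in> J" for j
    using isCont_tendsto_compose[OF conth[OF that] u_lim[OF that]] by (simp add: h_def)
  have d_lim: "((\<lambda>t. Ux j (q t) * x + Uy j (q t) * y) \<longlongrightarrow> Ux j \<omega> * x + Uy j \<omega> * y) (at 0)"
    if "j \<in> J" for j
  proof -
    have "j \<in> {1..9}" using J that by blast
    note C = isCont_Ux[OF \<omega> this]
    have "(q \<longlongrightarrow> \<omega>) (at 0)" using contq q0 by (simp add: isCont_def)
    then show ?thesis
      using isCont_tendsto_compose[OF C(1)] isCont_tendsto_compose[OF C(2)]
      by (intro tendsto_intros) auto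
  qed
  have lim: "((\<lambda>t. \<Sum>j\<in>J. w j t ^ k * h j (u j t) * (Ux j (q t) * x + Uy j (q t) * y)) \<longlongrightarrow>
      (\<Sum>j\<in>J. (Ux j \<omega> * x + Uy j \<omega> * y) ^ k * c j * (Ux j \<omega> * x + Uy j \<omega> * y))) (at 0)"
    by (intro tendsto_intros w_lim h_lim d_lim)
  have "filterlim q (nhds \<omega>) (at 0)" using contq q0 by (simp add: isCont_def)
  from eventually_compose_filterlim[OF rel this]
  have "\<forall>\<^sub>F t in at 0. (\<Sum>j\<in>J. w j t ^ k * h j (u j t) * (Ux j (q t) * x + Uy j (q t) * y)) = 0"
    using eventually_neq_at_within[of 0 0 UNIV]
  proof eventually_elim
    case (elim t)
    have "0 = (\<Sum>j\<in>J. g j (U j (q t)) * (Ux j (q t) * x + Uy j (q t) * y))"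
      using elim(1)[rule_format, of "(x, y)"] by simp
    also have "\<dots> = (\<Sum>j\<in>J. t ^ k * (w j t ^ k * h j (u j t) * (Ux j (q t) * x + Uy j (q t) * y)))"
    proof (intro sum.cong refl)
      fix j assume j: "j \<in> J"
      have "g j (U j (q t)) = u j t ^ k * h j (u j t)" using gh[OF j, of "u j t"] by (simp add: u_def)
      also have "u j t = t * w j t" using elim by (simp add: w_def)
      finally show "g j (U j (q t)) * (Ux j (q t) * x + Uy j (q t) * y)
          = t ^ k * (w j t ^ k * h j (u j t) * (Ux j (q t) * x + Uy j (q t) * y))"
        using elim by (simp add: power_mult_distrib w_def power_divide)
    qed
    also have "\<dots> = t ^ k * (\<Sum>j\<in>J. w j t ^ k * h j (u j t) * (Ux j (q t) * x + Uy j (q t) * y))"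
      by (simp add: sum_distrib_left)
    finally show ?case using elim by simp
  qed
  then have "((\<lambda>t. \<Sum>j\<in>J. w j t ^ k * h j (u j t) * (Ux j (q t) * x + Uy j (q t) * y)) \<longlongrightarrow> 0) (at 0)"
    by (rule tendsto_eventually)
  from tendsto_unique[OF _ lim this] show ?thesis
    by (simp add: c_def ac_simps)
qed

lemma sum_diff_triangular: "(\<Sum>k<n + 2. n - k) = (n + 1) * n div (2::nat)"
proof (induction n)
  case (Suc n)
  have "(\<Sum>k<Suc n + 2. Suc n - k) = Suc n + (\<Sum>k<n + 2. n - k)"
    using sum.lessThan_Suc_shift[of "\<lambda>k. Suc n - k" "n + 2"] by simp
  then show ?case using Suc by simp
qed (simp add: lessThan_Suc)

text \<open>For each order \<open>k\<close> only the coefficients of the first \<open>N - k - 2\<close> foliations are recorded. If they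
vanish, then at most \<open>k + 2\<close> coefficients of order \<open>k\<close> are left, and independence of the powers of the
differentials makes them vanish too. So the recorded coefficients determine the relation.\<close>

lemma maximal_rank_if_independent:
  assumes \<omega>: "\<omega> \<in> regular_locus J" "\<omega> \<in> off_axes" and J: "J \<subseteq> {1..9}" "2 \<le> card J"
    and B: "B \<subseteq> abelian_relations J \<omega>" "\<not> module.dependent scale_germs B" "finite B"
      "card B = (card J - 1) * (card J - 2) div 2"
  shows "maximal_rank_at J \<omega>"
proof -
  interpret vector_space scale_germs by (rule vector_space_scale_germs)
  define N where "N = card J"
  have finJ: "finite J" using J(1) finite_subset by blast
  obtain e where e: "bij_betw e {0..<N} J" using ex_bij_betw_nat_finite[OF finJ] N_def by blast
  have eJ: "e i \<in> J" if "i < N" for i using e that by (auto simp: bij_betw_def)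
  define F where "F = (SIGMA k:{..<N}. {..<N - k - 2})"
  define \<Phi> where "\<Phi> \<gamma> = (\<lambda>(k, i). germ_coeff k (\<gamma> (e i)))" for \<gamma> :: "nat \<Rightarrow> germ"
  have cardF: "card F = (N - 1) * (N - 2) div 2"
  proof -
    obtain n where n: "N = n + 2" using J(2) N_def le_Suc_ex by (metis add.commute)
    have "card F = (\<Sum>k<N. N - k - 2)" unfolding F_def by (subst card_SigmaI) auto
    also have "\<dots> = (\<Sum>k<n + 2. n - k)" unfolding n by (intro sum.cong) auto
    also have "\<dots> = (N - 1) * (N - 2) div 2" unfolding sum_diff_triangular n by simp
    finally show ?thesis .
  qed
  have rep: "\<exists>g. (\<forall>j\<in>J. g j analytic_on {U j \<omega>} \<and> \<gamma> j = germ_at (U j \<omega>) (g j))"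
    if "\<gamma> \<in> abelian_relations J \<omega>" for \<gamma>
    using that unfolding abelian_relations_def by blast
  have coeff: "germ_coeff k (germ_at a f) = (deriv ^^ k) f a / fact k" if "f analytic_on {a}" for k a f
    using germ_coeff_germ_at[OF that] by (simp add: fps_expansion_def)
  have zero_out: "\<gamma> j = 0" if "\<gamma> \<in> abelian_relations J \<omega>" "j \<notin> J" for \<gamma> j
    using that unfolding abelian_relations_def by blast
  have coeff0: "germ_coeff k 0 = 0" for k
    using coeff[of "\<lambda>_. 0" 0 k] higher_deriv_const[of k 0] by (simp add: germ_at_zero)
  have "dim (abelian_relations J \<omega>) = card F"
  proof (rule dim_eq_if_separating_functionals[where \<Phi> = \<Phi> and B = B])
    show "subspace (abelian_relations J \<omega>)" by (rule subspace_abelian_relations)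
  next
    fix \<gamma> \<delta> i assume \<gamma>: "\<gamma> \<in> abelian_relations J \<omega>" and \<delta>: "\<delta> \<in> abelian_relations J \<omega>"
    have add: "germ_coeff k ((\<gamma> + \<delta>) j) = germ_coeff k (\<gamma> j) + germ_coeff k (\<delta> j)" for k j
    proof (cases "j \<in> J")
      case True
      then obtain g h where "g analytic_on {U j \<omega>}" "\<gamma> j = germ_at (U j \<omega>) g"
          "h analytic_on {U j \<omega>}" "\<delta> j = germ_at (U j \<omega>) h"
        using rep[OF \<gamma>] rep[OF \<delta>] by blast
      then show ?thesis
        by (simp add: germ_at_add coeff analytic_on_add higher_deriv_add_at add_divide_distrib)
    qed (simp add: zero_out[OF \<gamma>] zero_out[OF \<delta>] coeff0)
    show "\<Phi> (\<gamma> + \<delta>) i = \<Phi> \<gamma> i + \<Phi> \<delta> i"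
      unfolding \<Phi>_def split_beta by (rule add)
  next
    fix c \<gamma> i assume \<gamma>: "\<gamma> \<in> abelian_relations J \<omega>"
    have "germ_coeff k (scale_germs c \<gamma> j) = c * germ_coeff k (\<gamma> j)" for k j
    proof (cases "j \<in> J")
      case True
      then obtain g where "g analytic_on {U j \<omega>}" "\<gamma> j = germ_at (U j \<omega>) g"
        using rep[OF \<gamma>] by blast
      then show ?thesis
        unfolding scale_germs_def
        by (simp add: germ_at_scale coeff analytic_on_mult higher_deriv_cmult')
    next
      case False
      have "scale_germ c 0 = 0" using germ_at_scale[of c 0 "\<lambda>_. 0"] by (simp add: germ_at_zero)
      then show ?thesis using False by (simp add: zero_out[OF \<gamma>] coeff0 scale_germs_def)
    qed
    then show "\<Phi> (scale_germs c \<gamma>) i = c * \<Phi> \<gamma> i"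
      unfolding \<Phi>_def split_beta .
  next
    fix \<gamma> assume \<gamma>: "\<gamma> \<in> abelian_relations J \<omega>" and \<Phi>0: "\<forall>i\<in>F. \<Phi> \<gamma> i = 0"
    obtain g where g: "\<forall>j\<in>J. g j analytic_on {U j \<omega>} \<and> \<gamma> j = germ_at (U j \<omega>) (g j)"
      and rel: "\<forall>\<^sub>F p in nhds \<omega>. \<forall>v. (\<Sum>j\<in>J. g j (U j p) * (Ux j p * fst v + Uy j p * snd v)) = 0"
      using \<gamma> unfolding abelian_relations_off_axes[OF \<omega>(2) J(1)] by blast
    let ?c = "\<lambda>j k. fps_nth (fps_expansion (g j) (U j \<omega>)) k"
    have gc: "germ_coeff k (\<gamma> j) = ?c j k" if "j \<in> J" for j k
      using g that germ_coeff_germ_at by metis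
    have "\<forall>j\<in>J. ?c j k = 0" for k
    proof (induction k rule: less_induct)
      case (less k)
      \<comment> \<open>the foliations whose coefficient of order \<open>k\<close> is not recorded\<close>
      define S where "S = e ` {N - k - 2..<N}"
      have S: "finite S" "S \<subseteq> J" "card S \<le> Suc k + 1"
        using eJ card_image_le[of "{N - k - 2..<N}" e] by (auto simp: S_def)
      have outside: "?c j k = 0" if "j \<in> J - S" for j
      proof -
        have "j \<in> e ` {0..<N}" using that e by (simp add: bij_betw_def)
        then obtain i where i: "i < N" "j = e i" by auto
        have "(k, i) \<in> F" using that i by (force simp: F_def S_def)
        then have "germ_coeff k (\<gamma> (e i)) = 0" using \<Phi>0 by (auto simp: \<Phi>_def)
        then show ?thesis using gc[of j k] that i by simp
      qed
      have sum0: "(\<Sum>j\<in>S. ?c j k * (Ux j \<omega> * x + Uy j \<omega> * y) ^ Suc k) = 0" for x y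
      proof -
        have "(\<Sum>j\<in>J. ?c j k * (Ux j \<omega> * x + Uy j \<omega> * y) ^ Suc k) = 0"
          by (rule leading_jets_relation[OF \<omega>(2) J(1) _ rel]) (use g less in auto)
        moreover have "(\<Sum>j\<in>J. ?c j k * (Ux j \<omega> * x + Uy j \<omega> * y) ^ Suc k) =
            (\<Sum>j\<in>S. ?c j k * (Ux j \<omega> * x + Uy j \<omega> * y) ^ Suc k)"
          by (rule sum.mono_neutral_right[OF finJ S(2)]) (use outside in auto)
        ultimately show ?thesis by simp
      qed
      have jacobian: "Ux i \<omega> * Uy j \<omega> \<noteq> Ux j \<omega> * Uy i \<omega>" if "i \<in> J" "j \<in> J" "i \<noteq> j" for i j
        using jacobian_nonzero[OF \<omega>(1) J(1) that] by (simp add: jacobian_def mult.commute)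
      have nz: "(Ux i \<omega>, Uy i \<omega>) \<noteq> (0, 0)" if i: "i \<in> J" for i
      proof -
        have "\<exists>j\<in>J. i \<noteq> j"
        proof (rule ccontr)
          assume "\<not> ?thesis"
          then have "J \<subseteq> {i}" by auto
          then have "card J \<le> card {i}" by (intro card_mono) auto
          then show False using J(2) by simp
        qed
        then show ?thesis using jacobian[OF i] by auto
      qed
      have "?c j k = 0" if "j \<in> S" for j
      proof (rule powers_of_forms_independent[OF S(1,3), where \<alpha> = "\<lambda>j. Ux j \<omega>" and \<beta> = "\<lambda>j. Uy j \<omega>"
            and c = "\<lambda>j. ?c j k" and i = j])
        show "Ux i \<omega> * Uy j \<omega> \<noteq> Ux j \<omega> * Uy i \<omega>" if "i \<in> S" "j \<in> S" "i \<noteq> j" for i j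
          using jacobian[of i j] that S(2) by (simp add: subset_iff)
        show "(Ux i \<omega>, Uy i \<omega>) \<noteq> (0, 0)" if "i \<in> S" for i
          using nz[of i] that S(2) by (simp add: subset_iff)
        show "(\<Sum>j\<in>S. ?c j k * (Ux j \<omega> * x + Uy j \<omega> * y) ^ Suc k) = 0" for x y
          by (rule sum0)
      qed (rule that)
      with outside show ?case by blast
    qed
    then have "\<gamma> j = 0" if "j \<in> J" for j
      using germ_at_eq_0_if_coeffs[of "g j" "U j \<omega>"] g that gc by metis
    then show "\<gamma> = 0" using zero_out[OF \<gamma>] by fastforce
  next
    show "finite F" unfolding F_def by auto
    show "card B = card F" using B(4) cardF N_def by simp
  qed (use B in auto)
  then show ?thesis
    unfolding maximal_rank_at_def web_rank_def using cardF N_def by simp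
qed

section \<open>Independence of iterated integrals\<close>

lemma pderiv_linear_power_mult:
  fixes A X :: "complex poly"
  assumes "pderiv X = 1"
  shows "X * pderiv (X ^ n * A) = X ^ n * (of_nat n * A + X * pderiv A)"
proof (cases n)
  case 0
  then show ?thesis by simp
next
  case (Suc m)
  have "pderiv (X ^ Suc m) = of_nat (Suc m) * X ^ m"
    by (subst pderiv_power_Suc) (simp add: assms of_nat_poly del: of_nat_Suc power_Suc)
  then show ?thesis
    unfolding Suc pderiv_mult by (simp add: algebra_simps del: of_nat_Suc)
qed

lemma poly_factor_out_root:
  fixes A :: "complex poly"
  assumes "A \<noteq> 0"
  obtains n A1 where "A = [:- r, 1:] ^ n * A1" "poly A1 r \<noteq> 0"
  using order_decomp[OF assms, of r] by (metis poly_eq_0_iff_dvd)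

text \<open>The equation says that \<open>A / B\<close> has the derivative \<open>E / D\<close>, which has a simple pole at \<open>r\<close>. With \<open>n\<close> and \<open>m\<close>
the orders of \<open>A\<close> and \<open>B\<close> at \<open>r\<close>, the factor \<open>n - m\<close> in \<open>T\<close> decides the comparison of orders.\<close>

lemma rational_derivative_has_no_simple_pole:
  fixes A B D D1 E :: "complex poly"
  assumes D: "D = [:- r, 1:] * D1" and D1: "poly D1 r \<noteq> 0" and B: "B \<noteq> 0"
    and eq: "D * (pderiv A * B - A * pderiv B) = E * B\<^sup>2" and E: "poly E r \<noteq> 0"
  shows False
proof -
  define X where "X = [:- r, 1:]"
  have X: "X \<noteq> 0" "poly X r = 0" "pderiv X = 1" by (simp_all add: X_def pderiv_pCons)
  have "A \<noteq> 0" using eq B E by auto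
  obtain n A1 where A1: "A = X ^ n * A1" "poly A1 r \<noteq> 0"
    using poly_factor_out_root[OF \<open>A \<noteq> 0\<close>] unfolding X_def .
  obtain m B1 where B1: "B = X ^ m * B1" "poly B1 r \<noteq> 0"
    using poly_factor_out_root[OF B] unfolding X_def .
  define T where "T = (of_nat n - of_nat m) * (A1 * B1) + X * (pderiv A1 * B1 - A1 * pderiv B1)"
  have "D * (pderiv A * B - A * pderiv B) = D1 * ((X * pderiv A) * B - A * (X * pderiv B))"
    unfolding D X_def[symmetric] by (simp add: algebra_simps)
  also have "\<dots> = X ^ n * X ^ m * (D1 * T)"
    unfolding A1(1) B1(1) pderiv_linear_power_mult[OF X(3)] by (simp add: T_def algebra_simps)
  finally have eq2: "X ^ n * X ^ m * (D1 * T) = X ^ m * X ^ m * (E * B1\<^sup>2)"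
    using eq by (simp add: B1(1) power_mult_distrib power2_eq_square ac_simps)
  then have eq3: "X ^ n * (D1 * T) = X ^ m * (E * B1\<^sup>2)"
    using X(1) by (simp add: ac_simps)
  show False
  proof (cases "n < m")
    case True
    then obtain k where k: "m = n + Suc k" using less_imp_Suc_add by auto
    have "X ^ m = X ^ n * X ^ Suc k" unfolding k power_add ..
    then have "X ^ n * (D1 * T) = X ^ n * (X ^ Suc k * (E * B1\<^sup>2))"
      using eq3 by (simp only: mult.assoc)
    then have "D1 * T = X ^ Suc k * (E * B1\<^sup>2)"
      using X(1) by (metis mult_left_cancel power_not_zero)
    then have "poly (D1 * T) r = 0" using X(2) by simp
    moreover have "poly T r = (of_nat n - of_nat m) * (poly A1 r * poly B1 r)"
      by (simp add: T_def X(2))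
    ultimately show False using D1 A1(2) B1(2) True by auto
  next
    case False
    then obtain k where k: "n = m + k" using le_Suc_ex not_less by blast
    from eq3 have "X ^ k * (D1 * T) = E * B1\<^sup>2"
      using X(1) unfolding k by (simp add: power_add mult.assoc)
    then have "poly (X ^ k * (D1 * T)) r = poly E r * (poly B1 r)\<^sup>2" by simp
    moreover have "poly (X ^ k * (D1 * T)) r = 0"
      using k X(2) by (cases "k = 0") (auto simp: poly_power T_def)
    ultimately show False using E B1(2) by simp
  qed
qed

text \<open>A multiple of \<open>B\<close> with the same value as \<open>A\<close> at a point where \<open>B\<close> does not vanish solves the same
first-order linear equation as \<open>A\<close>.\<close>

lemma proportional_if_wronskian_zero:
  fixes A B :: "complex poly"
  assumes B: "B \<noteq> 0" and eq: "pderiv A * B = A * pderiv B"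
  shows "\<exists>c. A = smult c B"
proof -
  obtain z where z: "poly B z \<noteq> 0" using B poly_all_0_iff_0 by blast
  define c where "c = poly A z / poly B z"
  define C where "C = A - smult c B"
  have eqC: "pderiv C * B = C * pderiv B"
    using eq by (simp add: C_def pderiv_diff pderiv_smult algebra_simps)
  have Cz: "poly C z = 0" using z by (simp add: C_def c_def)
  define X where "X = [:- z, 1:]"
  have X: "X \<noteq> 0" "poly X z = 0" "pderiv X = 1" by (simp_all add: X_def pderiv_pCons)
  have "C = 0"
  proof (rule ccontr)
    assume "C \<noteq> 0"
    then obtain n C1 where C1: "C = X ^ n * C1" "poly C1 z \<noteq> 0"
      unfolding X_def by (rule poly_factor_out_root)
    have n: "n > 0" using C1 Cz by (cases n) auto
    have "X ^ n * ((of_nat n * C1 + X * pderiv C1) * B) = (X * pderiv C) * B"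
      unfolding C1(1) pderiv_linear_power_mult[OF X(3)] by (simp only: mult.assoc)
    also have "\<dots> = X * (C * pderiv B)" using eqC by (simp only: mult.assoc)
    also have "\<dots> = X ^ n * (X * (C1 * pderiv B))"
      unfolding C1(1) by (simp only: ac_simps)
    finally have "(of_nat n * C1 + X * pderiv C1) * B = X * (C1 * pderiv B)"
      using X(1) by simp
    then have "poly ((of_nat n * C1 + X * pderiv C1) * B) z = poly (X * (C1 * pderiv B)) z"
      by (rule arg_cong)
    then show False using n C1(2) z X(2) by simp
  qed
  then show ?thesis unfolding C_def by auto
qed

lemma poly_eq_0_if_eventually:
  fixes P :: "complex poly"
  assumes "\<forall>\<^sub>F s in nhds s0. poly P s = 0"
  shows "P = 0"
proof (rule ccontr)
  assume "P \<noteq> 0"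
  then have "finite {s. poly P s = 0}" by (rule poly_roots_finite)
  moreover obtain e where "e > 0" "ball s0 e \<subseteq> {s. poly P s = 0}"
    using assms unfolding eventually_nhds_metric by (auto simp: dist_commute subset_iff)
  ultimately have "finite (ball s0 e)" using finite_subset by blast
  then show False using \<open>e > 0\<close> finite_imp_not_open[of "ball s0 e"] by auto
qed

text \<open>The letters of the iterated integrals are the forms \<open>N l / D\<close>; the hypothesis \<open>indep\<close> says that no
nontrivial combination of them is the derivative of a rational function. Induction on the length \<open>n\<close>
and on the number of words of maximal length with nonzero coefficient: if \<open>R\<close> is such a coefficient,
\<open>R\<close> times the derivative of the relation minus \<open>R'\<close> times the relation is a relation with fewer
longest words, hence trivial. Its longest words show that the top coefficients are multiples of \<open>R\<close>,
and the word obtained by deleting the first letter exhibits a combination of the letters as the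
derivative of a rational function.\<close>

lemma iterated_integrals_independent:
  fixes I :: "nat list \<Rightarrow> complex \<Rightarrow> complex" and N :: "nat \<Rightarrow> complex poly" and D :: "complex poly"
    and A :: "nat set" and P :: "nat list \<Rightarrow> complex poly"
  assumes A: "finite A" and D: "D \<noteq> 0" and I0: "I [] = (\<lambda>_. 1)"
    and I: "\<And>l w. l \<in> A \<Longrightarrow> set w \<subseteq> A \<Longrightarrow>
      \<forall>\<^sub>F s in nhds s0. I (l # w) field_differentiable at s \<and> poly D s * deriv (I (l # w)) s = poly (N l) s * I w s"
    and indep: "\<And>c P Q. Q \<noteq> 0 \<Longrightarrow>
      D * (pderiv P * Q - P * pderiv Q) = (\<Sum>l\<in>A. smult (c l) (N l)) * Q\<^sup>2 \<Longrightarrow> \<forall>l\<in>A. c l = 0"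
    and supp: "\<And>w. P w \<noteq> 0 \<Longrightarrow> set w \<subseteq> A \<and> length w \<le> n"
    and rel: "\<forall>\<^sub>F s in nhds s0. (\<Sum>w | set w \<subseteq> A \<and> length w \<le> n. poly (P w) s * I w s) = 0"
  shows "P w = 0"
  using supp rel
proof (induction n arbitrary: P w)
  case 0
  have "{w. set w \<subseteq> A \<and> length w \<le> 0} = {[]}" by auto
  then have "\<forall>\<^sub>F s in nhds s0. poly (P []) s = 0" using "0.prems"(2) by (simp add: I0)
  then have "P [] = 0" by (rule poly_eq_0_if_eventually)
  then show ?case using "0.prems"(1)[of w] by (cases w) auto
next
  case (Suc n)
  note outer = Suc.IH
  define W where "W k = {w. set w \<subseteq> A \<and> length w \<le> k}" for k
  have finW: "finite (W k)" for k unfolding W_def using A by (rule finite_lists_length_le)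
  have WSuc: "W (Suc k) = insert [] ((\<lambda>(l, u). l # u) ` (A \<times> W k))" for k
  proof (intro set_eqI)
    fix w show "w \<in> W (Suc k) \<longleftrightarrow> w \<in> insert [] ((\<lambda>(l, u). l # u) ` (A \<times> W k))"
      by (cases w) (auto simp: W_def)
  qed
  show ?case
    using Suc.prems
  proof (induction "card {w \<in> W (Suc n). length w = Suc n \<and> P w \<noteq> 0}" arbitrary: P w rule: less_induct)
    case (less P)
    let ?T = "\<lambda>P. {w \<in> W (Suc n). length w = Suc n \<and> P w \<noteq> 0}"
    have supp: "P w = 0" if "w \<notin> W (Suc n)" for w using less.prems(1) that unfolding W_def by blast
    show ?case
    proof (cases "?T P = {}")
      case True
      then have P0: "P w = 0" if "length w = Suc n" for w using supp that by blast
      have "(\<Sum>w\<in>W (Suc n). poly (P w) s * I w s) = (\<Sum>w\<in>W n. poly (P w) s * I w s)" for s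
      proof (rule sum.mono_neutral_right[OF finW])
        show "W n \<subseteq> W (Suc n)" by (auto simp: W_def)
        show "\<forall>w\<in>W (Suc n) - W n. poly (P w) s * I w s = 0"
        proof
          fix w assume "w \<in> W (Suc n) - W n"
          then have "length w = Suc n" by (auto simp: W_def)
          then show "poly (P w) s * I w s = 0" using P0 by simp
        qed
      qed
      then have rel: "\<forall>\<^sub>F s in nhds s0. (\<Sum>w | set w \<subseteq> A \<and> length w \<le> n. poly (P w) s * I w s) = 0"
        using less.prems(2) by (simp add: W_def)
      show ?thesis
      proof (rule outer[OF _ rel])
        show "set w \<subseteq> A \<and> length w \<le> n" if "P w \<noteq> 0" for w
          using less.prems(1)[OF that] P0[of w] that by (auto simp: le_Suc_eq)
      qed
    next
      case False
      then obtain v0 where v0: "v0 \<in> W (Suc n)" "length v0 = Suc n" "P v0 \<noteq> 0" by blast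
      define R where "R = P v0"
      define P' where "P' w = D * (R * pderiv (P w) - pderiv R * P w) + R * (\<Sum>l\<in>A. P (l # w) * N l)" for w
      have P'supp: "P' w = 0" if "w \<notin> W (Suc n)" for w
      proof -
        have "P (l # w) = 0" if "l \<in> A" for l using supp[of "l # w"] \<open>w \<notin> W (Suc n)\<close> by (auto simp: W_def)
        then show ?thesis using supp[OF that] by (simp add: P'_def)
      qed
      have top: "P (l # w) = 0" if "length w = Suc n" for l w using supp[of "l # w"] that by (auto simp: W_def)
      have rel': "\<forall>\<^sub>F s in nhds s0. (\<Sum>w\<in>W (Suc n). poly (P' w) s * I w s) = 0"
      proof -
        have "\<forall>\<^sub>F s in nhds s0. \<forall>w\<in>W (Suc n). w \<noteq> [] \<longrightarrow>
            I w field_differentiable at s \<and> poly D s * deriv (I w) s = poly (N (hd w)) s * I (tl w) s"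
        proof (rule eventually_ball_finite[OF finW], intro ballI)
          fix w assume "w \<in> W (Suc n)"
          then show "\<forall>\<^sub>F s in nhds s0. w \<noteq> [] \<longrightarrow>
            I w field_differentiable at s \<and> poly D s * deriv (I w) s = poly (N (hd w)) s * I (tl w) s"
            using I by (cases w) (auto simp: W_def)
        qed
        moreover have "\<forall>\<^sub>F s in nhds s0. (\<Sum>w\<in>W (Suc n). poly (P w) s * I w s) = 0"
          using less.prems(2) by (simp add: W_def)
        moreover from this have "\<forall>\<^sub>F s in nhds s0. \<forall>\<^sub>F z in nhds s. (\<Sum>w\<in>W (Suc n). poly (P w) z * I w z) = 0"
          by (simp add: eventually_eventually)
        ultimately show ?thesis
        proof eventually_elim
          case (elim s)
          have diff: "(I w has_field_derivative deriv (I w) s) (at s)" if "w \<in> W (Suc n)" for w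
            using elim(1) that I0 by (cases "w = []") (auto simp: field_differentiable_derivI)
          have "((\<lambda>z. \<Sum>w\<in>W (Suc n). poly (P w) z * I w z) has_field_derivative
              (\<Sum>w\<in>W (Suc n). poly (pderiv (P w)) s * I w s + poly (P w) s * deriv (I w) s)) (at s)"
            by (intro DERIV_sum) (auto intro!: derivative_eq_intros diff poly_DERIV)
          moreover have "((\<lambda>z. \<Sum>w\<in>W (Suc n). poly (P w) z * I w z) has_field_derivative 0) (at s)"
            using has_field_derivative_transform_within_open
            by (subst DERIV_cong_ev[OF refl elim(3) refl]) simp
          ultimately have "(\<Sum>w\<in>W (Suc n). poly (pderiv (P w)) s * I w s + poly (P w) s * deriv (I w) s) = 0"
            using DERIV_unique by blast
          then have d0: "(\<Sum>w\<in>W (Suc n). poly (D * pderiv (P w)) s * I w s) +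
              (\<Sum>w\<in>W (Suc n). poly (P w) s * (poly D s * deriv (I w) s)) = 0"
          proof -
            assume z: "(\<Sum>w\<in>W (Suc n). poly (pderiv (P w)) s * I w s + poly (P w) s * deriv (I w) s) = 0"
            have "(\<Sum>w\<in>W (Suc n). poly (D * pderiv (P w)) s * I w s) +
                (\<Sum>w\<in>W (Suc n). poly (P w) s * (poly D s * deriv (I w) s)) =
                poly D s * (\<Sum>w\<in>W (Suc n). poly (pderiv (P w)) s * I w s + poly (P w) s * deriv (I w) s)"
              unfolding sum_distrib_left sum.distrib[symmetric]
              by (intro sum.cong refl) (simp add: algebra_simps)
            then show ?thesis unfolding z by simp
          qed
          have inj: "inj_on (\<lambda>(l, u). l # u) (A \<times> W n)" by (auto simp: inj_on_def)
          have "(\<Sum>w\<in>W (Suc n). poly (P w) s * (poly D s * deriv (I w) s))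
              = (\<Sum>w\<in>(\<lambda>(l, u). l # u) ` (A \<times> W n). poly (P w) s * (poly D s * deriv (I w) s))"
            unfolding WSuc using finW A
            by (subst sum.insert) (auto simp: I0)
          also have "\<dots> = (\<Sum>(l, u)\<in>A \<times> W n. poly (P (l # u)) s * (poly (N l) s * I u s))"
            using elim(1) unfolding sum.reindex[OF inj] WSuc by (intro sum.cong) auto
          also have "\<dots> = (\<Sum>u\<in>W n. poly (\<Sum>l\<in>A. P (l # u) * N l) s * I u s)"
            unfolding sum.cartesian_product[symmetric]
            by (subst sum.swap) (simp add: poly_sum sum_distrib_right mult.assoc)
          also have "\<dots> = (\<Sum>u\<in>W (Suc n). poly (\<Sum>l\<in>A. P (l # u) * N l) s * I u s)"
          proof (rule sum.mono_neutral_left[OF finW])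
            show "W n \<subseteq> W (Suc n)" by (auto simp: W_def)
            show "\<forall>u\<in>W (Suc n) - W n. poly (\<Sum>l\<in>A. P (l # u) * N l) s * I u s = 0"
            proof
              fix u assume "u \<in> W (Suc n) - W n"
              then have "length u = Suc n" by (auto simp: W_def)
              then show "poly (\<Sum>l\<in>A. P (l # u) * N l) s * I u s = 0" using top by simp
            qed
          qed
          finally have d1: "(\<Sum>w\<in>W (Suc n). poly (D * pderiv (P w)) s * I w s) +
              (\<Sum>u\<in>W (Suc n). poly (\<Sum>l\<in>A. P (l # u) * N l) s * I u s) = 0"
            using d0 by simp
          have "(\<Sum>w\<in>W (Suc n). poly (P' w) s * I w s) =
              poly R s * ((\<Sum>w\<in>W (Suc n). poly (D * pderiv (P w)) s * I w s) +
                (\<Sum>u\<in>W (Suc n). poly (\<Sum>l\<in>A. P (l # u) * N l) s * I u s))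
              - poly (D * pderiv R) s * (\<Sum>w\<in>W (Suc n). poly (P w) s * I w s)"
            unfolding sum_distrib_left sum.distrib[symmetric] sum_subtractf[symmetric]
            by (intro sum.cong refl) (simp add: P'_def algebra_simps)
          then show ?case using d1 elim(2) by simp
        qed
      qed
      have P'0: "P' w = 0" for w
      proof (rule less.hyps[of P'])
        have "?T P' \<subseteq> ?T P - {v0}"
        proof
          fix w assume w: "w \<in> ?T P'"
          then have "P' w = D * (R * pderiv (P w) - pderiv R * P w)" using top by (simp add: P'_def)
          then show "w \<in> ?T P - {v0}" using w by (auto simp: R_def mult.commute)
        qed
        then have "?T P' \<subset> ?T P" using v0 by blast
        then show "card (?T P') < card (?T P)"
          by (rule psubset_card_mono[rotated]) (use finW in auto)
        show "set w \<subseteq> A \<and> length w \<le> Suc n" if "P' w \<noteq> 0" for w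
          using P'supp that by (auto simp: W_def)
        show "\<forall>\<^sub>F s in nhds s0. (\<Sum>w | set w \<subseteq> A \<and> length w \<le> Suc n. poly (P' w) s * I w s) = 0"
          using rel' by (simp add: W_def)
      qed
      have R: "R \<noteq> 0" using v0 by (simp add: R_def)
      obtain l0 v where v: "v0 = l0 # v" using v0(2) by (cases v0) auto
      have lv: "l0 \<in> A" "length v = n" using v0 v by (auto simp: W_def)
      have "\<exists>c. P (l # v) = smult c R" for l
      proof (rule proportional_if_wronskian_zero[OF R])
        have "D * (R * pderiv (P (l # v)) - pderiv R * P (l # v)) = 0"
          using P'0[of "l # v"] top[of "l # v"] lv by (simp add: P'_def)
        then show "pderiv (P (l # v)) * R = P (l # v) * pderiv R" using D by (simp add: mult.commute)
      qed
      then obtain c where c: "P (l # v) = smult (c l) R" for l by metis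
      have "D * (pderiv (P v) * R - P v * pderiv R) = (\<Sum>l\<in>A. smult (- c l) (N l)) * R\<^sup>2"
      proof -
        have "0 = D * (R * pderiv (P v) - pderiv R * P v) + R * (\<Sum>l\<in>A. smult (c l) R * N l)"
          using P'0[of v] unfolding P'_def c by simp
        moreover have "R * (\<Sum>l\<in>A. smult (c l) R * N l) = - ((\<Sum>l\<in>A. smult (- c l) (N l)) * R\<^sup>2)"
          by (simp add: sum_distrib_left sum_distrib_right power2_eq_square sum_negf ac_simps)
        ultimately show ?thesis by (simp add: ac_simps)
      qed
      from indep[OF R this] lv have "c l0 = 0" by simp
      then have "P v0 = 0" using c[of l0] v by simp
      with v0 show ?thesis by blast
    qed
  qed
qed

text \<open>The form of a letter that has its pole at the base point \<open>a\<close> is replaced by 0, so that all iterated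
integrals based at \<open>a\<close> exist; such letters never occur in the relations.\<close>

definition letter_form :: "complex \<Rightarrow> nat \<Rightarrow> complex \<Rightarrow> complex" where
  "letter_form a l z = (if l \<in> {0, 1} \<and> a \<noteq> of_nat l then 1 / (z - of_nat l) else 0)"

definition letter_radius :: "complex \<Rightarrow> real" where
  "letter_radius a = (if a = 0 \<or> a = 1 then 1 else min (norm a) (norm (a - 1)))"

lemma letter_radius_pos: "letter_radius a > 0" by (simp add: letter_radius_def)

lemma ball_letter_radius_avoids: "z \<in> ball a (letter_radius a) \<Longrightarrow> l \<in> {0, 1::nat} \<Longrightarrow> a \<noteq> of_nat l \<Longrightarrow> z \<noteq> of_nat l"
  by (auto simp: letter_radius_def dist_norm split: if_splits)

text \<open>The first letter of the word is the one that differentiation removes. Every nonempty word gives a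
function that vanishes at the base point.\<close>

fun iterated_integral :: "complex \<Rightarrow> nat list \<Rightarrow> complex \<Rightarrow> complex" where
  "iterated_integral a [] = (\<lambda>_. 1)"
| "iterated_integral a (l # w) = (SOME F. F a = 0 \<and>
     (\<forall>z\<in>ball a (letter_radius a). (F has_field_derivative letter_form a l z * iterated_integral a w z) (at z)))"

lemma letter_form_holomorphic: "letter_form a l holomorphic_on ball a (letter_radius a)"
proof (cases "l \<in> {0, 1} \<and> a \<noteq> of_nat l")
  case True
  then have "letter_form a l = (\<lambda>z. 1 / (z - of_nat l))" by (simp add: letter_form_def fun_eq_iff)
  then show ?thesis
    using True ball_letter_radius_avoids[of _ a l] by (auto intro!: holomorphic_intros)
next
  case False
  then have "letter_form a l = (\<lambda>z. 0)" by (auto simp: letter_form_def fun_eq_iff)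
  then show ?thesis by simp
qed

lemma iterated_integral_spec:
  "iterated_integral a w holomorphic_on ball a (letter_radius a) \<and>
   iterated_integral a (l # w) a = 0 \<and>
   (\<forall>z\<in>ball a (letter_radius a). (iterated_integral a (l # w) has_field_derivative letter_form a l z * iterated_integral a w z) (at z))"
proof (induction w arbitrary: l)
  have prim: "iterated_integral a (l # w) a = 0 \<and>
      (\<forall>z\<in>ball a (letter_radius a). (iterated_integral a (l # w) has_field_derivative letter_form a l z * iterated_integral a w z) (at z))"
    if hol: "iterated_integral a w holomorphic_on ball a (letter_radius a)" for l w
  proof -
    have "(\<lambda>z. letter_form a l z * iterated_integral a w z) holomorphic_on ball a (letter_radius a)"
      using hol letter_form_holomorphic by (intro holomorphic_on_mult)
    then obtain G where G: "\<And>z. z \<in> ball a (letter_radius a) \<Longrightarrow>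
        (G has_field_derivative letter_form a l z * iterated_integral a w z) (at z within ball a (letter_radius a))"
      using holomorphic_convex_primitive'[of "ball a (letter_radius a)"] by auto
    then have "((\<lambda>z. G z - G a) has_field_derivative letter_form a l z * iterated_integral a w z) (at z)"
      if "z \<in> ball a (letter_radius a)" for z
      using G[OF that] that by (auto intro!: derivative_eq_intros simp: at_within_open[OF that])
    then have "\<exists>F. F a = 0 \<and> (\<forall>z\<in>ball a (letter_radius a). (F has_field_derivative letter_form a l z * iterated_integral a w z) (at z))"
      by (intro exI[of _ "\<lambda>z. G z - G a"]) auto
    from someI_ex[OF this] show ?thesis by simp
  qed
  case Nil
  have "iterated_integral a [] holomorphic_on ball a (letter_radius a)" by simp
  then show ?case using prim by blast
  case (Cons m w)
  have "iterated_integral a (m # w) holomorphic_on ball a (letter_radius a)"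
    using Cons[of m] by (auto simp: holomorphic_on_open simp del: iterated_integral.simps)
  then show ?case using prim by blast
qed

declare iterated_integral.simps(2) [simp del]

lemma iterated_integral_base [simp]: "iterated_integral a (l # w) a = 0"
  using iterated_integral_spec by blast

lemma iterated_integral_DERIV:
  "z \<in> ball a (letter_radius a) \<Longrightarrow> (iterated_integral a (l # w) has_field_derivative letter_form a l z * iterated_integral a w z) (at z)"
  using iterated_integral_spec by blast

lemma iterated_integral_holomorphic: "iterated_integral a w holomorphic_on ball a (letter_radius a)"
  using iterated_integral_spec by blast

text \<open>The branch of the square root near \<open>s0\<^sup>2\<close> with value \<open>s0\<close> at that point.\<close>

definition local_sqrt :: "complex \<Rightarrow> complex \<Rightarrow> complex" where
  "local_sqrt s0 z = s0 * csqrt (z / s0\<^sup>2)"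

text \<open>Components of abelian relations are combinations of these functions: the letters 0 and 1 stand for
\<open>dz / z\<close> and \<open>dz / (z - 1)\<close>, the letters 2 and 3 for the differentials of \<open>z\<close> and \<open>- 1 / z\<close>, and the
letter 4 for the differential of \<open>2 artanh (sqrt z)\<close>. The base point is given by a square root \<open>s\<close> of it, to
fix the branch in the last case.\<close>

definition basis_function :: "complex \<Rightarrow> nat list \<Rightarrow> complex \<Rightarrow> complex" where
  "basis_function s w z = (case w of [] \<Rightarrow> 0 | l # u \<Rightarrow>
     if l = 2 then 1
     else if l = 3 then 1 / z\<^sup>2
     else if l = 4 then 1 / (local_sqrt s z * (1 - z))
     else letter_form (s\<^sup>2) l z * iterated_integral (s\<^sup>2) u z)"

lemma basis_function_simps [simp]:
  "basis_function s [2] z = 1" "basis_function s [3] z = 1 / z\<^sup>2" "basis_function s [4] z = 1 / (local_sqrt s z * (1 - z))"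
  "basis_function s (0 # u) z = letter_form (s\<^sup>2) 0 z * iterated_integral (s\<^sup>2) u z"
  "basis_function s (Suc 0 # u) z = letter_form (s\<^sup>2) 1 z * iterated_integral (s\<^sup>2) u z"
  by (simp_all add: basis_function_def)

lemma local_sqrt_square:
  assumes "s0 \<noteq> 0"
  shows "\<forall>\<^sub>F s in nhds s0. local_sqrt s0 (s\<^sup>2) = s"
proof -
  have "((\<lambda>s. Re (s / s0)) \<longlongrightarrow> Re (s0 / s0)) (nhds s0)"
    by (intro tendsto_intros filterlim_ident assms)
  moreover have "Re (s0 / s0) > 0" using assms by simp
  ultimately have "\<forall>\<^sub>F s in nhds s0. Re (s / s0) \<in> {0<..}"
    by (intro topological_tendstoD[of _ "Re (s0 / s0)"]) auto
  then show ?thesis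
  proof eventually_elim
    case (elim s)
    then have "csqrt ((s / s0)\<^sup>2) = s / s0" by (intro csqrt_square) simp
    then show ?case using assms by (simp add: local_sqrt_def power_divide)
  qed
qed

lemma local_sqrt_base: "s0 \<noteq> 0 \<Longrightarrow> local_sqrt s0 (s0\<^sup>2) = s0"
  by (simp add: local_sqrt_def)

lemma local_sqrt_squared: "s0 \<noteq> 0 \<Longrightarrow> (local_sqrt s0 z)\<^sup>2 = z"
  by (simp add: local_sqrt_def power_mult_distrib)

lemma local_sqrt_analytic: "s0 \<noteq> 0 \<Longrightarrow> local_sqrt s0 analytic_on {s0\<^sup>2}"
  unfolding local_sqrt_def[abs_def] by (auto intro!: analytic_intros analytic_on_csqrt' simp: complex_nonpos_Reals_iff)

text \<open>The letters 2, 3 and 4 occur as one-letter words only. Iterated integrals of length 3 suffice.\<close>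

definition admissible :: "complex \<Rightarrow> nat list \<Rightarrow> bool" where
  "admissible a w \<longleftrightarrow> w = [2] \<or> w = [3] \<or> (w = [4] \<and> a \<noteq> 1) \<or>
     (w \<noteq> [] \<and> length w \<le> 3 \<and> set w \<subseteq> {0, 1} \<and> (1 \<in> set w \<longrightarrow> a \<noteq> 1))"

lemma basis_function_analytic:
  assumes "s \<noteq> 0" "admissible (s\<^sup>2) w"
  shows "basis_function s w analytic_on {s\<^sup>2}"
proof -
  consider "w = [2]" | "w = [3]" | "w = [4]" "s\<^sup>2 \<noteq> 1" | l u where "w = l # u" "l \<in> {0, 1}"
    using assms(2) unfolding admissible_def by (cases w) auto
  then show ?thesis
  proof cases
    case 1
    then show ?thesis by (simp add: basis_function_def[abs_def])
  next
    case 2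
    then show ?thesis using assms by (auto simp: basis_function_def[abs_def] intro!: analytic_intros)
  next
    case 3
    then show ?thesis using assms
      by (auto simp: basis_function_def[abs_def] local_sqrt_base intro!: analytic_intros local_sqrt_analytic)
  next
    case 4
    then have "basis_function s w = (\<lambda>z. letter_form (s\<^sup>2) l z * iterated_integral (s\<^sup>2) u z)" by (auto simp: basis_function_def fun_eq_iff)
    moreover have "(\<lambda>z. letter_form (s\<^sup>2) l z * iterated_integral (s\<^sup>2) u z) holomorphic_on ball (s\<^sup>2) (letter_radius (s\<^sup>2))"
      by (intro holomorphic_on_mult letter_form_holomorphic iterated_integral_holomorphic)
    ultimately show ?thesis
      using letter_radius_pos by (metis analytic_at centre_in_ball open_ball)
  qed
qed

text \<open>In the variable \<open>s = sqrt z\<close> all coefficients become rational, with poles at 0 and at the square roots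
of 1, and the letters become \<open>2 ds / s\<close> and \<open>2 s ds / (s\<^sup>2 - 1)\<close>, which have independent residues at 0
and 1. Multiplication by \<open>s ^ 4 * (s\<^sup>2 - 1)\<close> clears the denominators.\<close>

lemma basis_function_independent:
  assumes s0: "s0 \<noteq> 0"
    and supp: "\<And>w. d w \<noteq> 0 \<Longrightarrow> admissible (s0\<^sup>2) w"
    and S: "finite S" "\<And>w. d w \<noteq> 0 \<Longrightarrow> w \<in> S"
    and rel: "\<forall>\<^sub>F z in nhds (s0\<^sup>2). (\<Sum>w\<in>S. d w * basis_function s0 w z) = 0"
  shows "d w = 0"
proof -
  define a where "a = s0\<^sup>2"
  have a0: "a \<noteq> 0" using s0 by (simp add: a_def)
  define A where "A = {l \<in> {0, 1::nat}. a \<noteq> of_nat l}"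
  have A01: "0 \<in> A" "A \<subseteq> {0, 1}" "1 \<in> A \<longleftrightarrow> a \<noteq> 1" "finite A" using a0 by (auto simp: A_def)
  define I where "I w = (\<lambda>s. iterated_integral a w (s\<^sup>2))" for w
  define N :: "nat \<Rightarrow> complex poly" where "N l = (if l = 0 then [:- 2, 0, 2:] else [:0, 0, 2:])" for l
  define D :: "complex poly" where "D = [:0, - 1, 0, 1:]"
  define P :: "nat list \<Rightarrow> complex poly" where
    "P u = (if length u \<le> 2 then smult (d (0 # u)) [:0, 0, - 1, 0, 1:] + smult (d (1 # u)) [:0, 0, 0, 0, 1:]
       + (if u = [] then smult (d [2]) [:0, 0, 0, 0, - 1, 0, 1:] + smult (d [3]) [:- 1, 0, 1:]
            + smult (d [4]) [:0, 0, 0, - 1:] else 0) else 0)" for u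
  define Wd where "Wd = {w. set w \<subseteq> A \<and> length w \<le> 2}"
  have finWd: "finite Wd" unfolding Wd_def using A01(4) by (rule finite_lists_length_le)
  \<comment> \<open>a word outside \<open>Wd\<close> is too long or has a letter with a pole at the base point\<close>
  have dA: "d (l # u) = 0" if "u \<notin> Wd" "l \<in> {0, 1}" for l u
  proof (rule ccontr)
    assume "d (l # u) \<noteq> 0"
    from supp[OF this] that show False
      using a0 by (auto simp: admissible_def Wd_def A_def a_def[symmetric])
  qed
  have P0: "P w = 0" for w
  proof (rule iterated_integrals_independent[of A D I N s0 P 2 w])
    show "finite A" "D \<noteq> 0" "I [] = (\<lambda>_. 1)" using A01 by (simp_all add: D_def I_def)
  next
    fix l w assume l: "l \<in> A" "set w \<subseteq> A"
    have "\<forall>\<^sub>F s in nhds s0. s\<^sup>2 \<in> ball a (letter_radius a)"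
      using letter_radius_pos[of a] by (intro eventually_compose_filterlim[OF eventually_nhds_in_open])
        (auto simp: a_def intro!: tendsto_intros filterlim_ident)
    then show "\<forall>\<^sub>F s in nhds s0. I (l # w) field_differentiable at s \<and>
        poly D s * deriv (I (l # w)) s = poly (N l) s * I w s"
    proof eventually_elim
      case (elim s)
      have der: "(I (l # w) has_field_derivative letter_form a l (s\<^sup>2) * iterated_integral a w (s\<^sup>2) * (2 * s)) (at s)"
        unfolding I_def by (rule DERIV_chain2[where g = "\<lambda>s. s\<^sup>2", OF iterated_integral_DERIV[OF elim]]) (auto intro!: derivative_eq_intros)
      have "s\<^sup>2 \<noteq> of_nat l" using ball_letter_radius_avoids[OF elim, of l] l by (auto simp: A_def)
      then have "poly D s * (letter_form a l (s\<^sup>2) * (2 * s)) = poly (N l) s"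
        using l(1) by (auto simp: letter_form_def A_def D_def N_def divide_simps power2_eq_square algebra_simps)
      then have "poly D s * (letter_form a l (s\<^sup>2) * iterated_integral a w (s\<^sup>2) * (2 * s)) = poly (N l) s * I w s"
        unfolding I_def by (metis mult.assoc mult.commute)
      then show ?case using der by (auto simp: field_differentiable_def DERIV_imp_deriv)
    qed
  next
    fix c and Q1 Q :: "complex poly"
    assume Q: "Q \<noteq> 0" and eq: "D * (pderiv Q1 * Q - Q1 * pderiv Q) = (\<Sum>l\<in>A. smult (c l) (N l)) * Q\<^sup>2"
    let ?E = "\<Sum>l\<in>A. smult (c l) (N l)"
    have E: "poly ?E r = (\<Sum>l\<in>A. c l * poly (N l) r)" for r by (simp add: poly_sum)
    have Dr: "D = [:- 0, 1:] * [:- 1, 0, 1:]" "D = [:- 1, 1:] * [:0, 1, 1:]" by (simp_all add: D_def)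
    have "poly ?E 0 = 0"
      using rational_derivative_has_no_simple_pole[OF Dr(1) _ Q eq] by auto
    moreover have "poly ?E 1 = 0"
      using rational_derivative_has_no_simple_pole[OF Dr(2) _ Q eq] by auto
    moreover have "poly ?E 0 = c 0 * (- 2)"
      unfolding E using A01 by (subst sum.remove[of A 0]) (auto simp: N_def intro!: sum.neutral)
    moreover have "poly ?E 1 = c 1 * 2" if "1 \<in> A"
      unfolding E using A01 that by (subst sum.remove[of A 1]) (auto simp: N_def intro!: sum.neutral)
    ultimately show "\<forall>l\<in>A. c l = 0" using A01(2) by auto
  next
    fix w assume "P w \<noteq> 0"
    then have "length w \<le> 2" "w = [] \<or> d (0 # w) \<noteq> 0 \<or> d (1 # w) \<noteq> 0"
      by (auto simp: P_def split: if_splits)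
    then show "set w \<subseteq> A \<and> length w \<le> 2" using dA[of w] by (auto simp: Wd_def)
  next
    have "\<forall>\<^sub>F s in nhds s0. s\<^sup>2 \<in> ball a (letter_radius a)"
      using letter_radius_pos[of a] by (intro eventually_compose_filterlim[OF eventually_nhds_in_open])
        (auto simp: a_def intro!: tendsto_intros filterlim_ident)
    moreover have "\<forall>\<^sub>F s in nhds s0. (\<Sum>w\<in>S. d w * basis_function s0 w (s\<^sup>2)) = 0"
      by (rule eventually_compose_filterlim[OF rel]) (auto intro!: tendsto_intros filterlim_ident)
    ultimately show "\<forall>\<^sub>F s in nhds s0. (\<Sum>w | set w \<subseteq> A \<and> length w \<le> 2. poly (P w) s * I w s) = 0"
      using local_sqrt_square[OF s0]
    proof eventually_elim
      case (elim s)
      let ?X = "s ^ 4 * (s\<^sup>2 - 1)"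
      have s: "s \<noteq> 0" using ball_letter_radius_avoids[OF elim(1), of 0] a0 by auto
      have s1: "s\<^sup>2 \<noteq> 1" if "a \<noteq> 1" using ball_letter_radius_avoids[OF elim(1), of 1] that by auto
      define B where "B = {[2], [3], [4]} \<union> (\<lambda>(l, u). l # u) ` ({0, 1} \<times> Wd)"
      have BS: "(\<Sum>w\<in>S. d w * basis_function s0 w (s\<^sup>2)) = (\<Sum>w\<in>B. d w * basis_function s0 w (s\<^sup>2))"
      proof (rule sum.mono_neutral_cong)
        show "finite S" "finite B" using S finWd by (auto simp: B_def)
        show "d w * basis_function s0 w (s\<^sup>2) = 0" if "w \<in> B - S" for w using S(2)[of w] that by auto
        show "d w * basis_function s0 w (s\<^sup>2) = 0" if w: "w \<in> S - B" for w
        proof (cases w)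
          case (Cons l u)
          have "d w = 0"
          proof (rule ccontr)
            assume nz: "d w \<noteq> 0"
            from supp[OF this] w Cons have l: "l \<in> {0, 1}" by (auto simp: admissible_def B_def)
            then have "u \<notin> Wd" using w Cons by (auto simp: B_def)
            then show False using dA[of u l] l nz Cons by auto
          qed
          then show ?thesis by simp
        qed (simp add: basis_function_def)
      qed simp
      have disj: "{[2], [3], [4]} \<inter> (\<lambda>(l, u). l # u) ` ({0, 1::nat} \<times> Wd) = {}" by auto
      have inj: "inj_on (\<lambda>(l, u). l # u) ({0, 1::nat} \<times> Wd)" by (auto simp: inj_on_def)
      have split: "(\<Sum>w\<in>B. d w * basis_function s0 w (s\<^sup>2)) =
          d [2] * basis_function s0 [2] (s\<^sup>2) + d [3] * basis_function s0 [3] (s\<^sup>2) + d [4] * basis_function s0 [4] (s\<^sup>2) +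
          (\<Sum>u\<in>Wd. d (0 # u) * basis_function s0 (0 # u) (s\<^sup>2) + d (1 # u) * basis_function s0 (1 # u) (s\<^sup>2))"
      proof -
        have "(\<Sum>w\<in>B. d w * basis_function s0 w (s\<^sup>2)) =
            (\<Sum>w\<in>{[2], [3], [4]}. d w * basis_function s0 w (s\<^sup>2)) +
            (\<Sum>w\<in>(\<lambda>(l, u). l # u) ` ({0, 1} \<times> Wd). d w * basis_function s0 w (s\<^sup>2))"
          unfolding B_def by (rule sum.union_disjoint) (use finWd disj in auto)
        also have "(\<Sum>w\<in>(\<lambda>(l, u). l # u) ` ({0, 1} \<times> Wd). d w * basis_function s0 w (s\<^sup>2)) =
            (\<Sum>(l, u)\<in>{0, 1} \<times> Wd. d (l # u) * basis_function s0 (l # u) (s\<^sup>2))"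
          unfolding sum.reindex[OF inj] by (intro sum.cong) auto
        also have "\<dots> = (\<Sum>u\<in>Wd. \<Sum>l\<in>{0, 1}. d (l # u) * basis_function s0 (l # u) (s\<^sup>2))"
          unfolding sum.cartesian_product[symmetric] by (rule sum.swap)
        finally show ?thesis by (simp add: add.assoc)
      qed
      have d1: "d (1 # u) = 0" if "a = 1" for u
      proof (rule ccontr)
        assume "d (1 # u) \<noteq> 0"
        from supp[OF this] show False using that by (auto simp: admissible_def a_def)
      qed
      have d4: "d [4] = 0" if "a = 1"
      proof (rule ccontr)
        assume "d [4] \<noteq> 0"
        from supp[OF this] show False using that by (auto simp: admissible_def a_def)
      qed
      have e0: "?X * (d (0 # u) * basis_function s0 (0 # u) (s\<^sup>2)) = d (0 # u) * (s ^ 4 - s\<^sup>2) * I u s" for u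
        using s a0 by (simp add: letter_form_def I_def a_def[symmetric] divide_simps) (simp add: algebra_simps power2_eq_square power4_eq_xxxx)
      have e1: "?X * (d (1 # u) * basis_function s0 (1 # u) (s\<^sup>2)) = d (1 # u) * s ^ 4 * I u s" for u
        using s1 d1 by (cases "a = 1") (auto simp: letter_form_def I_def a_def[symmetric] divide_simps)
      have e2: "?X * (d [2] * basis_function s0 [2] (s\<^sup>2)) = d [2] * (s ^ 6 - s ^ 4)"
        by (simp add: algebra_simps flip: power_add)
      have e3: "?X * (d [3] * basis_function s0 [3] (s\<^sup>2)) = d [3] * (s\<^sup>2 - 1)"
        using s by (simp add: divide_simps flip: power_mult)
      have e4: "?X * (d [4] * basis_function s0 [4] (s\<^sup>2)) = d [4] * (- (s ^ 3))"
      proof (cases "a = 1")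
        case False
        then have "s\<^sup>2 \<noteq> 1" using s1 by simp
        then show ?thesis using s elim(3)
          by (simp add: divide_simps) (simp add: algebra_simps power2_eq_square power3_eq_cube power4_eq_xxxx)
      qed (use d4 in simp)
      have "(\<Sum>w\<in>Wd. poly (P w) s * I w s) =
          (\<Sum>u\<in>Wd. d (0 # u) * (s ^ 4 - s\<^sup>2) * I u s + d (1 # u) * s ^ 4 * I u s
            + (if u = [] then d [2] * (s ^ 6 - s ^ 4) + d [3] * (s\<^sup>2 - 1) + d [4] * (- (s ^ 3)) else 0))"
        by (intro sum.cong refl)
           (auto simp: P_def Wd_def I_def algebra_simps power2_eq_square power3_eq_cube power4_eq_xxxx eval_nat_numeral)
      also have "\<dots> = (\<Sum>u\<in>Wd. d (0 # u) * (s ^ 4 - s\<^sup>2) * I u s + d (1 # u) * s ^ 4 * I u s)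
          + (d [2] * (s ^ 6 - s ^ 4) + d [3] * (s\<^sup>2 - 1) + d [4] * (- (s ^ 3)))"
        using finWd by (simp add: sum.distrib sum.delta Wd_def)
      also have "\<dots> = ?X * (\<Sum>w\<in>S. d w * basis_function s0 w (s\<^sup>2))"
        unfolding BS split distrib_left sum_distrib_left e0 e1 e2 e3 e4 by (simp add: algebra_simps)
      finally show ?case using elim(2) by (simp add: Wd_def)
    qed
  qed
  have cf: "coeff (P u) k = 0" for u k using P0[of u] by simp
  have "d (0 # u) = 0 \<and> d (1 # u) = 0" for u
  proof (cases "length u \<le> 2")
    case True
    show ?thesis
    proof (cases "u = []")
      case True
      then show ?thesis using cf[of "[]" 0] cf[of "[]" 2] cf[of "[]" 4] cf[of "[]" 6]
        by (simp add: P_def eval_nat_numeral)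
    next
      case False
      then show ?thesis using True cf[of u 2] cf[of u 4] by (simp add: P_def eval_nat_numeral)
    qed
  next
    case False
    then have "u \<notin> Wd" by (auto simp: Wd_def)
    then show ?thesis using dA by simp
  qed
  moreover have "d [2] = 0" "d [3] = 0" "d [4] = 0"
    using cf[of "[]" 0] cf[of "[]" 3] cf[of "[]" 6] by (simp_all add: P_def eval_nat_numeral)
  ultimately have D: "d (0 # u) = 0" "d (1 # u) = 0" "d [2] = 0" "d [3] = 0" "d [4] = 0" for u
    by auto
  show "d w = 0"
  proof (rule ccontr)
    assume nz: "d w \<noteq> 0"
    have "w \<noteq> [2]" "w \<noteq> [3]" "w \<noteq> [4]" using nz D by metis+
    with supp[OF nz] obtain l u where "w = l # u" "l \<in> {0, 1}"
      unfolding admissible_def by (cases w) auto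
    then show False using nz D by auto
  qed
qed

section \<open>Relations between iterated integrals\<close>

text \<open>A term \<open>(k, j, w)\<close> stands for \<open>k\<close> times the basis function of the word \<open>w\<close>, applied to \<open>U j\<close>.\<close>

type_synonym rel_terms = "(int \<times> nat \<times> nat list) list"

definition term_sum :: "rel_terms \<Rightarrow> (nat \<Rightarrow> nat list \<Rightarrow> complex) \<Rightarrow> complex" where
  "term_sum ts F = (\<Sum>(k, j, w)\<leftarrow>ts. of_int k * F j w)"

lemma term_sum_Nil [simp]: "term_sum [] F = 0"
  and term_sum_Cons [simp]: "term_sum ((k, j, w) # ts) F = of_int k * F j w + term_sum ts F"
  by (simp_all add: term_sum_def)

lemma term_sum_cong:
  assumes "\<And>k j w. (k, j, w) \<in> set ts \<Longrightarrow> F j w = G j w"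
  shows "term_sum ts F = term_sum ts G"
  using assms by (induction ts) (auto, fastforce)

lemma term_sum_mult_right: "term_sum ts (\<lambda>j w. F j w * c) = term_sum ts F * c"
  by (induction ts) (auto simp: algebra_simps)

lemma term_sum_sum: "finite I \<Longrightarrow> term_sum ts (\<lambda>j w. \<Sum>i\<in>I. F i j w) = (\<Sum>i\<in>I. term_sum ts (F i))"
  by (induction ts) (auto simp: sum.distrib sum_distrib_left)

definition term_coeff :: "rel_terms \<Rightarrow> nat \<Rightarrow> nat list \<Rightarrow> int" where
  "term_coeff ts j w = (\<Sum>(k, j', w')\<leftarrow>ts. if j' = j \<and> w' = w then k else 0)"

text \<open>The component of foliation \<open>j\<close> of the abelian relation described by a list of terms; \<open>rt j\<close> is a square
root of the base point of this component.\<close>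

definition component :: "(nat \<Rightarrow> complex) \<Rightarrow> rel_terms \<Rightarrow> nat \<Rightarrow> complex \<Rightarrow> complex" where
  "component rt ts j z = term_sum ts (\<lambda>j' w. if j' = j then basis_function (rt j) w z else 0)"

lemma component_eq_sum_term_coeff:
  assumes "finite S" "\<And>k w. (k, j, w) \<in> set ts \<Longrightarrow> w \<in> S"
  shows "component rt ts j z = (\<Sum>w\<in>S. of_int (term_coeff ts j w) * basis_function (rt j) w z)"
  using assms(2)
proof (induction ts)
  case Nil
  then show ?case by (simp add: component_def term_coeff_def)
next
  case (Cons t ts)
  obtain k j' w' where t: "t = (k, j', w')" by (cases t)
  have IH: "component rt ts j z = (\<Sum>w\<in>S. of_int (term_coeff ts j w) * basis_function (rt j) w z)"
    using Cons by auto
  have c: "of_int (term_coeff (t # ts) j w) * basis_function (rt j) w z =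
      (if w = w' then (if j' = j then of_int k * basis_function (rt j) w' z else 0) else 0)
      + of_int (term_coeff ts j w) * basis_function (rt j) w z" for w
    by (simp add: term_coeff_def t algebra_simps)
  have "(\<Sum>w\<in>S. of_int (term_coeff (t # ts) j w) * basis_function (rt j) w z) =
      (if w' \<in> S then (if j' = j then of_int k * basis_function (rt j) w' z else 0) else 0) + component rt ts j z"
    unfolding c sum.distrib IH using assms(1) by simp
  also have "\<dots> = component rt (t # ts) j z"
    using Cons.prems[of k w'] by (auto simp: component_def t)
  finally show ?case by simp
qed

definition germs_of_terms :: "(nat \<Rightarrow> complex) \<Rightarrow> rel_terms \<Rightarrow> nat \<Rightarrow> germ" where
  "germs_of_terms rt ts = (\<lambda>j. germ_at ((rt j)\<^sup>2) (component rt ts j))"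

definition terms_ok :: "nat set \<Rightarrow> complex \<times> complex \<Rightarrow> rel_terms \<Rightarrow> bool" where
  "terms_ok J \<omega> ts \<longleftrightarrow> (\<forall>(k, j, w)\<in>set ts. j \<in> J \<and> admissible (U j \<omega>) w)"

definition rel_holds :: "(nat \<Rightarrow> complex) \<Rightarrow> complex \<times> complex \<Rightarrow> rel_terms \<Rightarrow> bool" where
  "rel_holds rt \<omega> ts \<longleftrightarrow> (\<forall>\<^sub>F p in nhds \<omega>. \<forall>v.
     term_sum ts (\<lambda>j w. basis_function (rt j) w (U j p) * (Ux j p * fst v + Uy j p * snd v)) = 0)"

lemma germs_of_terms_in_abelian_relations:
  assumes \<omega>: "\<omega> \<in> off_axes" and J: "J \<subseteq> {1..9}"
    and rt: "\<And>j. j \<in> J \<Longrightarrow> rt j \<noteq> 0 \<and> (rt j)\<^sup>2 = U j \<omega>"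
    and ok: "terms_ok J \<omega> ts" and rel: "rel_holds rt \<omega> ts"
  shows "germs_of_terms rt ts \<in> abelian_relations J \<omega>"
proof -
  have finJ: "finite J" using J finite_subset by blast
  have out: "component rt ts j z = 0" if "j \<notin> J" for j z
  proof -
    have "component rt ts j z = term_sum ts (\<lambda>_ _. 0)"
      unfolding component_def using ok that by (intro term_sum_cong) (auto simp: terms_ok_def)
    also have "\<dots> = 0" by (induction ts) auto
    finally show ?thesis .
  qed
  have an: "component rt ts j analytic_on {U j \<omega>}" if j: "j \<in> J" for j
    using ok
  proof (induction ts)
    case Nil
    then show ?case by (simp add: component_def[abs_def])
  next
    case (Cons t ts)
    obtain k j' w where t: "t = (k, j', w)" by (cases t)
    have IH: "component rt ts j analytic_on {U j \<omega>}" using Cons by (auto simp: terms_ok_def)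
    have adm: "admissible (U j \<omega>) w" if "j' = j" using Cons.prems that by (auto simp: t terms_ok_def)
    have eq: "component rt (t # ts) j = (\<lambda>z. of_int k * (if j' = j then basis_function (rt j) w z else 0) + component rt ts j z)"
      by (simp add: component_def fun_eq_iff t)
    show ?case
    proof (cases "j' = j")
      case True
      have "basis_function (rt j) w analytic_on {U j \<omega>}"
        using basis_function_analytic[of "rt j" w] rt[OF j] adm[OF True] by simp
      then show ?thesis unfolding eq using True IH by (auto intro!: analytic_intros)
    qed (use IH eq in \<open>simp add: eta_contract_eq\<close>)
  qed
  have "\<forall>\<^sub>F p in nhds \<omega>. \<forall>v. (\<Sum>j\<in>J. component rt ts j (U j p) * (Ux j p * fst v + Uy j p * snd v)) = 0"
    using rel unfolding rel_holds_def
  proof (rule eventually_mono, intro allI)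
    fix p v
    assume *: "\<forall>v. term_sum ts (\<lambda>j w. basis_function (rt j) w (U j p) * (Ux j p * fst v + Uy j p * snd v)) = 0"
    have "(\<Sum>j\<in>J. component rt ts j (U j p) * (Ux j p * fst v + Uy j p * snd v)) =
        term_sum ts (\<lambda>j' w. \<Sum>j\<in>J. (if j' = j then basis_function (rt j) w (U j p) else 0) * (Ux j p * fst v + Uy j p * snd v))"
      unfolding term_sum_sum[OF finJ] term_sum_mult_right component_def ..
    also have "\<dots> = term_sum ts (\<lambda>j w. basis_function (rt j) w (U j p) * (Ux j p * fst v + Uy j p * snd v))"
    proof (rule term_sum_cong)
      fix k j' w assume "(k, j', w) \<in> set ts"
      then have "j' \<in> J" using ok by (auto simp: terms_ok_def)
      have "(\<Sum>j\<in>J. (if j' = j then basis_function (rt j) w (U j p) else 0) * (Ux j p * fst v + Uy j p * snd v)) =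
          (\<Sum>j\<in>J. if j' = j then basis_function (rt j) w (U j p) * (Ux j p * fst v + Uy j p * snd v) else 0)"
        by (intro sum.cong) auto
      then show "(\<Sum>j\<in>J. (if j' = j then basis_function (rt j) w (U j p) else 0) * (Ux j p * fst v + Uy j p * snd v)) =
          basis_function (rt j') w (U j' p) * (Ux j' p * fst v + Uy j' p * snd v)"
        using \<open>j' \<in> J\<close> finJ by simp
    qed
    finally show "(\<Sum>j\<in>J. component rt ts j (U j p) * (Ux j p * fst v + Uy j p * snd v)) = 0" using * by simp
  qed
  then show ?thesis
    unfolding abelian_relations_off_axes[OF \<omega> J] germs_of_terms_def
  proof (intro conjI allI impI exI[of _ "component rt ts"] ballI)
    show "germ_at ((rt j)\<^sup>2) (component rt ts j) = 0" if "j \<notin> J" for j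
    proof -
      have "component rt ts j = (\<lambda>_. 0)" using out[OF that] by (simp add: fun_eq_iff)
      then show ?thesis by (simp add: germ_at_zero)
    qed
  qed (use an rt in auto)
qed

text \<open>The matrix of coefficients of the relations, restricted to the pivots, is triangular with nonzero
diagonal.\<close>

definition triangular :: "rel_terms list \<Rightarrow> (nat \<times> nat list) list \<Rightarrow> bool" where
  "triangular rels piv \<longleftrightarrow> length piv = length rels \<and>
     (\<forall>i<length rels. term_coeff (rels ! i) (fst (piv ! i)) (snd (piv ! i)) \<noteq> 0 \<and>
       (\<forall>i'\<in>{i<..<length rels}. term_coeff (rels ! i') (fst (piv ! i)) (snd (piv ! i)) = 0))"

lemma germ_at_eq_0_iff: "germ_at a f = 0 \<longleftrightarrow> (\<forall>\<^sub>F z in nhds a. f z = 0)"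
proof -
  have "germ_at a f = 0 \<longleftrightarrow> (\<forall>\<^sub>F t in nhds 0. f (a + t) = 0)"
    unfolding germ_at_def zero_germ_def by (simp add: germ.abs_eq_iff)
  also have "\<dots> \<longleftrightarrow> (\<forall>\<^sub>F z in nhds a. f z = 0)"
  proof
    assume "\<forall>\<^sub>F t in nhds 0. f (a + t) = 0"
    then have "\<forall>\<^sub>F z in nhds a. f (a + (z - a)) = 0"
      by (rule eventually_compose_filterlim) (auto intro!: tendsto_eq_intros filterlim_ident)
    then show "\<forall>\<^sub>F z in nhds a. f z = 0" by simp
  next
    assume "\<forall>\<^sub>F z in nhds a. f z = 0"
    then show "\<forall>\<^sub>F t in nhds 0. f (a + t) = 0"
      by (rule eventually_compose_filterlim) (auto intro!: tendsto_eq_intros filterlim_ident)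
  qed
  finally show ?thesis .
qed

lemma sum_fun_apply: "finite I \<Longrightarrow> (\<Sum>i\<in>I. f i) x = (\<Sum>i\<in>I. f i x :: 'a :: comm_monoid_add)"
  by (induction I rule: finite_induct) auto

lemma sum_germs:
  "finite I \<Longrightarrow> (\<Sum>i\<in>I. scale_germ (c i) (germ_at a (h i))) = germ_at a (\<lambda>z. \<Sum>i\<in>I. c i * h i z)"
proof (induction I rule: finite_induct)
  case empty
  then show ?case using germ_at_zero[of a] by simp
next
  case (insert i I)
  show ?case
    unfolding sum.insert[OF insert(1,2)] insert.IH
    unfolding germ_at_scale germ_at_add ..
qed

text \<open>Independence of the basis functions reduces a vanishing combination of relations to a system of linear
equations for \<open>c\<close>, one for each foliation and word; the pivots solve it by forward substitution.\<close>

lemma germs_of_terms_family_independent: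
  assumes J: "J \<subseteq> {1..9}"
    and rt: "\<And>j. j \<in> J \<Longrightarrow> rt j \<noteq> 0 \<and> (rt j)\<^sup>2 = U j \<omega>"
    and ok: "\<And>ts. ts \<in> set rels \<Longrightarrow> terms_ok J \<omega> ts"
    and tri: "triangular rels piv"
    and pivJ: "fst ` set piv \<subseteq> J"
    and zero: "(\<Sum>i<length rels. scale_germs (c i) (germs_of_terms rt (rels ! i))) = 0"
    and i: "i < length rels"
  shows "c i = 0"
proof -
  let ?m = "length rels"
  \<comment> \<open>the coefficient of each basis function in the combination\<close>
  define d where "d j w = (\<Sum>i<?m. c i * of_int (term_coeff (rels ! i) j w))" for j w
  have d0: "d j w = 0" if j: "j \<in> J" for j w
  proof -
    define S where "S = (\<lambda>(k, j, w). w) ` (\<Union>ts\<in>set rels. set ts)"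
    have finS: "finite S" by (simp add: S_def)
    have memS: "w \<in> S" if "ts \<in> set rels" "(k, j, w) \<in> set ts" for ts k w
      unfolding S_def by (rule image_eqI[of _ _ "(k, j, w)"]) (use that in auto)
    have "(\<Sum>i<?m. scale_germs (c i) (germs_of_terms rt (rels ! i))) j = 0"
      unfolding zero by simp
    then have "(\<Sum>i<?m. scale_germ (c i) (germ_at ((rt j)\<^sup>2) (component rt (rels ! i) j))) = 0"
      by (simp add: scale_germs_def germs_of_terms_def sum_fun_apply)
    then have "\<forall>\<^sub>F z in nhds ((rt j)\<^sup>2). (\<Sum>i<?m. c i * component rt (rels ! i) j z) = 0"
      by (simp add: sum_germs germ_at_eq_0_iff)
    moreover have "(\<Sum>i<?m. c i * component rt (rels ! i) j z) = (\<Sum>w\<in>S. d j w * basis_function (rt j) w z)" for z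
    proof -
      have "(\<Sum>i<?m. c i * component rt (rels ! i) j z) =
          (\<Sum>i<?m. \<Sum>w\<in>S. c i * (of_int (term_coeff (rels ! i) j w) * basis_function (rt j) w z))"
      proof (intro sum.cong refl)
        fix i assume "i \<in> {..<?m}"
        then have "component rt (rels ! i) j z = (\<Sum>w\<in>S. of_int (term_coeff (rels ! i) j w) * basis_function (rt j) w z)"
          by (intro component_eq_sum_term_coeff[OF finS] memS) auto
        then show "c i * component rt (rels ! i) j z =
            (\<Sum>w\<in>S. c i * (of_int (term_coeff (rels ! i) j w) * basis_function (rt j) w z))"
          by (simp add: sum_distrib_left)
      qed
      also have "\<dots> = (\<Sum>w\<in>S. d j w * basis_function (rt j) w z)"
        by (subst sum.swap) (simp add: d_def sum_distrib_right mult.assoc)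
      finally show ?thesis .
    qed
    ultimately have rel: "\<forall>\<^sub>F z in nhds ((rt j)\<^sup>2). (\<Sum>w\<in>S. d j w * basis_function (rt j) w z) = 0" by simp
    have mem: "\<exists>ts\<in>set rels. \<exists>k. (k, j, w) \<in> set ts" if "d j w \<noteq> 0" for w
    proof (rule ccontr)
      assume neg: "\<not> ?thesis"
      have "term_coeff ts j w = 0" if "ts \<in> set rels" for ts
      proof -
        have "\<forall>k. (k, j, w) \<notin> set ts" using neg that by blast
        then show ?thesis unfolding term_coeff_def by (induction ts) fastforce+
      qed
      then have "d j w = 0" unfolding d_def by (intro sum.neutral) auto
      with that show False by simp
    qed
    show ?thesis
    proof (rule basis_function_independent[OF _ _ finS _ rel])
      show "rt j \<noteq> 0" using rt j by blast
      show "admissible ((rt j)\<^sup>2) w" if "d j w \<noteq> 0" for w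
      proof -
        obtain ts k where ts: "ts \<in> set rels" "(k, j, w) \<in> set ts" using mem[OF \<open>d j w \<noteq> 0\<close>] by blast
        from ok[OF ts(1)] ts(2) rt[OF j] show ?thesis by (auto simp: terms_ok_def)
      qed
      show "w \<in> S" if "d j w \<noteq> 0" for w
        using mem[OF that] memS by blast
    qed
  qed
  show ?thesis
    using i
  proof (induction i rule: less_induct)
    case (less i)
    let ?p = "piv ! i"
    have "fst ?p \<in> J" using pivJ tri less.prems by (auto simp: triangular_def subset_iff)
    then have "0 = (\<Sum>i'<?m. c i' * of_int (term_coeff (rels ! i') (fst ?p) (snd ?p)))"
      using d0 by (simp add: d_def)
    also have "\<dots> = (\<Sum>i'\<in>{i}. c i' * of_int (term_coeff (rels ! i') (fst ?p) (snd ?p)))"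
    proof (rule sum.mono_neutral_right)
      show "\<forall>i'\<in>{..<?m} - {i}. c i' * of_int (term_coeff (rels ! i') (fst ?p) (snd ?p)) = 0"
      proof
        fix i' assume i': "i' \<in> {..<?m} - {i}"
        show "c i' * of_int (term_coeff (rels ! i') (fst ?p) (snd ?p)) = 0"
        proof (cases "i' < i")
          case True
          then show ?thesis using less by simp
        next
          case False
          then have "i' \<in> {i<..<?m}" using i' by auto
          then show ?thesis using tri less.prems by (simp add: triangular_def)
        qed
      qed
    qed (use less.prems in auto)
    finally show "c i = 0" using tri less.prems by (simp add: triangular_def)
  qed
qed

lemma maximal_rank_from_relations:
  assumes \<omega>: "\<omega> \<in> regular_locus J" "\<omega> \<in> off_axes" and J: "J \<subseteq> {1..9}" "2 \<le> card J"
    and rt: "\<And>j. j \<in> J \<Longrightarrow> rt j \<noteq> 0 \<and> (rt j)\<^sup>2 = U j \<omega>"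
    and rels: "\<And>ts. ts \<in> set rels \<Longrightarrow> terms_ok J \<omega> ts \<and> rel_holds rt \<omega> ts"
    and tri: "triangular rels piv" "fst ` set piv \<subseteq> J"
    and len: "length rels = (card J - 1) * (card J - 2) div 2"
  shows "maximal_rank_at J \<omega>"
proof -
  interpret vector_space scale_germs by (rule vector_space_scale_germs)
  define f where "f i = germs_of_terms rt (rels ! i)" for i
  let ?I = "{..<length rels}"
  have ind: "c i = 0" if "(\<Sum>i\<in>?I. scale_germs (c i) (f i)) = 0" "i \<in> ?I" for c i
    using germs_of_terms_family_independent[OF J(1) rt _ tri, of c i] rels that by (auto simp: f_def)
  have inj: "inj_on f ?I"
  proof (rule inj_onI, rule ccontr)
    fix i i' assume *: "i \<in> ?I" "i' \<in> ?I" "f i = f i'" "i \<noteq> i'"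
    define c :: "nat \<Rightarrow> complex" where "c = (\<lambda>_. 0)(i := 1, i' := - 1)"
    have "(\<Sum>l\<in>?I. scale_germs (c l) (f l)) = (\<Sum>l\<in>{i, i'}. scale_germs (c l) (f l))"
      using * by (intro sum.mono_neutral_right) (auto simp: c_def)
    also have "\<dots> = 0" using *(3,4) by (simp add: c_def scale_minus_left)
    finally have "c i = 0" using ind * by blast
    then show False using *(4) by (simp add: c_def)
  qed
  have indep: "independent (f ` ?I)"
  proof (subst dependent_finite)
    show "\<not> (\<exists>u. (\<exists>v\<in>f ` ?I. u v \<noteq> 0) \<and> (\<Sum>v\<in>f ` ?I. scale_germs (u v) v) = 0)"
    proof
      assume "\<exists>u. (\<exists>v\<in>f ` ?I. u v \<noteq> 0) \<and> (\<Sum>v\<in>f ` ?I. scale_germs (u v) v) = 0"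
      then obtain u i where u: "i \<in> ?I" "u (f i) \<noteq> 0" "(\<Sum>v\<in>f ` ?I. scale_germs (u v) v) = 0" by blast
      then have "(\<Sum>i\<in>?I. scale_germs (u (f i)) (f i)) = 0" by (simp add: sum.reindex[OF inj])
      with ind[of "\<lambda>i. u (f i)"] u show False by blast
    qed
  qed simp
  show ?thesis
  proof (rule maximal_rank_if_independent[OF \<omega> J _ indep])
    show "f ` ?I \<subseteq> abelian_relations J \<omega>"
      using germs_of_terms_in_abelian_relations[OF \<omega>(2) J(1) rt] rels by (auto simp: f_def)
    show "card (f ` ?I) = (card J - 1) * (card J - 2) div 2"
      using card_image[OF inj] len by simp
  qed simp
qed

text \<open>The orders of \<open>U j\<close> (for \<open>l = 0\<close>) and of \<open>U j - 1\<close> (for \<open>l = 1\<close>) along the zero sets of \<open>x\<close>, \<open>y\<close>, \<open>x - 1\<close>,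
\<open>y - 1\<close>, \<open>x - y\<close>, \<open>x * y - 1\<close>.\<close>

definition letter_exponents :: "nat \<Rightarrow> nat \<Rightarrow> int list" where
  "letter_exponents j l = (if l = 0 then
     [[1,0,0,0,0,0], [0,1,0,0,0,0], [1,-1,0,0,0,0], [0,0,-1,1,0,0], [1,-1,-1,1,0,0],
      [1,1,0,0,0,0], [1,0,-1,1,0,0], [0,-1,-1,1,0,0], [1,-1,-2,2,0,0]] ! (j - 1)
   else
     [[0,0,1,0,0,0], [0,0,0,1,0,0], [0,-1,0,0,1,0], [0,0,-1,0,1,0], [0,-1,-1,0,1,0],
      [0,0,0,0,0,1], [0,0,-1,0,0,1], [0,-1,-1,0,0,1], [0,-1,-2,0,1,1]] ! (j - 1))"

text \<open>The logarithmic differentials of the six polynomials to which \<open>letter_exponents\<close> refers, in the same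
order.\<close>

definition dlog_form :: "nat \<Rightarrow> complex \<times> complex \<Rightarrow> complex \<times> complex \<Rightarrow> complex" where
  "dlog_form L = (\<lambda>(x, y) (u, v).
     [u / x, v / y, u / (x - 1), v / (y - 1), (u - v) / (x - y), (y * u + x * v) / (x * y - 1)] ! L)"

lemma U_minus_1:
  assumes "(x, y) \<in> off_axes"
  shows "U 1 (x, y) - 1 = x - 1" "U 2 (x, y) - 1 = y - 1" "U 3 (x, y) - 1 = (x - y) / y"
    "U 4 (x, y) - 1 = - ((x - y) / (x - 1))" "U 5 (x, y) - 1 = - ((x - y) / (y * (x - 1)))"
    "U 6 (x, y) - 1 = x * y - 1" "U 7 (x, y) - 1 = - ((x * y - 1) / (x - 1))"
    "U 8 (x, y) - 1 = - ((x * y - 1) / (y * (x - 1)))"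
    "U 9 (x, y) - 1 = - ((x - y) * (x * y - 1) / (y * (x - 1)\<^sup>2))"
proof -
  have *: "x \<noteq> 0" "y \<noteq> 0" "x - 1 \<noteq> 0" "1 - x \<noteq> 0" using assms by (auto simp: off_axes_def)
  have sq: "(1 - x)\<^sup>2 = (x - 1)\<^sup>2" by (simp add: power2_eq_square algebra_simps)
  show "U 1 (x, y) - 1 = x - 1" "U 2 (x, y) - 1 = y - 1" "U 6 (x, y) - 1 = x * y - 1" by simp_all
  show "U 3 (x, y) - 1 = (x - y) / y" using * by (simp add: divide_simps)
  show "U 4 (x, y) - 1 = - ((x - y) / (x - 1))"
    using * by (simp add: divide_simps) (simp add: algebra_simps)
  show "U 5 (x, y) - 1 = - ((x - y) / (y * (x - 1)))"
    using * by (simp add: divide_simps) (simp add: algebra_simps)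
  show "U 7 (x, y) - 1 = - ((x * y - 1) / (x - 1))"
    using * by (simp add: divide_simps) (simp add: algebra_simps)
  show "U 8 (x, y) - 1 = - ((x * y - 1) / (y * (x - 1)))"
    using * by (simp add: divide_simps) (simp add: algebra_simps)
  show "U 9 (x, y) - 1 = - ((x - y) * (x * y - 1) / (y * (x - 1)\<^sup>2))"
    using * by (simp add: divide_simps sq) (simp add: algebra_simps power2_eq_square)
qed

lemma sum_lessThan_6: "(\<Sum>L<6::nat. f L) = f 0 + f 1 + f 2 + f 3 + f 4 + (f 5 :: complex)"
  by (simp add: eval_nat_numeral)

lemma letter_pullback:
  assumes p: "p \<in> off_axes" and j: "j \<in> {1..9}" and l: "l \<in> {0, 1}" and ne: "U j p \<noteq> of_nat l"
  shows "(Ux j p * fst v + Uy j p * snd v) / (U j p - of_nat l) = (\<Sum>L<6. of_int (letter_exponents j l ! L) * dlog_form L p v)"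
proof -
  obtain x y where xy: "p = (x, y)" by (cases p)
  obtain a b where ab: "v = (a, b)" by (cases v)
  have *: "x \<noteq> 0" "y \<noteq> 0" "x - 1 \<noteq> 0" "1 - x \<noteq> 0" "y - 1 \<noteq> 0" "1 - y \<noteq> 0" "x \<noteq> 1" "y \<noteq> 1"
    using p by (auto simp: off_axes_def xy)
  note M = sum_lessThan_6 dlog_form_def xy ab letter_exponents_def Ux_def Uy_def x_factor_def y_factor_def x_factor_deriv_def y_factor_deriv_def
  show ?thesis
  proof (cases "l = 0")
    case True
    then show ?thesis using j * unfolding web_index_cases
      by (elim disjE; simp add: M; simp add: divide_simps power2_eq_square power3_eq_cube; simp add: algebra_simps)
  next
    case False
    then have l1: "l = 1" using l by simp
    have nz: "U j (x, y) - 1 \<noteq> 0" using ne l1 xy by simp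
    note U1 = U_minus_1[OF p[unfolded xy]]
    let ?goal = "\<lambda>j. (Ux j (x, y) * a + Uy j (x, y) * b) / (U j (x, y) - 1) =
        (\<Sum>L<6. of_int (letter_exponents j 1 ! L) * dlog_form L (x, y) (a, b))"
    have "?goal j" using j nz unfolding web_index_cases
    proof (elim disjE)
      assume j: "j = 1" and nz: "U j (x, y) - 1 \<noteq> 0"
      from * show "?goal j" unfolding j U1(1)
        by (simp add: M; (simp add: divide_simps power2_eq_square power3_eq_cube)?; (simp add: algebra_simps)?)
    next
      assume j: "j = 2" and nz: "U j (x, y) - 1 \<noteq> 0"
      from * show "?goal j" unfolding j U1(2)
        by (simp add: M; (simp add: divide_simps power2_eq_square power3_eq_cube)?; (simp add: algebra_simps)?)
    next
      assume j: "j = 3" and nz: "U j (x, y) - 1 \<noteq> 0"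
      have "x - y \<noteq> 0" using nz U1(3) unfolding j by auto
      with * show "?goal j" unfolding j U1(3)
        by (simp add: M; (simp add: divide_simps power2_eq_square power3_eq_cube)?; (simp add: algebra_simps)?)
    next
      assume j: "j = 4" and nz: "U j (x, y) - 1 \<noteq> 0"
      have "x - y \<noteq> 0" using nz U1(4) unfolding j by auto
      with * show "?goal j" unfolding j U1(4)
        by (simp add: M; (simp add: divide_simps power2_eq_square power3_eq_cube)?; (simp add: algebra_simps)?)
    next
      assume j: "j = 5" and nz: "U j (x, y) - 1 \<noteq> 0"
      have "x - y \<noteq> 0" using nz U1(5) unfolding j by auto
      with * show "?goal j" unfolding j U1(5)
        by (simp add: M; (simp add: divide_simps power2_eq_square power3_eq_cube)?; (simp add: algebra_simps)?)
    next
      assume j: "j = 6" and nz: "U j (x, y) - 1 \<noteq> 0"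
      have "x * y - 1 \<noteq> 0" using nz U1(6) unfolding j by auto
      with * show "?goal j" unfolding j U1(6)
        by (simp add: M; (simp add: divide_simps power2_eq_square power3_eq_cube)?; (simp add: algebra_simps)?)
    next
      assume j: "j = 7" and nz: "U j (x, y) - 1 \<noteq> 0"
      have "x * y - 1 \<noteq> 0" using nz U1(7) unfolding j by auto
      with * show "?goal j" unfolding j U1(7)
        by (simp add: M; (simp add: divide_simps power2_eq_square power3_eq_cube)?; (simp add: algebra_simps)?)
    next
      assume j: "j = 8" and nz: "U j (x, y) - 1 \<noteq> 0"
      have "x * y - 1 \<noteq> 0" using nz U1(8) unfolding j by auto
      with * show "?goal j" unfolding j U1(8)
        by (simp add: M; (simp add: divide_simps power2_eq_square power3_eq_cube)?; (simp add: algebra_simps)?)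
    next
      assume j: "j = 9" and nz: "U j (x, y) - 1 \<noteq> 0"
      have "x - y \<noteq> 0" "x * y - 1 \<noteq> 0" using nz U1(9) unfolding j by auto
      with * show "?goal j" unfolding j U1(9)
        by (simp add: M; (simp add: divide_simps power2_eq_square power3_eq_cube)?; (simp add: algebra_simps)?)
    qed
    then show ?thesis by (simp add: l1 xy ab)
  qed
qed

text \<open>The coefficient of the \<open>L\<close>-th logarithmic differential in the differential of a combination of iterated
integrals.\<close>

definition strip_letter :: "nat \<Rightarrow> rel_terms \<Rightarrow> rel_terms" where
  "strip_letter L ts = filter (\<lambda>t. fst t \<noteq> 0) (map (\<lambda>(k, j, w). (k * letter_exponents j (hd w) ! L, j, tl w)) ts)"

text \<open>The symbol of a combination of iterated integrals of length \<open>n\<close> is zero.\<close>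

fun symbol_vanishes :: "nat \<Rightarrow> rel_terms \<Rightarrow> bool" where
  "symbol_vanishes 0 ts \<longleftrightarrow> sum_list (map fst ts) = 0"
| "symbol_vanishes (Suc n) ts \<longleftrightarrow> list_all (\<lambda>L. symbol_vanishes n (strip_letter L ts)) [0..<6]"

lemma term_sum_strip_letter: "term_sum (strip_letter L ts) F = term_sum ts (\<lambda>j w. of_int (letter_exponents j (hd w) ! L) * F j (tl w))"
  by (induction ts) (auto simp: strip_letter_def)

definition log_terms :: "complex \<times> complex \<Rightarrow> nat \<Rightarrow> rel_terms \<Rightarrow> bool" where
  "log_terms \<omega> n ts \<longleftrightarrow> (\<forall>(k, j, w)\<in>set ts. j \<in> {1..9} \<and> length w = n \<and> set w \<subseteq> {0, 1} \<and>
     (\<forall>l\<in>set w. U j \<omega> \<noteq> of_nat l))"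

lemma log_terms_strip_letter:
  assumes "log_terms \<omega> (Suc n) ts"
  shows "log_terms \<omega> n (strip_letter L ts)"
  unfolding log_terms_def
proof (intro ballI)
  fix t assume "t \<in> set (strip_letter L ts)"
  then obtain k j w where t: "(k, j, w) \<in> set ts" "t = (k * letter_exponents j (hd w) ! L, j, tl w)"
    by (auto simp: strip_letter_def)
  then have w: "j \<in> {1..9}" "length w = Suc n" "set w \<subseteq> {0, 1}" "\<forall>l\<in>set w. U j \<omega> \<noteq> of_nat l"
    using assms unfolding log_terms_def by (auto simp only: split: prod.splits)
  then obtain l u where "w = l # u" by (cases w) auto
  with w t(2) show "case t of (k, j, w) \<Rightarrow> j \<in> {1..9} \<and> length w = n \<and> set w \<subseteq> {0, 1} \<and>
     (\<forall>l\<in>set w. U j \<omega> \<noteq> of_nat l)" by simp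
qed

text \<open>On such a neighbourhood the iterated integrals based at the points \<open>U j \<omega>\<close> can be composed with the \<open>U j\<close>.\<close>

definition tame_nbhd :: "complex \<times> complex \<Rightarrow> (complex \<times> complex) set \<Rightarrow> bool" where
  "tame_nbhd \<omega> B \<longleftrightarrow> open B \<and> convex B \<and> \<omega> \<in> B \<and> B \<subseteq> off_axes \<and>
     (\<forall>p\<in>B. \<forall>j\<in>{1..9}. U j p \<in> ball (U j \<omega>) (letter_radius (U j \<omega>)))"

lemma tame_nbhd_exists:
  assumes "\<omega> \<in> off_axes"
  shows "\<exists>B. tame_nbhd \<omega> B"
proof -
  have "\<forall>\<^sub>F p in nhds \<omega>. U j p \<in> ball (U j \<omega>) (letter_radius (U j \<omega>))" if "j \<in> {1..9}" for j
  proof -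
    have "isCont (U j) \<omega>"
      using has_derivative_U[OF that off_axes_not_polar[OF assms that]] has_derivative_continuous by blast
    then show ?thesis
      using letter_radius_pos[of "U j \<omega>"] by (intro topological_tendstoD) (auto simp: isCont_def tendsto_nhds_iff)
  qed
  then have "\<forall>\<^sub>F p in nhds \<omega>. \<forall>j\<in>{1..9}. U j p \<in> ball (U j \<omega>) (letter_radius (U j \<omega>))"
    by (intro eventually_ball_finite) auto
  moreover have "\<forall>\<^sub>F p in nhds \<omega>. p \<in> off_axes"
    using open_off_axes assms by (simp add: eventually_nhds_in_open)
  ultimately have "\<forall>\<^sub>F p in nhds \<omega>. p \<in> off_axes \<and> (\<forall>j\<in>{1..9}. U j p \<in> ball (U j \<omega>) (letter_radius (U j \<omega>)))"
    by eventually_elim auto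
  then obtain e where "e > 0" "\<And>p. dist p \<omega> < e \<Longrightarrow> p \<in> off_axes \<and> (\<forall>j\<in>{1..9}. U j p \<in> ball (U j \<omega>) (letter_radius (U j \<omega>)))"
    unfolding eventually_nhds_metric by blast
  then have "tame_nbhd \<omega> (ball \<omega> e)"
    by (auto simp: tame_nbhd_def dist_commute)
  then show ?thesis ..
qed

lemma log_form_pullback:
  assumes B: "tame_nbhd \<omega> B" "p \<in> B" and ts: "log_terms \<omega> (Suc n) ts"
  shows "term_sum ts (\<lambda>j w. letter_form (U j \<omega>) (hd w) (U j p) * iterated_integral (U j \<omega>) (tl w) (U j p) *
      (Ux j p * fst v + Uy j p * snd v)) =
    (\<Sum>L<6. dlog_form L p v * term_sum (strip_letter L ts) (\<lambda>j w. iterated_integral (U j \<omega>) w (U j p)))"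
proof -
  have "term_sum ts (\<lambda>j w. letter_form (U j \<omega>) (hd w) (U j p) * iterated_integral (U j \<omega>) (tl w) (U j p) *
      (Ux j p * fst v + Uy j p * snd v)) =
    term_sum ts (\<lambda>j w. \<Sum>L<6. of_int (letter_exponents j (hd w) ! L) * iterated_integral (U j \<omega>) (tl w) (U j p) * dlog_form L p v)"
  proof (rule term_sum_cong)
    fix k j w assume mem: "(k, j, w) \<in> set ts"
    then have *: "j \<in> {1..9} \<and> length w = Suc n \<and> set w \<subseteq> {0, 1} \<and> (\<forall>l\<in>set w. U j \<omega> \<noteq> of_nat l)"
      using ts unfolding log_terms_def by (auto simp only: split: prod.splits)
    then have "hd w \<in> set w" by (intro hd_in_set) auto
    with * have j: "j \<in> {1..9}" and h: "hd w \<in> {0, 1}" "U j \<omega> \<noteq> of_nat (hd w)" by blast+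
    have "U j p \<in> ball (U j \<omega>) (letter_radius (U j \<omega>))" using B j by (auto simp: tame_nbhd_def)
    then have ne: "U j p \<noteq> of_nat (hd w)" using ball_letter_radius_avoids h by blast
    have "p \<in> off_axes" using B by (auto simp: tame_nbhd_def)
    from letter_pullback[OF this j h(1) ne, of v]
    have letter_form: "letter_form (U j \<omega>) (hd w) (U j p) * (Ux j p * fst v + Uy j p * snd v) =
        (\<Sum>L<6. of_int (letter_exponents j (hd w) ! L) * dlog_form L p v)"
      using h by (simp add: letter_form_def)
    have "letter_form (U j \<omega>) (hd w) (U j p) * iterated_integral (U j \<omega>) (tl w) (U j p) * (Ux j p * fst v + Uy j p * snd v)
        = iterated_integral (U j \<omega>) (tl w) (U j p) *
          (letter_form (U j \<omega>) (hd w) (U j p) * (Ux j p * fst v + Uy j p * snd v))"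
      by (simp only: ac_simps)
    also have "\<dots> = iterated_integral (U j \<omega>) (tl w) (U j p) * (\<Sum>L<6. of_int (letter_exponents j (hd w) ! L) * dlog_form L p v)"
      unfolding letter_form ..
    finally show "letter_form (U j \<omega>) (hd w) (U j p) * iterated_integral (U j \<omega>) (tl w) (U j p) * (Ux j p * fst v + Uy j p * snd v)
        = (\<Sum>L<6. of_int (letter_exponents j (hd w) ! L) * iterated_integral (U j \<omega>) (tl w) (U j p) * dlog_form L p v)"
      by (simp add: sum_distrib_left ac_simps)
  qed
  also have "\<dots> = (\<Sum>L<6. dlog_form L p v * term_sum (strip_letter L ts) (\<lambda>j w. iterated_integral (U j \<omega>) w (U j p)))"
    unfolding term_sum_sum[OF finite_lessThan] term_sum_mult_right term_sum_strip_letter by (intro sum.cong refl mult.commute)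
  finally show ?thesis .
qed

lemma term_sum_has_derivative:
  assumes "\<And>k j w. (k, j, w) \<in> set ts \<Longrightarrow> (F j w has_derivative F' j w) (at p)"
  shows "((\<lambda>p. term_sum ts (\<lambda>j w. F j w p)) has_derivative (\<lambda>v. term_sum ts (\<lambda>j w. F' j w v))) (at p)"
  using assms
proof (induction ts)
  case (Cons t ts)
  obtain k j w where t: "t = (k, j, w)" by (cases t)
  have "((\<lambda>p. term_sum ts (\<lambda>j w. F j w p)) has_derivative (\<lambda>v. term_sum ts (\<lambda>j w. F' j w v))) (at p)"
  proof (rule Cons.IH)
    show "(F j w has_derivative F' j w) (at p)" if "(k, j, w) \<in> set ts" for k j w
      by (rule Cons.prems[of k]) (use that in simp)
  qed
  moreover have "(F j w has_derivative F' j w) (at p)" by (rule Cons.prems[of k]) (simp add: t)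
  ultimately show ?case unfolding t term_sum_Cons
    by (intro has_derivative_add has_derivative_mult_right)
qed simp

text \<open>The value at \<open>\<omega>\<close> is zero, because iterated integrals are zero at their base point. The differential is a
combination of the six logarithmic differentials whose coefficients have shorter words and are zero by
induction.\<close>

lemma vanishing_symbol:
  assumes B: "tame_nbhd \<omega> B" and "log_terms \<omega> n ts" "symbol_vanishes n ts" "p \<in> B"
  shows "term_sum ts (\<lambda>j w. iterated_integral (U j \<omega>) w (U j p)) = 0"
  using assms(2-)
proof (induction n arbitrary: ts p)
  case 0
  have "term_sum ts (\<lambda>j w. iterated_integral (U j \<omega>) w (U j p)) = term_sum ts (\<lambda>_ _. 1)"
    using "0.prems"(1) by (intro term_sum_cong) (auto simp: log_terms_def)
  also have "\<dots> = of_int (sum_list (map fst ts))" by (induction ts) auto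
  finally show ?case using "0.prems"(2) by simp
next
  case (Suc n)
  define f where "f q = term_sum ts (\<lambda>j w. iterated_integral (U j \<omega>) w (U j q))" for q
  have der: "(f has_derivative (\<lambda>v. 0)) (at q within B)" if q: "q \<in> B" for q
  proof -
    have "(f has_derivative (\<lambda>v. term_sum ts (\<lambda>j w. letter_form (U j \<omega>) (hd w) (U j q) * iterated_integral (U j \<omega>) (tl w) (U j q) *
        (Ux j q * fst v + Uy j q * snd v)))) (at q)"
      unfolding f_def
    proof (rule term_sum_has_derivative)
      fix k j w assume mem: "(k, j, w) \<in> set ts"
      then have j: "j \<in> {1..9}" and "length w = Suc n"
        using Suc.prems(1) by (auto simp: log_terms_def)
      then obtain l u where w: "w = l # u" by (cases w) auto
      have Uq: "U j q \<in> ball (U j \<omega>) (letter_radius (U j \<omega>))" and "q \<in> off_axes"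
        using B q j by (auto simp: tame_nbhd_def)
      have dU: "(U j has_derivative (\<lambda>v. Ux j q * fst v + Uy j q * snd v)) (at q)"
        by (rule has_derivative_U[OF j off_axes_not_polar[OF \<open>q \<in> off_axes\<close> j]])
      have "(iterated_integral (U j \<omega>) w has_derivative
          (\<lambda>h. letter_form (U j \<omega>) l (U j q) * iterated_integral (U j \<omega>) u (U j q) * h)) (at (U j q))"
        using iterated_integral_DERIV[OF Uq, of l u] unfolding w has_field_derivative_def .
      from has_derivative_compose[OF dU this]
      show "((\<lambda>q. iterated_integral (U j \<omega>) w (U j q)) has_derivative (\<lambda>v. letter_form (U j \<omega>) (hd w) (U j q) *
          iterated_integral (U j \<omega>) (tl w) (U j q) * (Ux j q * fst v + Uy j q * snd v))) (at q)"
        by (simp add: w)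
    qed
    also have "(\<lambda>v. term_sum ts (\<lambda>j w. letter_form (U j \<omega>) (hd w) (U j q) * iterated_integral (U j \<omega>) (tl w) (U j q) *
        (Ux j q * fst v + Uy j q * snd v))) = (\<lambda>v. 0)"
    proof
      fix v
      have "term_sum (strip_letter L ts) (\<lambda>j w. iterated_integral (U j \<omega>) w (U j q)) = 0" if "L < 6" for L
        using Suc.IH[OF log_terms_strip_letter[OF Suc.prems(1)] _ q] Suc.prems(2) that by (auto simp: list_all_iff)
      then show "term_sum ts (\<lambda>j w. letter_form (U j \<omega>) (hd w) (U j q) * iterated_integral (U j \<omega>) (tl w) (U j q) *
        (Ux j q * fst v + Uy j q * snd v)) = 0"
        unfolding log_form_pullback[OF B q Suc.prems(1)] by simp
    qed
    finally show ?thesis by (rule has_derivative_at_withinI)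
  qed
  have "f \<omega> = term_sum ts (\<lambda>_ _. 0)"
    unfolding f_def
  proof (rule term_sum_cong)
    fix k j w assume "(k, j, w) \<in> set ts"
    then have "length w = Suc n" using Suc.prems(1) by (auto simp: log_terms_def)
    then show "iterated_integral (U j \<omega>) w (U j \<omega>) = 0" by (cases w) auto
  qed
  also have "\<dots> = 0" by (induction ts) auto
  finally have f0: "f \<omega> = 0" .
  have "f p = f \<omega>"
    using has_derivative_zero_unique[of B f p \<omega>] der B Suc.prems(3) by (auto simp: tame_nbhd_def)
  then show ?case using f0 by (simp add: f_def)
qed

lemma rel_holds_if_symbol_vanishes:
  assumes \<omega>: "\<omega> \<in> off_axes" and ts: "log_terms \<omega> (Suc n) ts" and van: "symbol_vanishes (Suc n) ts"
    and rt: "\<And>j. j \<in> {1..9} \<Longrightarrow> (rt j)\<^sup>2 = U j \<omega>"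
  shows "rel_holds rt \<omega> ts"
proof -
  obtain B where B: "tame_nbhd \<omega> B" using tame_nbhd_exists[OF \<omega>] ..
  then have "\<forall>\<^sub>F p in nhds \<omega>. p \<in> B" by (auto simp: tame_nbhd_def intro!: eventually_nhds_in_open)
  then show ?thesis
    unfolding rel_holds_def
  proof (rule eventually_mono, intro allI)
    fix p v assume p: "p \<in> B"
    have "term_sum ts (\<lambda>j w. basis_function (rt j) w (U j p) * (Ux j p * fst v + Uy j p * snd v)) =
      term_sum ts (\<lambda>j w. letter_form (U j \<omega>) (hd w) (U j p) * iterated_integral (U j \<omega>) (tl w) (U j p) *
      (Ux j p * fst v + Uy j p * snd v))"
    proof (rule term_sum_cong)
      fix k j w assume "(k, j, w) \<in> set ts"
      then have j: "j \<in> {1..9}" and "length w = Suc n" "set w \<subseteq> {0, 1}"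
        using ts by (auto simp: log_terms_def)
      then obtain l u where w: "w = l # u" "l \<in> {0, 1}" by (cases w) auto
      then have "basis_function (rt j) w (U j p) = letter_form (U j \<omega>) (hd w) (U j p) * iterated_integral (U j \<omega>) (tl w) (U j p)"
        using rt[OF j] by (auto simp: basis_function_def)
      then show "basis_function (rt j) w (U j p) * (Ux j p * fst v + Uy j p * snd v) =
          letter_form (U j \<omega>) (hd w) (U j p) * iterated_integral (U j \<omega>) (tl w) (U j p) * (Ux j p * fst v + Uy j p * snd v)"
        by simp
    qed
    also have "\<dots> = 0"
    proof -
      have "term_sum (strip_letter L ts) (\<lambda>j w. iterated_integral (U j \<omega>) w (U j p)) = 0" if "L < 6" for L
        using vanishing_symbol[OF B log_terms_strip_letter[OF ts] _ p] van that by (auto simp: list_all_iff)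
      then show ?thesis unfolding log_form_pullback[OF B p ts] by simp
    qed
    finally show "term_sum ts (\<lambda>j w. basis_function (rt j) w (U j p) * (Ux j p * fst v + Uy j p * snd v)) = 0" .
  qed
qed

section \<open>The abelian relations of the five webs\<close>

definition log_124 :: rel_terms where
  "log_124 = [(1, 1, [1]), (-1, 2, [1]), (1, 4, [0])]"

definition log_158 :: rel_terms where
  "log_158 = [(1, 1, [0]), (-1, 5, [0]), (1, 8, [0])]"

definition log_245 :: rel_terms where
  "log_245 = [(1, 2, [0]), (-1, 4, [1]), (1, 5, [1])]"

definition log_248 :: rel_terms where
  "log_248 = [(1, 2, [0]), (-1, 4, [0]), (1, 8, [0])]"

definition log_135 :: rel_terms where
  "log_135 = [(1, 1, [1]), (-1, 3, [1]), (1, 5, [1])]"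

definition log_1357 :: rel_terms where
  "log_1357 = [(-1, 1, [0]), (1, 3, [0]), (-1, 5, [0]), (1, 7, [0])]"

definition log_123 :: rel_terms where
  "log_123 = [(-1, 1, [0]), (1, 2, [0]), (1, 3, [0])]"

definition log_278 :: rel_terms where
  "log_278 = [(1, 2, [0]), (-1, 7, [1]), (1, 8, [1])]"

definition log_136 :: rel_terms where
  "log_136 = [(-2, 1, [0]), (1, 3, [0]), (1, 6, [0])]"

definition log_167 :: rel_terms where
  "log_167 = [(1, 1, [1]), (-1, 6, [1]), (1, 7, [1])]"

definition log_359 :: rel_terms where
  "log_359 = [(1, 3, [0]), (-2, 5, [0]), (1, 9, [0])]"

definition log_579 :: rel_terms where
  "log_579 = [(-1, 5, [1]), (-1, 7, [1]), (1, 9, [1])]"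

definition dilog_123458 :: rel_terms where
    "dilog_123458 = [(-1, 1, [0, 1]), (-1, 2, [0, 0]), (1, 2, [0, 1]), (1, 3, [0, 1]), (-1, 4,
    [0, 0]), (1, 4, [0, 1]), (-1, 5, [0, 1]), (1, 8, [0, 0])]"

definition dilog_12345 :: rel_terms where
    "dilog_12345 = [(-1, 1, [0, 1]), (1, 1, [1, 0]), (1, 2, [0, 1]), (-1, 2, [1, 0]), (1, 3, [0,
    1]), (-1, 3, [1, 0]), (1, 4, [0, 1]), (-1, 4, [1, 0]), (-1, 5, [0, 1]), (1, 5, [1, 0])]"

definition dilog_123457 :: rel_terms where
    "dilog_123457 = [(-1, 1, [0, 0]), (1, 1, [0, 1]), (-1, 2, [0, 1]), (1, 3, [0, 0]), (-1, 3,
    [0, 1]), (-1, 4, [0, 1]), (-1, 5, [0, 0]), (1, 5, [0, 1]), (1, 7, [0, 0])]"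

definition dilog_135679 :: rel_terms where
    "dilog_135679 = [(-2, 1, [0, 1]), (1, 3, [0, 1]), (-2, 5, [0, 1]), (1, 6, [0, 1]), (-2, 7,
    [0, 1]), (1, 9, [0, 1])]"

definition dilog_135679b :: rel_terms where
    "dilog_135679b = [(-2, 1, [1, 0]), (1, 3, [1, 0]), (-2, 5, [1, 0]), (1, 6, [1, 0]), (-2, 7,
    [1, 0]), (1, 9, [1, 0])]"

definition dilog_1236 :: rel_terms where
  "dilog_1236 = [(-2, 1, [0, 0]), (-2, 2, [0, 0]), (1, 3, [0, 0]), (1, 6, [0, 0])]"

definition dilog_3459 :: rel_terms where
  "dilog_3459 = [(1, 3, [0, 0]), (-2, 4, [0, 0]), (-2, 5, [0, 0]), (1, 9, [0, 0])]"

definition dilog_245789 :: rel_terms where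
    "dilog_245789 = [(1, 2, [0, 0]), (-1, 4, [0, 1]), (-1, 5, [0, 1]), (-1, 7, [0, 1]), (-1, 8,
    [0, 1]), (1, 9, [0, 1])]"

definition dilog_245789b :: rel_terms where
    "dilog_245789b = [(1, 2, [0, 0]), (-1, 4, [1, 0]), (-1, 5, [1, 0]), (-1, 7, [1, 0]), (-1, 8,
    [1, 0]), (1, 9, [1, 0])]"

definition trilog_123456789 :: rel_terms where
    "trilog_123456789 = [(2, 1, [0, 0, 1]), (-2, 1, [0, 1, 0]), (2, 2, [0, 0, 1]), (-2, 2, [0,
    1, 0]), (-1, 3, [0, 0, 1]), (1, 3, [0, 1, 0]), (2, 4, [0, 0, 1]), (-2, 4, [0, 1, 0]), (2, 5, [0,
    0, 1]), (-2, 5, [0, 1, 0]), (-1, 6, [0, 0, 1]), (1, 6, [0, 1, 0]), (2, 7, [0, 0, 1]), (-2, 7,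
    [0, 1, 0]), (2, 8, [0, 0, 1]), (-2, 8, [0, 1, 0]), (-1, 9, [0, 0, 1]), (1, 9, [0, 1, 0])]"

definition trilog_123456789b :: rel_terms where
    "trilog_123456789b = [(2, 1, [0, 0, 1]), (-2, 1, [1, 0, 0]), (2, 2, [0, 0, 1]), (-2, 2, [1,
    0, 0]), (-1, 3, [0, 0, 1]), (1, 3, [1, 0, 0]), (2, 4, [0, 0, 1]), (-2, 4, [1, 0, 0]), (2, 5, [0,
    0, 1]), (-2, 5, [1, 0, 0]), (-1, 6, [0, 0, 1]), (1, 6, [1, 0, 0]), (2, 7, [0, 0, 1]), (-2, 7,
    [1, 0, 0]), (2, 8, [0, 0, 1]), (-2, 8, [1, 0, 0]), (-1, 9, [0, 0, 1]), (1, 9, [1, 0, 0])]"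

definition log_147 :: rel_terms where
  "log_147 = [(-1, 1, [0]), (-1, 4, [0]), (1, 7, [0])]"

definition rational_247 :: rel_terms where
  "rational_247 = [(1, 2, [2]), (1, 4, [2]), (1, 7, [2])]"

definition rational_258 :: rel_terms where
  "rational_258 = [(-1, 2, [3]), (1, 5, [2]), (1, 8, [2])]"

definition rational_157 :: rel_terms where
  "rational_157 = [(1, 1, [3]), (1, 5, [3]), (1, 7, [3])]"

definition rational_148 :: rel_terms where
  "rational_148 = [(1, 1, [2]), (-1, 4, [3]), (-1, 8, [3])]"

definition artanh_369 :: rel_terms where
  "artanh_369 = [(-1, 3, [4]), (1, 6, [4]), (1, 9, [4])]"

lemmas rel_defs =
  log_124_def log_158_def log_245_def log_248_def log_135_def log_1357_def log_123_def log_278_def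
  log_136_def log_167_def log_359_def log_579_def dilog_123458_def dilog_12345_def
  dilog_123457_def dilog_135679_def dilog_135679b_def dilog_1236_def dilog_3459_def
  dilog_245789_def dilog_245789b_def trilog_123456789_def trilog_123456789b_def log_147_def
  rational_247_def rational_258_def rational_157_def rational_148_def artanh_369_def

text \<open>A form of the triangularity condition suited to evaluation: absence of a term replaces a zero
coefficient.\<close>

fun triangular_code :: "rel_terms list \<Rightarrow> (nat \<times> nat list) list \<Rightarrow> bool" where
  "triangular_code [] [] \<longleftrightarrow> True"
| "triangular_code (ts # rels) ((j, w) # piv) \<longleftrightarrow> term_coeff ts j w \<noteq> 0 \<and>
     list_all (\<lambda>ts'. list_all (\<lambda>(k, j', w'). j' \<noteq> j \<or> w' \<noteq> w) ts') rels \<and> triangular_code rels piv"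
| "triangular_code _ _ \<longleftrightarrow> False"

lemma term_coeff_absent:
  assumes "list_all (\<lambda>(k, j', w'). j' \<noteq> j \<or> w' \<noteq> w) ts"
  shows "term_coeff ts j w = 0"
  using assms by (induction ts) (auto simp: term_coeff_def)

lemma triangular_if_code: "triangular_code rels piv \<Longrightarrow> triangular rels piv"
proof (induction rels piv rule: triangular_code.induct)
  case (2 ts rels j w piv)
  have IH: "triangular rels piv" using 2 by simp
  have absent: "term_coeff ts' j w = 0" if "ts' \<in> set rels" for ts'
    using 2(2) that term_coeff_absent by (auto simp: list_all_iff)
  show ?case
    unfolding triangular_def
  proof (intro conjI allI impI ballI)
    show "length ((j, w) # piv) = length (ts # rels)" using IH by (simp add: triangular_def)
    fix i assume i: "i < length (ts # rels)"
    show "term_coeff ((ts # rels) ! i) (fst (((j, w) # piv) ! i)) (snd (((j, w) # piv) ! i)) \<noteq> 0"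
      using 2(2) IH i by (cases i) (auto simp: triangular_def)
    fix i' assume i': "i' \<in> {i<..<length (ts # rels)}"
    then obtain m where m: "i' = Suc m" "m < length rels" by (cases i') auto
    show "term_coeff ((ts # rels) ! i') (fst (((j, w) # piv) ! i)) (snd (((j, w) # piv) ! i)) = 0"
      using IH i i' m absent[of "rels ! m"] by (cases i) (auto simp: triangular_def)
  qed
qed (auto simp: triangular_def)

text \<open>All conditions on a relation of weight 1, 2 or 3 that can be checked by evaluation. The list \<open>ones\<close>
contains the foliations for which the letter 1 is allowed, because \<open>U j\<close> does not take the value 1.\<close>

definition log_check :: "nat list \<Rightarrow> nat list \<Rightarrow> rel_terms \<Rightarrow> bool" where
  "log_check J ones ts \<longleftrightarrow> (let n = length (snd (snd (hd ts))) in 1 \<le> n \<and> n \<le> 3 \<and>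
     list_all (\<lambda>(k, j, w). j \<in> set J \<and> length w = n \<and>
       list_all (\<lambda>l. l = 0 \<or> l = 1 \<and> j \<in> set ones) w) ts \<and> symbol_vanishes n ts)"

text \<open>The square roots of \<open>U 3\<close>, \<open>U 6\<close> and \<open>U 9\<close> differ by rational factors, since \<open>U 6 = U 3 * y\<^sup>2\<close> and
\<open>U 9 = U 3 * ((1 - y) / (1 - x))\<^sup>2\<close>. Their branches are chosen consistently, so that the \<open>artanh\<close> relation
holds with fixed signs; any branch serves for the other foliations.\<close>

definition branch :: "complex \<times> complex \<Rightarrow> nat \<Rightarrow> complex" where
  "branch \<omega> j = (let s = csqrt (U 3 \<omega>) in
     if j = 3 then s else if j = 6 then s * snd \<omega>
     else if j = 9 then s * ((1 - snd \<omega>) / (1 - fst \<omega>)) else csqrt (U j \<omega>))"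

lemma U_nonzero: "\<omega> \<in> off_axes \<Longrightarrow> j \<in> {1..9} \<Longrightarrow> U j \<omega> \<noteq> 0"
  unfolding web_index_cases by (cases \<omega>) (auto simp: off_axes_def)

lemma branch_squared:
  assumes "\<omega> \<in> off_axes" "j \<in> {1..9}"
  shows "(branch \<omega> j)\<^sup>2 = U j \<omega>"
proof -
  obtain x y where "\<omega> = (x, y)" by (cases \<omega>)
  with assms show ?thesis
    by (auto simp: branch_def Let_def power_mult_distrib off_axes_def power_divide divide_simps)
       (simp_all add: power2_eq_square)
qed

lemma branch_nonzero: "\<omega> \<in> off_axes \<Longrightarrow> j \<in> {1..9} \<Longrightarrow> branch \<omega> j \<noteq> 0"
  using branch_squared U_nonzero by fastforce

lemma log_check_sound:
  assumes \<omega>: "\<omega> \<in> off_axes" and J: "set J \<subseteq> {1..9}" and ones: "\<And>j. j \<in> set ones \<Longrightarrow> U j \<omega> \<noteq> 1"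
    and chk: "log_check J ones ts"
  shows "terms_ok (set J) \<omega> ts \<and> rel_holds (branch \<omega>) \<omega> ts"
proof -
  obtain n where n: "Suc n \<le> 3" "symbol_vanishes (Suc n) ts"
    and t: "\<And>k j w. (k, j, w) \<in> set ts \<Longrightarrow> j \<in> set J \<and> length w = Suc n \<and>
       (\<forall>l\<in>set w. l = 0 \<or> l = 1 \<and> j \<in> set ones)"
  proof -
    define m where "m = length (snd (snd (hd ts)))"
    have m: "1 \<le> m" "m \<le> 3" "symbol_vanishes m ts"
      and l: "list_all (\<lambda>(k, j, w). j \<in> set J \<and> length w = m \<and>
       list_all (\<lambda>l. l = 0 \<or> l = 1 \<and> j \<in> set ones) w) ts"
      using chk unfolding log_check_def Let_def m_def[symmetric] by blast+
    from m(1) obtain n where "m = Suc n" by (cases m) auto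
    with m l that[of n] show thesis
      by (auto simp: list_all_iff split: prod.splits)
  qed
  have letters: "log_terms \<omega> (Suc n) ts"
    unfolding log_terms_def
  proof (intro ballI, clarsimp simp only: split: prod.splits, intro conjI ballI)
    fix k j w assume mem: "(k, j, w) \<in> set ts"
    note tt = t[OF mem]
    show "j \<in> {1..9}" using tt J by blast
    show "length w = Suc n" using tt by blast
    show "set w \<subseteq> {0, 1}" using tt by blast
    show "U j \<omega> \<noteq> of_nat l" if "l \<in> set w" for l
    proof -
      have "l = 0 \<or> l = 1 \<and> j \<in> set ones" using tt that by blast
      moreover have "U j \<omega> \<noteq> 0" using tt J by (intro U_nonzero[OF \<omega>]) blast
      moreover have "U j \<omega> \<noteq> 1" if "j \<in> set ones" using ones[OF that] .
      ultimately show ?thesis by auto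
    qed
  qed
  have adm: "terms_ok (set J) \<omega> ts"
    unfolding terms_ok_def
  proof (intro ballI, clarsimp simp only: split: prod.splits, intro conjI)
    fix k j w assume mem: "(k, j, w) \<in> set ts"
    note tt = t[OF mem]
    show "j \<in> set J" using tt by blast
    have "length w = Suc n" using tt by blast
    then have "w \<noteq> []" "length w \<le> 3" using n(1) by auto
    moreover have "set w \<subseteq> {0, 1}" using tt by blast
    moreover have "1 \<in> set w \<longrightarrow> U j \<omega> \<noteq> 1"
    proof
      assume "1 \<in> set w"
      with tt have "j \<in> set ones" by fastforce
      then show "U j \<omega> \<noteq> 1" by (rule ones)
    qed
    ultimately show "admissible (U j \<omega>) w" by (simp add: admissible_def)
  qed
  show ?thesis
    using adm rel_holds_if_symbol_vanishes[OF \<omega> letters n(2) branch_squared[OF \<omega>]] by blast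
qed

lemma maximal_rank_from_lists:
  assumes \<omega>: "\<omega> \<in> regular_locus (set J)" "\<omega> \<in> off_axes" and J: "set J \<subseteq> {1..9}" "2 \<le> card (set J)"
    and ones: "\<And>j. j \<in> set ones \<Longrightarrow> U j \<omega> \<noteq> 1"
    and logs: "list_all (log_check J ones) logs"
    and sps: "\<And>ts. ts \<in> set sps \<Longrightarrow> terms_ok (set J) \<omega> ts \<and> rel_holds (branch \<omega>) \<omega> ts"
    and tri: "triangular_code (logs @ sps) piv" "list_all (\<lambda>p. fst p \<in> set J) piv"
    and len: "length (logs @ sps) = (card (set J) - 1) * (card (set J) - 2) div 2"
  shows "maximal_rank_at (set J) \<omega>"
proof (rule maximal_rank_from_relations[OF \<omega> J _ _ triangular_if_code[OF tri(1)] _ len, of "branch \<omega>"])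
  show "branch \<omega> j \<noteq> 0 \<and> (branch \<omega> j)\<^sup>2 = U j \<omega>" if "j \<in> set J" for j
    using branch_nonzero branch_squared \<omega>(2) J(1) that by blast
  show "terms_ok (set J) \<omega> ts \<and> rel_holds (branch \<omega>) \<omega> ts" if "ts \<in> set (logs @ sps)" for ts
    using that sps log_check_sound[OF \<omega>(2) J(1) ones] logs by (auto simp: list_all_iff)
  show "fst ` set piv \<subseteq> set J" using tri(2) by (auto simp: list_all_iff)
qed

text \<open>Differentials of \<open>U 2 + U 4 + U 7 = 1\<close>, \<open>1 / U 2 + U 5 + U 8 = 1\<close>, \<open>1 / U 1 + 1 / U 5 + 1 / U 7 = 1\<close> and
\<open>U 1 + 1 / U 4 + 1 / U 8 = 1\<close>.\<close>

lemma rational_relations_hold: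
  assumes "\<omega> \<in> off_axes"
  shows "rel_holds rt \<omega> rational_247" "rel_holds rt \<omega> rational_258"
    "rel_holds rt \<omega> rational_157" "rel_holds rt \<omega> rational_148"
proof -
  have off_axes: "\<forall>\<^sub>F p in nhds \<omega>. p \<in> off_axes"
    using open_off_axes assms by (simp add: eventually_nhds_in_open)
  note defs = rel_defs Ux_def Uy_def x_factor_def y_factor_def x_factor_deriv_def y_factor_deriv_def off_axes_def
  show "rel_holds rt \<omega> rational_247" unfolding rel_holds_def
    by (rule eventually_mono[OF off_axes])
       (auto simp: defs divide_simps power2_eq_square, simp add: algebra_simps)
  show "rel_holds rt \<omega> rational_258" unfolding rel_holds_def
    by (rule eventually_mono[OF off_axes])
       (auto simp: defs divide_simps power2_eq_square, simp add: algebra_simps)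
  show "rel_holds rt \<omega> rational_157" unfolding rel_holds_def
    by (rule eventually_mono[OF off_axes])
       (auto simp: defs divide_simps power2_eq_square, simp add: algebra_simps)
  show "rel_holds rt \<omega> rational_148" unfolding rel_holds_def
    by (rule eventually_mono[OF off_axes])
       (auto simp: defs divide_simps power2_eq_square, simp add: algebra_simps)
qed

lemma square_roots_agree:
  fixes f g :: "'a :: topological_space \<Rightarrow> complex"
  assumes f: "(f \<longlongrightarrow> c) F" and g: "(g \<longlongrightarrow> c) F" and c: "c \<noteq> 0"
    and eq: "\<forall>\<^sub>F x in F. (f x)\<^sup>2 = (g x)\<^sup>2"
  shows "\<forall>\<^sub>F x in F. f x = g x"
proof -
  have "((\<lambda>x. f x + g x) \<longlongrightarrow> c + c) F" by (intro tendsto_intros f g)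
  moreover have "c + c \<noteq> 0" using c by simp
  ultimately have "\<forall>\<^sub>F x in F. f x + g x \<in> - {0}"
    by (intro topological_tendstoD[of _ "c + c"]) (auto simp: open_Compl)
  with eq show ?thesis
    by eventually_elim (auto simp: power2_eq_iff)
qed

text \<open>With \<open>x = s\<^sup>2\<close> and \<open>y = t\<^sup>2\<close>, the functions \<open>(1 + sqrt U) / (1 - sqrt U)\<close> for \<open>U = U 3, U 6, U 9\<close> are
\<open>(t + s) / (t - s)\<close>, \<open>(1 + s t) / (1 - s t)\<close> and \<open>(t + s) (1 - s t) / ((t - s) (1 + s t))\<close>, so the third is the
quotient of the first two. The proof compares the differentials; the common factor \<open>1 / sqrt (U 3)\<close>
cancels and leaves a rational identity.\<close>

lemma artanh_relation_holds:
  assumes \<omega>: "\<omega> \<in> off_axes" and ne: "fst \<omega> \<noteq> snd \<omega>" "fst \<omega> * snd \<omega> \<noteq> 1"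
  shows "rel_holds (branch \<omega>) \<omega> artanh_369"
proof -
  define S where "S j p = local_sqrt (branch \<omega> j) (U j p)" for j p
  have nz: "branch \<omega> j \<noteq> 0" if "j \<in> {1..9}" for j using branch_nonzero[OF \<omega> that] .
  have sq: "(S j p)\<^sup>2 = U j p" if "j \<in> {1..9}" for j p
    unfolding S_def using local_sqrt_squared nz[OF that] by blast
  have sq3: "(S 3 p)\<^sup>2 = U 3 p" and sq6: "(S 6 p)\<^sup>2 = U 6 p" and sq9: "(S 9 p)\<^sup>2 = U 9 p" for p
    by (rule sq, simp)+
  have lim: "(S j \<longlongrightarrow> branch \<omega> j) (nhds \<omega>)" if j: "j \<in> {1..9}" for j
  proof -
    have "isCont (U j) \<omega>"
      using has_derivative_U[OF j off_axes_not_polar[OF \<omega> j]] has_derivative_continuous by blast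
    moreover have "isCont (local_sqrt (branch \<omega> j)) (U j \<omega>)"
      using local_sqrt_analytic[OF nz[OF j]] branch_squared[OF \<omega> j]
        analytic_at_imp_isCont by metis
    ultimately have "isCont (\<lambda>p. local_sqrt (branch \<omega> j) (U j p)) \<omega>" by (rule isCont_o2)
    then show ?thesis
      using local_sqrt_base[OF nz[OF j]] branch_squared[OF \<omega> j]
      by (simp add: isCont_def S_def[abs_def] tendsto_nhds_iff)
  qed
  have off_axes: "\<forall>\<^sub>F p in nhds \<omega>. p \<in> off_axes"
    using open_off_axes \<omega> by (simp add: eventually_nhds_in_open)
  have lim6: "((\<lambda>p. S 3 p * snd p) \<longlongrightarrow> branch \<omega> 6) (nhds \<omega>)"
  proof -
    have "branch \<omega> 6 = branch \<omega> 3 * snd \<omega>" by (simp add: branch_def Let_def)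
    then show ?thesis by (simp only:) (intro tendsto_intros lim filterlim_ident, simp)
  qed
  have lim9: "((\<lambda>p. S 3 p * ((1 - snd p) / (1 - fst p))) \<longlongrightarrow> branch \<omega> 9) (nhds \<omega>)"
  proof -
    have "branch \<omega> 9 = branch \<omega> 3 * ((1 - snd \<omega>) / (1 - fst \<omega>))" by (simp add: branch_def Let_def)
    moreover have "1 - fst \<omega> \<noteq> 0" using \<omega> by (auto simp: off_axes_def)
    ultimately show ?thesis by (simp only:) (intro tendsto_intros lim filterlim_ident, simp_all)
  qed
  have e6: "\<forall>\<^sub>F p in nhds \<omega>. S 6 p = S 3 p * snd p"
  proof (rule square_roots_agree[OF lim lim6])
    show "\<forall>\<^sub>F p in nhds \<omega>. (S 6 p)\<^sup>2 = (S 3 p * snd p)\<^sup>2"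
      using off_axes by eventually_elim (auto simp: power_mult_distrib sq3 sq6 off_axes_def, simp add: power2_eq_square)
  qed (use nz in auto)
  have e9: "\<forall>\<^sub>F p in nhds \<omega>. S 9 p = S 3 p * ((1 - snd p) / (1 - fst p))"
  proof (rule square_roots_agree[OF lim lim9])
    show "\<forall>\<^sub>F p in nhds \<omega>. (S 9 p)\<^sup>2 = (S 3 p * ((1 - snd p) / (1 - fst p)))\<^sup>2"
      using off_axes by eventually_elim (auto simp: sq3 sq9 power_mult_distrib off_axes_def power_divide)
  qed (use nz in auto)
  have "((\<lambda>p. fst p - snd p) \<longlongrightarrow> fst \<omega> - snd \<omega>) (nhds \<omega>)"
    by (intro tendsto_intros filterlim_ident)
  then have "\<forall>\<^sub>F p in nhds \<omega>. fst p - snd p \<in> - {0}"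
    by (rule topological_tendstoD) (use ne in \<open>auto simp: open_Compl\<close>)
  moreover have "((\<lambda>p. fst p * snd p - 1) \<longlongrightarrow> fst \<omega> * snd \<omega> - 1) (nhds \<omega>)"
    by (intro tendsto_intros filterlim_ident)
  then have "\<forall>\<^sub>F p in nhds \<omega>. fst p * snd p - 1 \<in> - {0}"
    by (rule topological_tendstoD) (use ne in \<open>auto simp: open_Compl\<close>)
  ultimately show ?thesis
    unfolding rel_holds_def using off_axes e6 e9
  proof eventually_elim
    case (elim p)
    obtain x y where p: "p = (x, y)" by (cases p)
    define s where "s = S 3 p"
    have s2: "s\<^sup>2 = x / y" using sq[of 3 p] by (simp add: s_def p)
    have g: "x \<noteq> 0" "y \<noteq> 0" "x - 1 \<noteq> 0" "1 - x \<noteq> 0" "1 - y \<noteq> 0" "x - y \<noteq> 0" "y - x \<noteq> 0" "x * y - 1 \<noteq> 0" "1 - x * y \<noteq> 0"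
      using elim by (auto simp: p off_axes_def)
    have s0: "s \<noteq> 0" using s2 g by auto
    have gp: "(x, y) \<in> off_axes" using elim p by simp
    note U1 = U_minus_1[OF gp]
    have o3: "1 - U 3 (x, y) = (y - x) / y" using U1(3) g by (simp add: p divide_simps)
    have o6: "1 - U 6 (x, y) = 1 - x * y" by (simp add: p)
    have o9: "1 - U 9 (x, y) = (x - y) * (x * y - 1) / (y * (1 - x)\<^sup>2)"
      using U1(9) by (simp add: p power2_commute[of 1 x] algebra_simps)
    have b3: "basis_function (branch \<omega> 3) [4] (U 3 p) = 1 / s * (y / (y - x))"
      using g by (simp add: S_def[symmetric] o3 p s_def[unfolded p, symmetric] del: U.simps)
    have b6: "basis_function (branch \<omega> 6) [4] (U 6 p) = 1 / s * (1 / (y * (1 - x * y)))"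
      using g elim by (simp add: S_def[symmetric] o6 p s_def[unfolded p, symmetric] del: U.simps)
    have b9: "basis_function (branch \<omega> 9) [4] (U 9 p) = 1 / s * ((1 - x) ^ 3 * y / ((1 - y) * ((x - y) * (x * y - 1))))"
      using g elim by (simp add: S_def[symmetric] o9 p s_def[unfolded p, symmetric] power2_eq_square power3_eq_cube del: U.simps)
        (simp only: ac_simps)
    show ?case
    proof
      fix v :: "complex \<times> complex"
      obtain a b where v: "v = (a, b)" by (cases v)
      have "(1 - x) ^ 3 * y / ((1 - y) * ((x - y) * (x * y - 1))) * (Ux 9 p * a + Uy 9 p * b)
          - y / (y - x) * (Ux 3 p * a + Uy 3 p * b) + 1 / (y * (1 - x * y)) * (Ux 6 p * a + Uy 6 p * b) = 0"
        using g unfolding p Ux_def Uy_def x_factor_def y_factor_def x_factor_deriv_def y_factor_deriv_def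
        by (simp add: divide_simps power2_eq_square power3_eq_cube) (simp add: algebra_simps)
      then have "1 / s * ((1 - x) ^ 3 * y / ((1 - y) * ((x - y) * (x * y - 1))) * (Ux 9 p * a + Uy 9 p * b)
          - y / (y - x) * (Ux 3 p * a + Uy 3 p * b) + 1 / (y * (1 - x * y)) * (Ux 6 p * a + Uy 6 p * b)) = 0"
        by simp
      moreover have "of_int (- 1) * (1 / s * B * Y) + (of_int 1 * (1 / s * C * Z) + (of_int 1 * (1 / s * A * X) + 0)) =
          1 / s * (A * X - B * Y + C * Z)" for A B C X Y Z
        by (simp add: algebra_simps)
      ultimately show "term_sum artanh_369 (\<lambda>j w. basis_function (branch \<omega> j) w (U j p) * (Ux j p * fst v + Uy j p * snd v)) = 0"
        unfolding artanh_369_def term_sum_Cons term_sum_Nil b3 b6 b9 v fst_conv snd_conv by (simp only:)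
    qed
  qed
qed

lemma U_not_1:
  assumes "(x, y) \<in> off_axes" "j \<in> {1..9}" "j \<in> {3, 4, 5, 9} \<Longrightarrow> x \<noteq> y" "j \<in> {6, 7, 8, 9} \<Longrightarrow> x * y \<noteq> 1"
  shows "U j (x, y) \<noteq> 1"
proof -
  note U1 = U_minus_1[OF assms(1)]
  have g: "x - 1 \<noteq> 0" "y - 1 \<noteq> 0" "y \<noteq> 0" using assms(1) by (auto simp: off_axes_def)
  have "U j (x, y) - 1 \<noteq> 0"
    using assms(2,3,4) g unfolding web_index_cases
    by (elim disjE) (simp_all only: U1, auto)
  then show ?thesis by simp
qed

text \<open>For this web \<open>U 8\<close> may take the value 1 at a regular point, because only one of its functions has the
level set \<open>x y = 1\<close>. The relations use only the letter 0 for \<open>U 8\<close>.\<close>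

lemma maximal_rank_123458:
  assumes \<omega>: "\<omega> \<in> regular_locus (set [1, 2, 3, 4, 5, 8 :: nat])"
  shows "maximal_rank_at (set [1, 2, 3, 4, 5, 8 :: nat]) \<omega>"
proof -
  let ?J = "[1, 2, 3, 4, 5, 8 :: nat]" and ?ones = "[1, 2, 3, 4, 5 :: nat]"
  let ?logs = "[dilog_12345, dilog_123458, log_123, log_124, log_135, log_158, log_245, log_248]"
  let ?sps = "[rational_148, rational_258]"
  let ?piv = "[(5, [1, 0]), (8, [0, 0]), (3, [0]), (2, [1]), (1, [1]), (1, [0]), (5, [1]), (8, [0]), (1,
    [2]), (2, [3])] :: (nat \<times> nat list) list"
  obtain x y where xy: "\<omega> = (x, y)" by (cases \<omega>)
  have sub: "set ?J \<subseteq> {1..9}" by auto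
  note R = regular_1245[OF \<omega>[unfolded xy] sub]
  have off_axes: "(x, y) \<in> off_axes" and ne: "x \<noteq> y" using R by auto
  show ?thesis
  proof (rule maximal_rank_from_lists[OF \<omega> _ sub, where ones = "?ones" and logs = "?logs"
      and sps = "?sps" and piv = "?piv"])
    show "\<omega> \<in> off_axes" using off_axes xy by simp
    show "2 \<le> card (set ?J)" by (simp add: card_insert_if)
    show "U j \<omega> \<noteq> 1" if "j \<in> set ?ones" for j
      unfolding xy by (rule U_not_1[OF off_axes]) (use that ne in auto)
    show "list_all (log_check ?J ?ones) ?logs" by code_simp
    show "terms_ok (set ?J) \<omega> ts \<and> rel_holds (branch \<omega>) \<omega> ts" if "ts \<in> set ?sps" for ts
    proof -
      have "\<omega> \<in> off_axes" using off_axes xy by simp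
      note rational_relations_hold[OF this]
      then show ?thesis
        using that ne 
        by (auto simp: xy terms_ok_def admissible_def rel_defs simp del: U.simps)
    qed
    show "triangular_code (?logs @ ?sps) ?piv" by code_simp
    show "list_all (\<lambda>p. fst p \<in> set ?J) ?piv" by code_simp
    show "length (?logs @ ?sps) = (card (set ?J) - 1) * (card (set ?J) - 2) div 2"
      by (simp add: card_insert_if)
  qed
qed

lemma maximal_rank_135679:
  assumes \<omega>: "\<omega> \<in> regular_locus (set [1, 3, 5, 6, 7, 9 :: nat])"
  shows "maximal_rank_at (set [1, 3, 5, 6, 7, 9 :: nat]) \<omega>"
proof -
  let ?J = "[1, 3, 5, 6, 7, 9 :: nat]" and ?ones = "[1, 3, 5, 6, 7, 9 :: nat]"
  let ?logs = "[dilog_135679, dilog_135679b, log_135, log_1357, log_136, log_167, log_359, log_579]"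
  let ?sps = "[rational_157, artanh_369]"
  let ?piv = "[(9, [0, 1]), (9, [1, 0]), (3, [1]), (7, [0]), (6, [0]), (1, [1]), (9, [0]), (9, [1]), (1,
    [3]), (3, [4])] :: (nat \<times> nat list) list"
  obtain x y where xy: "\<omega> = (x, y)" by (cases \<omega>)
  have sub: "set ?J \<subseteq> {1..9}" by auto
  note R = regular_13567[OF \<omega>[unfolded xy] sub]
  have off_axes: "(x, y) \<in> off_axes" and ne: "x \<noteq> y" "x * y \<noteq> 1" using R by auto
  show ?thesis
  proof (rule maximal_rank_from_lists[OF \<omega> _ sub, where ones = "?ones" and logs = "?logs"
      and sps = "?sps" and piv = "?piv"])
    show "\<omega> \<in> off_axes" using off_axes xy by simp
    show "2 \<le> card (set ?J)" by (simp add: card_insert_if)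
    show "U j \<omega> \<noteq> 1" if "j \<in> set ?ones" for j
      unfolding xy by (rule U_not_1[OF off_axes]) (use that ne in auto)
    show "list_all (log_check ?J ?ones) ?logs" by code_simp
    show "terms_ok (set ?J) \<omega> ts \<and> rel_holds (branch \<omega>) \<omega> ts" if "ts \<in> set ?sps" for ts
    proof -
      have "\<omega> \<in> off_axes" using off_axes xy by simp
      note rational_relations_hold[OF this] artanh_relation_holds[OF this]
      then show ?thesis
        using that ne U_not_1[OF off_axes, of 3] U_not_1[OF off_axes, of 6] U_not_1[OF off_axes, of 9]
        by (auto simp: xy terms_ok_def admissible_def rel_defs simp del: U.simps)
    qed
    show "triangular_code (?logs @ ?sps) ?piv" by code_simp
    show "list_all (\<lambda>p. fst p \<in> set ?J) ?piv" by code_simp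
    show "length (?logs @ ?sps) = (card (set ?J) - 1) * (card (set ?J) - 2) div 2"
      by (simp add: card_insert_if)
  qed
qed

lemma maximal_rank_124578:
  assumes \<omega>: "\<omega> \<in> regular_locus (set [1, 2, 4, 5, 7, 8 :: nat])"
  shows "maximal_rank_at (set [1, 2, 4, 5, 7, 8 :: nat]) \<omega>"
proof -
  let ?J = "[1, 2, 4, 5, 7, 8 :: nat]" and ?ones = "[1, 2, 4, 5, 7, 8 :: nat]"
  let ?logs = "[log_124, log_147, log_158, log_245, log_248, log_278]"
  let ?sps = "[rational_148, rational_157, rational_247, rational_258]"
  let ?piv = "[(1, [1]), (7, [0]), (1, [0]), (5, [1]), (8, [0]), (8, [1]), (1, [2]), (1, [3]), (2, [2]), (2,
    [3])] :: (nat \<times> nat list) list"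
  obtain x y where xy: "\<omega> = (x, y)" by (cases \<omega>)
  have sub: "set ?J \<subseteq> {1..9}" by auto
  note R = regular_1245[OF \<omega>[unfolded xy] sub] regular_78[OF \<omega>[unfolded xy] sub]
  have off_axes: "(x, y) \<in> off_axes" and ne: "x \<noteq> y" "x * y \<noteq> 1" using R by auto
  show ?thesis
  proof (rule maximal_rank_from_lists[OF \<omega> _ sub, where ones = "?ones" and logs = "?logs"
      and sps = "?sps" and piv = "?piv"])
    show "\<omega> \<in> off_axes" using off_axes xy by simp
    show "2 \<le> card (set ?J)" by (simp add: card_insert_if)
    show "U j \<omega> \<noteq> 1" if "j \<in> set ?ones" for j
      unfolding xy by (rule U_not_1[OF off_axes]) (use that ne in auto)
    show "list_all (log_check ?J ?ones) ?logs" by code_simp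
    show "terms_ok (set ?J) \<omega> ts \<and> rel_holds (branch \<omega>) \<omega> ts" if "ts \<in> set ?sps" for ts
    proof -
      have "\<omega> \<in> off_axes" using off_axes xy by simp
      note rational_relations_hold[OF this]
      then show ?thesis
        using that ne 
        by (auto simp: xy terms_ok_def admissible_def rel_defs simp del: U.simps)
    qed
    show "triangular_code (?logs @ ?sps) ?piv" by code_simp
    show "list_all (\<lambda>p. fst p \<in> set ?J) ?piv" by code_simp
    show "length (?logs @ ?sps) = (card (set ?J) - 1) * (card (set ?J) - 2) div 2"
      by (simp add: card_insert_if)
  qed
qed

lemma maximal_rank_1234578:
  assumes \<omega>: "\<omega> \<in> regular_locus (set [1, 2, 3, 4, 5, 7, 8 :: nat])"
  shows "maximal_rank_at (set [1, 2, 3, 4, 5, 7, 8 :: nat]) \<omega>"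
proof -
  let ?J = "[1, 2, 3, 4, 5, 7, 8 :: nat]" and ?ones = "[1, 2, 3, 4, 5, 7, 8 :: nat]"
  let ?logs = "[dilog_12345, dilog_123457, dilog_123458, log_124, log_135, log_1357, log_123, log_158,
    log_245, log_248, log_278]"
  let ?sps = "[rational_148, rational_157, rational_247, rational_258]"
  let ?piv = "[(5, [1, 0]), (7, [0, 0]), (8, [0, 0]), (2, [1]), (1, [1]), (7, [0]), (3, [0]), (1, [0]), (5,
    [1]), (8, [0]), (8, [1]), (1, [2]), (1, [3]), (2, [2]), (2, [3])] :: (nat \<times> nat list) list"
  obtain x y where xy: "\<omega> = (x, y)" by (cases \<omega>)
  have sub: "set ?J \<subseteq> {1..9}" by auto
  note R = regular_1245[OF \<omega>[unfolded xy] sub] regular_78[OF \<omega>[unfolded xy] sub]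
  have off_axes: "(x, y) \<in> off_axes" and ne: "x \<noteq> y" "x * y \<noteq> 1" using R by auto
  show ?thesis
  proof (rule maximal_rank_from_lists[OF \<omega> _ sub, where ones = "?ones" and logs = "?logs"
      and sps = "?sps" and piv = "?piv"])
    show "\<omega> \<in> off_axes" using off_axes xy by simp
    show "2 \<le> card (set ?J)" by (simp add: card_insert_if)
    show "U j \<omega> \<noteq> 1" if "j \<in> set ?ones" for j
      unfolding xy by (rule U_not_1[OF off_axes]) (use that ne in auto)
    show "list_all (log_check ?J ?ones) ?logs" by code_simp
    show "terms_ok (set ?J) \<omega> ts \<and> rel_holds (branch \<omega>) \<omega> ts" if "ts \<in> set ?sps" for ts
    proof -
      have "\<omega> \<in> off_axes" using off_axes xy by simp
      note rational_relations_hold[OF this]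
      then show ?thesis
        using that ne 
        by (auto simp: xy terms_ok_def admissible_def rel_defs simp del: U.simps)
    qed
    show "triangular_code (?logs @ ?sps) ?piv" by code_simp
    show "list_all (\<lambda>p. fst p \<in> set ?J) ?piv" by code_simp
    show "length (?logs @ ?sps) = (card (set ?J) - 1) * (card (set ?J) - 2) div 2"
      by (simp add: card_insert_if)
  qed
qed

lemma maximal_rank_123456789:
  assumes \<omega>: "\<omega> \<in> regular_locus (set [1, 2, 3, 4, 5, 6, 7, 8, 9 :: nat])"
  shows "maximal_rank_at (set [1, 2, 3, 4, 5, 6, 7, 8, 9 :: nat]) \<omega>"
proof -
  let ?J = "[1, 2, 3, 4, 5, 6, 7, 8, 9 :: nat]" and ?ones = "[1, 2, 3, 4, 5, 6, 7, 8, 9 :: nat]"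
  let ?logs = "[dilog_12345, dilog_123457, dilog_123458, dilog_1236, dilog_135679, dilog_135679b,
    dilog_245789, dilog_245789b, dilog_3459, log_124, log_135, log_1357, log_136, log_167,
    log_245, log_248, log_158, log_123, log_278, log_359, log_579, trilog_123456789,
    trilog_123456789b]"
  let ?sps = "[rational_148, rational_157, rational_247, rational_258, artanh_369]"
  let ?piv = "[(2, [1, 0]), (7, [0, 0]), (8, [0, 0]), (6, [0, 0]), (3, [0, 1]), (3, [1, 0]), (9, [0, 1]),
    (9, [1, 0]), (9, [0, 0]), (2, [1]), (3, [1]), (7, [0]), (6, [0]), (1, [1]), (4, [1]), (4,
    [0]), (8, [0]), (1, [0]), (8, [1]), (9, [0]), (9, [1]), (9, [0, 1, 0]), (9, [1, 0, 0]), (1,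
    [2]), (1, [3]), (2, [2]), (2, [3]), (3, [4])] :: (nat \<times> nat list) list"
  obtain x y where xy: "\<omega> = (x, y)" by (cases \<omega>)
  have sub: "set ?J \<subseteq> {1..9}" by auto
  note R = regular_1245[OF \<omega>[unfolded xy] sub] regular_78[OF \<omega>[unfolded xy] sub]
  have off_axes: "(x, y) \<in> off_axes" and ne: "x \<noteq> y" "x * y \<noteq> 1" using R by auto
  show ?thesis
  proof (rule maximal_rank_from_lists[OF \<omega> _ sub, where ones = "?ones" and logs = "?logs"
      and sps = "?sps" and piv = "?piv"])
    show "\<omega> \<in> off_axes" using off_axes xy by simp
    show "2 \<le> card (set ?J)" by (simp add: card_insert_if)
    show "U j \<omega> \<noteq> 1" if "j \<in> set ?ones" for j
      unfolding xy by (rule U_not_1[OF off_axes]) (use that ne in auto)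
    show "list_all (log_check ?J ?ones) ?logs" by code_simp
    show "terms_ok (set ?J) \<omega> ts \<and> rel_holds (branch \<omega>) \<omega> ts" if "ts \<in> set ?sps" for ts
    proof -
      have "\<omega> \<in> off_axes" using off_axes xy by simp
      note rational_relations_hold[OF this] artanh_relation_holds[OF this]
      then show ?thesis
        using that ne U_not_1[OF off_axes, of 3] U_not_1[OF off_axes, of 6] U_not_1[OF off_axes, of 9]
        by (auto simp: xy terms_ok_def admissible_def rel_defs simp del: U.simps)
    qed
    show "triangular_code (?logs @ ?sps) ?piv" by code_simp
    show "list_all (\<lambda>p. fst p \<in> set ?J) ?piv" by code_simp
    show "length (?logs @ ?sps) = (card (set ?J) - 1) * (card (set ?J) - 2) div 2"
      by (simp add: card_insert_if)
  qed
qed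

section \<open>Hexagonality\<close>

definition blinfun2 :: "complex \<Rightarrow> complex \<Rightarrow> complex \<Rightarrow> complex \<Rightarrow> (complex \<times> complex) \<Rightarrow>\<^sub>L (complex \<times> complex)" where
  "blinfun2 a b c d = Blinfun (\<lambda>v. (a * fst v + b * snd v, c * fst v + d * snd v))"

lemma blinfun2_apply: "blinfun_apply (blinfun2 a b c d) = (\<lambda>v. (a * fst v + b * snd v, c * fst v + d * snd v))"
proof -
  have "bounded_linear (\<lambda>v. (a * fst v + b * snd v, c * fst v + d * snd v))"
    by (intro bounded_linear_intros)
  then show ?thesis unfolding blinfun2_def by (rule bounded_linear_Blinfun_apply)
qed

text \<open>The inverse function theorem; the inverse of a complex linear bijection is complex linear.\<close>

lemma local_biholomorphism:
  fixes f1 f2 a b c d :: "complex \<times> complex \<Rightarrow> complex"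
  assumes N: "open N" "\<omega> \<in> N"
    and d1: "\<And>p. p \<in> N \<Longrightarrow> (f1 has_derivative (\<lambda>v. a p * fst v + b p * snd v)) (at p)"
    and d2: "\<And>p. p \<in> N \<Longrightarrow> (f2 has_derivative (\<lambda>v. c p * fst v + d p * snd v)) (at p)"
    and cont: "continuous_on N a" "continuous_on N b" "continuous_on N c" "continuous_on N d"
    and det: "a \<omega> * d \<omega> - b \<omega> * c \<omega> \<noteq> 0"
  shows "\<exists>W. \<omega> \<in> W \<and> W \<subseteq> N \<and> biholomorphism (\<lambda>p. (f1 p, f2 p)) W"
proof -
  let ?f = "\<lambda>p. (f1 p, f2 p)"
  let ?f' = "\<lambda>p. blinfun2 (a p) (b p) (c p) (d p)"
  let ?D = "a \<omega> * d \<omega> - b \<omega> * c \<omega>"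
  have der: "(?f has_derivative blinfun_apply (?f' p)) (at p)" if "p \<in> N" for p
    unfolding blinfun2_apply using d1[OF that] d2[OF that] by (rule has_derivative_Pair)
  have contf: "continuous_on N ?f'"
    by (rule continuous_on_blinfun_componentwise) (auto simp: blinfun2_apply intro!: continuous_intros cont)
  have inv: "blinfun2 (d \<omega> / ?D) (- b \<omega> / ?D) (- c \<omega> / ?D) (a \<omega> / ?D) o\<^sub>L ?f' \<omega> = id_blinfun"
  proof (rule blinfun_eqI)
    fix v :: "complex \<times> complex"
    obtain x y where v: "v = (x, y)" by (cases v)
    have cramer: "q / D * (p' * x + q' * y) + - s / D * (r' * x + t' * y) = ((q * p' - s * r') * x + (q * q' - s * t') * y) / D"
      for p' q' r' t' q s D :: complex
      by (simp add: diff_divide_distrib add_divide_distrib algebra_simps)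
    have "d \<omega> / ?D * (a \<omega> * x + b \<omega> * y) + - b \<omega> / ?D * (c \<omega> * x + d \<omega> * y) = x"
      unfolding cramer using det by (simp add: mult.commute)
    moreover have "- c \<omega> / ?D * (a \<omega> * x + b \<omega> * y) + a \<omega> / ?D * (c \<omega> * x + d \<omega> * y) = y"
      using cramer[of "- c \<omega>" ?D "a \<omega>" "b \<omega>" "- a \<omega>" "c \<omega>" "d \<omega>"] det by (simp add: mult.commute)
    ultimately show "(blinfun2 (d \<omega> / ?D) (- b \<omega> / ?D) (- c \<omega> / ?D) (a \<omega> / ?D) o\<^sub>L ?f' \<omega>) v = id_blinfun v"
      by (simp only: v blinfun_apply_blinfun_compose blinfun2_apply fst_conv snd_conv blinfun_apply_id_blinfun)
  qed
  obtain W V g g' where W: "open W" "W \<subseteq> N" "\<omega> \<in> W" "open V" "?f \<omega> \<in> V" "homeomorphism W V ?f g"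
    and g: "\<And>y. y \<in> V \<Longrightarrow> (g has_derivative (g' y)) (at y)"
      "\<And>y. y \<in> V \<Longrightarrow> g' y = inv (blinfun_apply (?f' (g y)))"
      "\<And>y. y \<in> V \<Longrightarrow> bij (blinfun_apply (?f' (g y)))"
    by (rule inverse_function_theorem[OF N(1) der contf N(2) inv]) (assumption, (rule that; assumption))
  have img: "?f ` W = V" and gf: "\<And>p. p \<in> W \<Longrightarrow> g (?f p) = p" and fg: "\<And>y. y \<in> V \<Longrightarrow> ?f (g y) = y"
    and gV: "g ` V = W"
    using W(6) by (auto simp: homeomorphism_def)
  have injW: "inj_on ?f W" by (rule inj_on_inverseI[of _ g]) (rule gf)
  have clin: "blinfun2 a b c d (map_prod ((*) k) ((*) k) v) = map_prod ((*) k) ((*) k) (blinfun2 a b c d v)"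
    for a b c d k v by (cases v) (simp add: blinfun2_apply algebra_simps)
  have "holomorphic_map ?f W"
    unfolding holomorphic_map_def
  proof
    fix p assume "p \<in> W"
    then show "\<exists>D. (?f has_derivative D) (at p) \<and> (\<forall>c v. D (map_prod ((*) c) ((*) c) v) = map_prod ((*) c) ((*) c) (D v))"
      using der[of p] W(2) clin by (intro exI[of _ "blinfun_apply (?f' p)"]) blast
  qed
  moreover have "holomorphic_map (inv_into W ?f) V"
    unfolding holomorphic_map_def
  proof
    fix y assume y: "y \<in> V"
    have "(inv_into W ?f has_derivative g' y) (at y)"
    proof (rule has_derivative_transform_within_open[OF g(1)[OF y] W(4) y])
      fix z assume z: "z \<in> V"
      then have "g z \<in> W" using gV by blast
      then show "g z = inv_into W ?f z" using inv_into_f_f[OF injW, of "g z"] fg[OF z] by simp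
    qed
    moreover have "g' y (map_prod ((*) k) ((*) k) v) = map_prod ((*) k) ((*) k) (g' y v)" for k v
    proof -
      let ?L = "blinfun_apply (?f' (g y))"
      have L: "bij ?L" by (rule g(3)[OF y])
      have "?L (map_prod ((*) k) ((*) k) (inv ?L v)) = map_prod ((*) k) ((*) k) v"
        unfolding clin using L by (simp add: bij_is_surj surj_f_inv_f)
      then show ?thesis unfolding g(2)[OF y] using L by (metis bij_inv_eq_iff)
    qed
    ultimately show "\<exists>D. (inv_into W ?f has_derivative D) (at y) \<and>
        (\<forall>c v. D (map_prod ((*) c) ((*) c) v) = map_prod ((*) c) ((*) c) (D v))" by blast
  qed
  ultimately have "biholomorphism ?f W"
    unfolding biholomorphism_def using W(1,4) injW by (simp add: img)
  then show ?thesis using W by blast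
qed

lemma local_primitive:
  assumes "g analytic_on {a}" "g a \<noteq> 0"
  obtains F r where "r > 0" "\<And>z. z \<in> ball a r \<Longrightarrow> (F has_field_derivative g z) (at z)"
    "inj_on F (ball a r)" "g holomorphic_on ball a r"
proof -
  obtain e where e: "e > 0" "g holomorphic_on ball a e" using assms(1) by (auto simp: analytic_on_def)
  obtain F where F: "\<And>z. z \<in> ball a e \<Longrightarrow> (F has_field_derivative g z) (at z within ball a e)"
    using holomorphic_convex_primitive'[OF convex_ball open_ball e(2)] by blast
  then have F': "(F has_field_derivative g z) (at z)" if "z \<in> ball a e" for z
    using that at_within_open[OF that open_ball] by metis
  have "F holomorphic_on ball a e" unfolding holomorphic_on_def field_differentiable_def using F by blast
  moreover have "deriv F a \<noteq> 0" using F'[of a] e(1) assms(2) by (simp add: DERIV_imp_deriv)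
  ultimately obtain r where "r > 0" "ball a r \<subseteq> ball a e" "inj_on F (ball a r)"
    using has_complex_derivative_locally_injective[of F "ball a e" a] e(1) by auto
  then show thesis using that[of r F] F' e(2) by (meson holomorphic_on_subset subsetD)
qed

text \<open>Let \<open>F l\<close> be a primitive of \<open>g l\<close>. The sum of the \<open>F l (U l)\<close> is constant. In the coordinates
\<open>(F i (U i), F j (U j))\<close> the leaves of \<open>U i\<close> and \<open>U j\<close> are parallel to the axes, and those of \<open>U k\<close> are the
level lines of the sum of the coordinates. Since \<open>g l\<close> does not vanish, \<open>F l\<close> is locally injective, so
that the level sets of \<open>F l (U l)\<close> are those of \<open>U l\<close>.\<close>

lemma parallelisable_if_relation:
  assumes K: "K = {i, j, k}" "i \<noteq> j" "i \<noteq> k" "j \<noteq> k" "K \<subseteq> {1..9}"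
    and \<omega>: "\<omega> \<in> off_axes" "\<omega> \<in> regular_locus K"
    and an: "\<And>l. l \<in> K \<Longrightarrow> g l analytic_on {U l \<omega>}"
    and nz: "\<And>l. l \<in> K \<Longrightarrow> g l (U l \<omega>) \<noteq> 0"
    and rel: "\<forall>\<^sub>F p in nhds \<omega>. \<forall>v. (\<Sum>l\<in>K. g l (U l p) * (Ux l p * fst v + Uy l p * snd v)) = 0"
  shows "parallelisable_at K \<omega>"
proof -
  have K9: "l \<in> {1..9}" if "l \<in> K" for l using that K(5) by blast
  have "\<forall>l\<in>K. \<exists>F r. r > 0 \<and> (\<forall>z\<in>ball (U l \<omega>) r. (F has_field_derivative g l z) (at z)) \<and>
      inj_on F (ball (U l \<omega>) r) \<and> g l holomorphic_on ball (U l \<omega>) r"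
    using local_primitive[OF an nz] by metis
  then obtain F r where F: "\<And>l. l \<in> K \<Longrightarrow> r l > 0"
      "\<And>l z. l \<in> K \<Longrightarrow> z \<in> ball (U l \<omega>) (r l) \<Longrightarrow> (F l has_field_derivative g l z) (at z)"
      "\<And>l. l \<in> K \<Longrightarrow> inj_on (F l) (ball (U l \<omega>) (r l))"
      "\<And>l. l \<in> K \<Longrightarrow> g l holomorphic_on ball (U l \<omega>) (r l)"
    by metis
  have "\<forall>\<^sub>F p in nhds \<omega>. U l p \<in> ball (U l \<omega>) (r l)" if "l \<in> K" for l
  proof -
    have "isCont (U l) \<omega>"
      using has_derivative_U[OF K9[OF that] off_axes_not_polar[OF \<omega>(1) K9[OF that]]] has_derivative_continuous by blast
    then show ?thesis
      using F(1)[OF that] by (intro topological_tendstoD) (auto simp: isCont_def tendsto_nhds_iff)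
  qed
  then have "\<forall>\<^sub>F p in nhds \<omega>. \<forall>l\<in>K. U l p \<in> ball (U l \<omega>) (r l)"
    using K(1) by (intro eventually_ball_finite) auto
  moreover have "\<forall>\<^sub>F p in nhds \<omega>. p \<in> off_axes"
    using open_off_axes \<omega>(1) by (simp add: eventually_nhds_in_open)
  moreover note open_regular[OF K(5) \<omega>] rel
  ultimately have "\<forall>\<^sub>F p in nhds \<omega>. (\<forall>l\<in>K. U l p \<in> ball (U l \<omega>) (r l)) \<and> p \<in> off_axes \<and> p \<in> regular_locus K \<and>
      (\<forall>v. (\<Sum>l\<in>K. g l (U l p) * (Ux l p * fst v + Uy l p * snd v)) = 0)"
    by eventually_elim blast
  then obtain e where e: "e > 0" and Nprop: "\<And>p. dist p \<omega> < e \<Longrightarrow> (\<forall>l\<in>K. U l p \<in> ball (U l \<omega>) (r l)) \<and> p \<in> off_axes \<and>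
      p \<in> regular_locus K \<and> (\<forall>v. (\<Sum>l\<in>K. g l (U l p) * (Ux l p * fst v + Uy l p * snd v)) = 0)"
    unfolding eventually_nhds_metric by blast
  define N where "N = ball \<omega> e"
  have N: "open N" "convex N" "\<omega> \<in> N" using e by (auto simp: N_def)
  have NU: "U l p \<in> ball (U l \<omega>) (r l)" if "p \<in> N" "l \<in> K" for p l
    using Nprop[of p] that by (simp add: N_def dist_commute)
  have Ngood: "p \<in> off_axes" and Nreg: "p \<in> regular_locus K"
    and Nrel: "(\<Sum>l\<in>K. g l (U l p) * (Ux l p * fst v + Uy l p * snd v)) = 0" if "p \<in> N" for p v
    using Nprop[of p] that by (simp_all add: N_def dist_commute)
  have dF: "((\<lambda>p. F l (U l p)) has_derivative
      (\<lambda>v. (g l (U l p) * Ux l p) * fst v + (g l (U l p) * Uy l p) * snd v)) (at p)" if p: "p \<in> N" and l: "l \<in> K" for p l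
  proof -
    have "(F l has_derivative (\<lambda>h. g l (U l p) * h)) (at (U l p))"
      using F(2)[OF l NU[OF p l]] by (simp add: has_field_derivative_def)
    from has_derivative_compose[OF has_derivative_U[OF K9[OF l] off_axes_not_polar[OF Ngood[OF p] K9[OF l]]] this]
    show ?thesis by (simp add: algebra_simps)
  qed
  have cU: "continuous_on N (U l)" if "l \<in> K" for l
    using has_derivative_U[OF K9[OF that] off_axes_not_polar[OF Ngood K9[OF that]]] has_derivative_continuous
      continuous_at_imp_continuous_on by blast
  have cg: "continuous_on N (\<lambda>p. g l (U l p))" if l: "l \<in> K" for l
    by (rule continuous_on_compose2[OF holomorphic_on_imp_continuous_on[OF F(4)[OF l]] cU[OF l]])
       (use NU[OF _ l] in blast)
  have cx: "continuous_on N (\<lambda>p. g l (U l p) * Ux l p)" "continuous_on N (\<lambda>p. g l (U l p) * Uy l p)" if l: "l \<in> K" for l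
    by (rule continuous_on_mult[OF cg[OF l] continuous_at_imp_continuous_on],
        use isCont_Ux[OF Ngood K9[OF l]] in blast)+
  have ijk: "i \<in> K" "j \<in> K" "k \<in> K" using K(1) by auto
  have "jacobian i j \<omega> \<noteq> 0" using jacobian_nonzero[OF \<omega>(2) K(5) ijk(1,2) K(2)] .
  then have "(g i (U i \<omega>) * Ux i \<omega>) * (g j (U j \<omega>) * Uy j \<omega>) - (g i (U i \<omega>) * Uy i \<omega>) * (g j (U j \<omega>) * Ux j \<omega>) \<noteq> 0"
  proof -
    have "(g i (U i \<omega>) * Ux i \<omega>) * (g j (U j \<omega>) * Uy j \<omega>) - (g i (U i \<omega>) * Uy i \<omega>) * (g j (U j \<omega>) * Ux j \<omega>)
        = g i (U i \<omega>) * g j (U j \<omega>) * jacobian i j \<omega>" by (simp add: jacobian_def algebra_simps)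
    then show ?thesis using nz ijk \<open>jacobian i j \<omega> \<noteq> 0\<close> by simp
  qed
  from local_biholomorphism[OF N(1,3) dF[OF _ ijk(1)] dF[OF _ ijk(2)] cx[OF ijk(1)] cx[OF ijk(2)] this]
  obtain W where W: "\<omega> \<in> W" "W \<subseteq> N" "biholomorphism (\<lambda>p. (F i (U i p), F j (U j p))) W" by blast
  define \<phi> where "\<phi> = (\<lambda>p. (F i (U i p), F j (U j p)))"
  define d :: "nat \<Rightarrow> complex \<times> complex" where "d l = (if l = i then (1, 0) else if l = j then (0, 1) else (1, 1))" for l
  define H where "H p = F i (U i p) + F j (U j p) + F k (U k p)" for p
  have H: "H p = H q" if "p \<in> N" "q \<in> N" for p q
  proof -
    have "(H has_derivative (\<lambda>v. 0)) (at p within N)" if p: "p \<in> N" for p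
    proof -
      have "(H has_derivative (\<lambda>v. ((g i (U i p) * Ux i p) * fst v + (g i (U i p) * Uy i p) * snd v) +
          ((g j (U j p) * Ux j p) * fst v + (g j (U j p) * Uy j p) * snd v) +
          ((g k (U k p) * Ux k p) * fst v + (g k (U k p) * Uy k p) * snd v))) (at p)"
        unfolding H_def by (intro has_derivative_add dF[OF p] ijk)
      also have "(\<lambda>v. ((g i (U i p) * Ux i p) * fst v + (g i (U i p) * Uy i p) * snd v) +
          ((g j (U j p) * Ux j p) * fst v + (g j (U j p) * Uy j p) * snd v) +
          ((g k (U k p) * Ux k p) * fst v + (g k (U k p) * Uy k p) * snd v)) = (\<lambda>v. 0)"
        using Nrel[OF p] K(1-4) by (simp add: fun_eq_iff algebra_simps)
      finally show ?thesis by (rule has_derivative_at_withinI)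
    qed
    then show ?thesis using has_derivative_zero_unique[OF N(2) _ that(2,1)] that by metis
  qed
  have iff: "U l q = U l p \<longleftrightarrow> F l (U l q) = F l (U l p)" if "p \<in> N" "q \<in> N" "l \<in> K" for p q l
    using inj_on_eq_iff[OF F(3)[OF that(3)] NU[OF that(2,3)] NU[OF that(1,3)]] by blast
  have form: "U l q = U l p \<longleftrightarrow> linear_form (d l) (\<phi> q) = linear_form (d l) (\<phi> p)"
    if pq: "p \<in> N" "q \<in> N" and l: "l \<in> K" for p q l
  proof -
    consider "l = i" | "l = j" | "l = k" using l K(1) by blast
    then show ?thesis
    proof cases
      case 3
      have "F i (U i q) + F j (U j q) = F i (U i p) + F j (U j p) \<longleftrightarrow> F k (U k q) = F k (U k p)"
        using H[OF pq] unfolding H_def by (metis add_left_cancel add_right_cancel)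
      then show ?thesis using iff[OF pq l] K(2-4) 3 by (simp add: linear_form_def d_def \<phi>_def)
    qed (use iff[OF pq l] K(2-4) in \<open>simp_all add: linear_form_def d_def \<phi>_def\<close>)
  qed
  have carries: "carries_foliation \<phi> W (U l) (linear_form (d l))" if l: "l \<in> K" for l
    unfolding carries_foliation_def
  proof
    fix p assume p: "p \<in> W"
    then have "\<forall>\<^sub>F q in nhds p. q \<in> N" using W(2) N(1) by (intro eventually_nhds_in_open) auto
    then show "\<forall>\<^sub>F q in nhds p. U l q = U l p \<longleftrightarrow> linear_form (d l) (\<phi> q) = linear_form (d l) (\<phi> p)"
      by eventually_elim (use form p W(2) l in blast)
  qed
  show ?thesis
    unfolding parallelisable_at_def
  proof (intro exI conjI)
    show "\<omega> \<in> W" "biholomorphism \<phi> W" using W by (simp_all add: \<phi>_def)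
    show "W \<subseteq> regular_locus K" using W(2) Nreg by blast
    show "\<forall>l\<in>K. carries_foliation \<phi> W (U l) (linear_form (d l))" using carries by blast
    show "\<forall>l\<in>K. \<forall>m\<in>K. l \<noteq> m \<longrightarrow> fst (d l) * snd (d m) \<noteq> fst (d m) * snd (d l)"
      using K by (auto simp: d_def)
  qed
qed

text \<open>Any two of the three differentials are independent, so if one component of the relation is nonzero
at the base point, then all three are.\<close>

lemma parallelisable_if_abelian_relation:
  assumes K: "card K = 3" "K \<subseteq> {1..9}"
    and \<omega>: "\<omega> \<in> off_axes" "\<omega> \<in> regular_locus K"
    and \<gamma>: "\<gamma> \<in> abelian_relations K \<omega>" "l \<in> K" "germ_coeff 0 (\<gamma> l) \<noteq> 0"
  shows "parallelisable_at K \<omega>"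
proof -
  obtain g where g: "\<forall>j\<in>K. g j analytic_on {U j \<omega>} \<and> \<gamma> j = germ_at (U j \<omega>) (g j)"
    and rel: "\<forall>\<^sub>F p in nhds \<omega>. \<forall>v. (\<Sum>j\<in>K. g j (U j p) * (Ux j p * fst v + Uy j p * snd v)) = 0"
    using \<gamma>(1) unfolding abelian_relations_off_axes[OF \<omega>(1) K(2)] by blast
  have gl: "g l (U l \<omega>) \<noteq> 0"
    using \<gamma>(2,3) g germ_coeff_germ_at[of "g l" "U l \<omega>" 0] by (simp add: fps_expansion_def)
  have \<open>card (K - {l}) = 2\<close> using K(1) \<gamma>(2) by simp
  then obtain m n where mn: "K - {l} = {m, n}" "m \<noteq> n" by (meson card_2_iff)
  have K3: "K = {l, m, n}" "l \<noteq> m" "l \<noteq> n" "m \<noteq> n" using mn \<gamma>(2) by auto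
  have "\<forall>v. (\<Sum>j\<in>K. g j (U j \<omega>) * (Ux j \<omega> * fst v + Uy j \<omega> * snd v)) = 0"
    using rel eventually_nhds_x_imp_x by fast
  then have lin: "g l (U l \<omega>) * (Ux l \<omega> * a + Uy l \<omega> * b) + (g m (U m \<omega>) * (Ux m \<omega> * a + Uy m \<omega> * b) +
      g n (U n \<omega>) * (Ux n \<omega> * a + Uy n \<omega> * b)) = 0" for a b
    using K3 by simp
  have J: "jacobian l m \<omega> \<noteq> 0" "jacobian l n \<omega> \<noteq> 0"
    using jacobian_nonzero[OF \<omega>(2) K(2)] K3 by auto
  have "g m (U m \<omega>) * jacobian m n \<omega> = - (g l (U l \<omega>) * jacobian l n \<omega>)"
    using lin[of "Uy n \<omega>" "- Ux n \<omega>"] by (simp add: jacobian_def algebra_simps)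
  then have m0: "g m (U m \<omega>) \<noteq> 0" using J gl by auto
  have "g n (U n \<omega>) * jacobian n m \<omega> = - (g l (U l \<omega>) * jacobian l m \<omega>)"
    using lin[of "Uy m \<omega>" "- Ux m \<omega>"] by (simp add: jacobian_def algebra_simps)
  then have n0: "g n (U n \<omega>) \<noteq> 0" using J gl by auto
  show ?thesis
    by (rule parallelisable_if_relation[OF K3 K(2) \<omega> _ _ rel]) (use g gl m0 n0 K3 in auto)
qed

definition log_125 :: rel_terms where
  "log_125 = [(-1, 1, [0]), (1, 1, [1]), (1, 2, [0]), (-1, 2, [1]), (1, 5, [0])]"

definition log_127 :: rel_terms where
  "log_127 = [(-1, 1, [0]), (1, 1, [1]), (-1, 2, [1]), (1, 7, [0])]"

definition log_128 :: rel_terms where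
  "log_128 = [(1, 1, [1]), (1, 2, [0]), (-1, 2, [1]), (1, 8, [0])]"

definition log_145 :: rel_terms where
  "log_145 = [(1, 1, [0]), (1, 4, [0]), (-1, 4, [1]), (-1, 5, [0]), (1, 5, [1])]"

definition log_178 :: rel_terms where
  "log_178 = [(-1, 1, [0]), (1, 7, [0]), (-1, 7, [1]), (-1, 8, [0]), (1, 8, [1])]"

definition log_257 :: rel_terms where
  "log_257 = [(-1, 2, [0]), (-1, 5, [0]), (1, 7, [0])]"

definition log_457 :: rel_terms where
  "log_457 = [(-1, 4, [1]), (-1, 5, [0]), (1, 5, [1]), (1, 7, [0])]"

definition log_458 :: rel_terms where
  "log_458 = [(-1, 4, [0]), (1, 4, [1]), (-1, 5, [1]), (1, 8, [0])]"

definition log_478 :: rel_terms where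
  "log_478 = [(1, 4, [0]), (-1, 7, [1]), (-1, 8, [0]), (1, 8, [1])]"

definition log_578 :: rel_terms where
  "log_578 = [(-1, 5, [0]), (1, 7, [0]), (-1, 7, [1]), (1, 8, [1])]"

text \<open>Together with the four rational relations these belong to the 20 three-element subsets of
\<open>{1, 2, 4, 5, 7, 8}\<close>, one to each.\<close>

definition hexagonal_logs :: "rel_terms list" where
  "hexagonal_logs = [log_124, log_125, log_127, log_128, log_145, log_147, log_158, log_178, log_245, log_248, log_257, log_278, log_457, log_458, log_478, log_578]"

definition hexagonal_rationals :: "rel_terms list" where
  "hexagonal_rationals = [rational_148, rational_157, rational_247, rational_258]"

definition foliations :: "rel_terms \<Rightarrow> nat list" where
  "foliations ts = map (\<lambda>(k, j, w). j) ts"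

text \<open>For one foliation the component of the relation is a multiple of \<open>1 / z\<close>, \<open>1 / (z - 1)\<close>, 1 or
\<open>1 / z\<^sup>2\<close>, hence nowhere zero.\<close>

definition has_single_term :: "rel_terms \<Rightarrow> bool" where
  "has_single_term ts \<longleftrightarrow> list_ex (\<lambda>(k, j, w). k \<noteq> 0 \<and> w \<in> set [[0], [1], [2], [3]] \<and>
     filter (\<lambda>(k', j', w'). j' = j) ts = [(k, j, w)]) ts"

lemma component_filter: "component rt ts j z = component rt (filter (\<lambda>(k', j', w'). j' = j) ts) j z"
  unfolding component_def by (induction ts) auto

lemma parallelisable_from_terms:
  assumes \<omega>: "\<omega> \<in> off_axes" "\<omega> \<in> regular_locus (set (foliations ts))"
    and K: "card (set (foliations ts)) = 3" "set (foliations ts) \<subseteq> {1..9}"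
    and rel: "terms_ok (set (foliations ts)) \<omega> ts \<and> rel_holds (branch \<omega>) \<omega> ts"
    and single: "has_single_term ts"
  shows "parallelisable_at (set (foliations ts)) \<omega>"
proof -
  let ?K = "set (foliations ts)"
  obtain k j w where t: "(k, j, w) \<in> set ts" "k \<noteq> 0" "w \<in> {[0], [1], [2], [3]}"
      "filter (\<lambda>(k', j', w'). j' = j) ts = [(k, j, w)]"
    using single unfolding has_single_term_def list_ex_iff by auto
  have j: "j \<in> ?K" using t(1) by (force simp: foliations_def)
  then have j9: "j \<in> {1..9}" using K(2) by blast
  have sq: "(branch \<omega> j)\<^sup>2 = U j \<omega>" by (rule branch_squared[OF \<omega>(1) j9])
  have adm: "admissible (U j \<omega>) w" using rel t(1) unfolding terms_ok_def by blast
  have U0: "U j \<omega> \<noteq> 0" by (rule U_nonzero[OF \<omega>(1) j9])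
  have "basis_function (branch \<omega> j) w (U j \<omega>) \<noteq> 0"
    using t(3) adm U0 by (auto simp: sq letter_form_def admissible_def simp del: U.simps)
  moreover have "component (branch \<omega>) ts j (U j \<omega>) = of_int k * basis_function (branch \<omega> j) w (U j \<omega>)"
    unfolding component_filter[of _ ts] t(4) by (simp add: component_def del: U.simps)
  ultimately have "germ_coeff 0 (germs_of_terms (branch \<omega>) ts j) \<noteq> 0"
    using t(2) by (simp add: germs_of_terms_def germ_at_def germ_coeff.abs_eq sq del: U.simps)
  moreover have "germs_of_terms (branch \<omega>) ts \<in> abelian_relations ?K \<omega>"
    using germs_of_terms_in_abelian_relations[OF \<omega>(1) K(2), of "branch \<omega>"] rel
      branch_nonzero[OF \<omega>(1)] branch_squared[OF \<omega>(1)] K(2) by blast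
  ultimately show ?thesis
    using parallelisable_if_abelian_relation[OF K \<omega> _ j] by blast
qed

lemma hexagonal_web_124578: "hexagonal_web {1, 2, 4, 5, 7, 8}"
  unfolding hexagonal_web_def
proof (intro ballI allI impI)
  let ?J = "[1, 2, 4, 5, 7, 8 :: nat]"
  fix \<omega> K assume \<omega>: "\<omega> \<in> regular_locus {1, 2, 4, 5, 7, 8}" and K: "K \<subseteq> {1, 2, 4, 5, 7, 8 :: nat}" "card K = 3"
  obtain x y where xy: "\<omega> = (x, y)" by (cases \<omega>)
  have R: "(x, y) \<in> off_axes" "x \<noteq> y" "x * y \<noteq> 1"
    using regular_1245[OF \<omega>[unfolded xy]] regular_78[OF \<omega>[unfolded xy]] by auto
  then have off_axes: "\<omega> \<in> off_axes" by (simp add: xy)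
  have Un1: "U j \<omega> \<noteq> 1" if "j \<in> set ?J" for j
    unfolding xy by (rule U_not_1[OF R(1)]) (use that R in auto)
  obtain a b c where abc: "K = {a, b, c}" "a \<noteq> b" "b \<noteq> c" "a \<noteq> c" using K(2) by (auto simp: card_3_iff)
  have "list_all (\<lambda>a. list_all (\<lambda>b. list_all (\<lambda>c. a = b \<or> b = c \<or> a = c \<or>
      list_ex (\<lambda>ts. list_all (\<lambda>j. j = a \<or> j = b \<or> j = c) (foliations ts) \<and>
        a \<in> set (foliations ts) \<and> b \<in> set (foliations ts) \<and> c \<in> set (foliations ts))
      (hexagonal_logs @ hexagonal_rationals)) ?J) ?J) ?J"
    by code_simp
  moreover have "a \<in> set ?J" "b \<in> set ?J" "c \<in> set ?J" using K(1) abc(1) by auto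
  ultimately obtain ts where ts: "ts \<in> set (hexagonal_logs @ hexagonal_rationals)"
      "\<forall>j\<in>set (foliations ts). j = a \<or> j = b \<or> j = c" "{a, b, c} \<subseteq> set (foliations ts)"
    unfolding list_all_iff list_ex_iff using abc(2-4) by blast
  have KF: "K = set (foliations ts)" using ts(2,3) abc(1) by blast
  have K9: "set (foliations ts) \<subseteq> {1..9}" using K(1) unfolding KF by auto
  have rel: "terms_ok (set (foliations ts)) \<omega> ts \<and> rel_holds (branch \<omega>) \<omega> ts"
  proof (cases "ts \<in> set hexagonal_logs")
    case True
    have "list_all (\<lambda>ts. log_check (foliations ts) (foliations ts) ts) hexagonal_logs"
      by code_simp
    then have chk: "log_check (foliations ts) (foliations ts) ts" using True by (simp add: list_all_iff)
    show ?thesis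
      by (rule log_check_sound[OF off_axes K9 _ chk]) (use Un1 K(1) KF in auto)
  next
    case False
    then have "ts \<in> set hexagonal_rationals" using ts(1) by simp
    then show ?thesis using rational_relations_hold[OF off_axes]
      by (auto simp: hexagonal_rationals_def terms_ok_def admissible_def rel_defs foliations_def simp del: U.simps)
  qed
  have "list_all has_single_term (hexagonal_logs @ hexagonal_rationals)"
    by code_simp
  then have single: "has_single_term ts" using ts(1) unfolding list_all_iff by blast
  have "\<omega> \<in> regular_locus K" using regular_locus_antimono[OF K(1)] \<omega> by blast
  then show "parallelisable_at K \<omega>"
    using parallelisable_from_terms[OF off_axes _ _ K9 rel single] K(2) unfolding KF by blast
qed

section \<open>Second derivatives of holomorphic functions of two variables\<close>

lemma slice_derivatives:
  assumes "(f has_derivative (\<lambda>v. a * fst v + b * snd v)) (at (x, y))"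
  shows "((\<lambda>x. f (x, y)) has_field_derivative a) (at x)"
    and "((\<lambda>y. f (x, y)) has_field_derivative b) (at (y::complex))"
proof -
  have "((\<lambda>x. (x, y)) has_derivative (\<lambda>h. (h, 0))) (at x)"
    by (rule has_derivative_eq_rhs, (rule derivative_intros)+) auto
  from has_derivative_compose[OF this assms]
  have "((\<lambda>x. f (x, y)) has_derivative (\<lambda>h. a * fst (h, 0) + b * snd (h, 0))) (at x)" by simp
  then show "((\<lambda>x. f (x, y)) has_field_derivative a) (at x)"
    unfolding has_field_derivative_def by simp
  have "((\<lambda>y. (x, y)) has_derivative (\<lambda>h. (0, h))) (at y)"
    by (rule has_derivative_eq_rhs, (rule derivative_intros)+) auto
  from has_derivative_compose[OF this assms]
  have "((\<lambda>y. f (x, y)) has_derivative (\<lambda>h. a * fst (0, h) + b * snd (0, h))) (at y)" by simp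
  then show "((\<lambda>y. f (x, y)) has_field_derivative b) (at y)"
    unfolding has_field_derivative_def by simp
qed

text \<open>The speed of the circle of radius \<open>r\<close> parametrised by \<open>{0..1}\<close>.\<close>

definition circle' :: "real \<Rightarrow> real \<Rightarrow> complex" where
  "circle' r t = 2 * of_real pi * \<i> * of_real r * exp (2 * of_real pi * \<i> * of_real t)"

text \<open>Cauchy's formula for the derivative, in the first variable.\<close>

lemma cauchy_slice:
  fixes f :: "complex \<times> complex \<Rightarrow> complex"
  assumes der: "\<And>q. q \<in> W \<Longrightarrow> (f has_derivative (\<lambda>v. fx q * fst v + fy q * snd v)) (at q)"
    and sub: "cball x0 r \<times> cball y0 r \<subseteq> W" and xy: "x \<in> ball x0 r" "y \<in> cball y0 r"
  shows "fx (x, y) = 1 / (2 * of_real pi * \<i>) *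
    integral (cbox 0 1) (\<lambda>t. f (circlepath x0 r t, y) / (circlepath x0 r t - x)\<^sup>2 * circle' r t)"
    and "(\<lambda>t. f (circlepath x0 r t, y) / (circlepath x0 r t - x)\<^sup>2 * circle' r t) integrable_on cbox 0 1"
proof -
  have d: "((\<lambda>x. f (x, y)) has_field_derivative fx (z, y)) (at z)" if "z \<in> cball x0 r" for z
    by (rule slice_derivatives(1)[OF der]) (use sub that xy in auto)
  have cont: "continuous_on (cball x0 r) (\<lambda>x. f (x, y))"
    using d DERIV_isCont continuous_at_imp_continuous_on by blast
  have hol: "(\<lambda>x. f (x, y)) holomorphic_on ball x0 r"
    using d unfolding holomorphic_on_def
    by (meson ball_subset_cball field_differentiable_at_within field_differentiable_def subsetD)
  note C = Cauchy_derivative_integral_circlepath[OF cont hol xy(1)]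
  have "fx (x, y) = 1 / (2 * of_real pi * \<i>) *
      contour_integral (circlepath x0 r) (\<lambda>u. f (u, y) / (u - x)\<^sup>2)"
    by (rule DERIV_unique[OF d C(2)]) (use xy in auto)
  then show "fx (x, y) = 1 / (2 * of_real pi * \<i>) *
      integral (cbox 0 1) (\<lambda>t. f (circlepath x0 r t, y) / (circlepath x0 r t - x)\<^sup>2 * circle' r t)"
    by (simp add: contour_integral_integral vector_derivative_circlepath circle'_def cbox_interval)
  show "(\<lambda>t. f (circlepath x0 r t, y) / (circlepath x0 r t - x)\<^sup>2 * circle' r t) integrable_on cbox 0 1"
    using C(1) by (simp add: contour_integrable_on vector_derivative_circlepath circle'_def cbox_interval)
qed

lemma continuous_on_cauchy_kernel:
  fixes g :: "complex \<times> complex \<Rightarrow> complex"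
  assumes g: "continuous_on (cball x0 r \<times> cball y0 r) g" and "r > 0"
  shows "continuous_on ((ball x0 r \<times> ball y0 r) \<times> cbox 0 1)
    (\<lambda>(q, t). g (circlepath x0 r t, snd q) / (circlepath x0 r t - fst q)\<^sup>2 * circle' r t)"
proof -
  have circle: "dist x0 (circlepath x0 r t) = r" for t
    using \<open>r > 0\<close> by (simp add: circlepath dist_norm norm_mult)
  have ne: "circlepath x0 r t \<noteq> x" if "x \<in> ball x0 r" for x t
    using circle[of t] that by auto
  have cc: "continuous_on S (\<lambda>p. circlepath x0 r (snd p))" for S :: "((complex \<times> complex) \<times> real) set"
    unfolding circlepath by (intro continuous_intros)
  have gc: "continuous_on ((ball x0 r \<times> ball y0 r) \<times> cbox 0 1) (\<lambda>p. g (circlepath x0 r (snd p), snd (fst p)))"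
    by (rule continuous_on_compose2[OF g]) (use circle in \<open>auto intro!: continuous_intros cc\<close>)
  show ?thesis
    unfolding split_beta circle'_def
    by (intro continuous_intros gc cc) (use ne in auto)
qed

lemma cball_times_in_open:
  fixes W :: "(complex \<times> complex) set"
  assumes "open W" "(x0, y0) \<in> W"
  obtains r where "r > 0" "cball x0 r \<times> cball y0 r \<subseteq> W"
proof -
  obtain A B where AB: "open A" "open B" "(x0, y0) \<in> A \<times> B" "A \<times> B \<subseteq> W"
    using open_prod_elim[OF assms] by blast
  obtain a b where "a > 0" "cball x0 a \<subseteq> A" "b > 0" "cball y0 b \<subseteq> B"
    using AB open_contains_cball by (metis mem_Sigma_iff)
  then have "min a b > 0" "cball x0 (min a b) \<times> cball y0 (min a b) \<subseteq> W"
    using AB(4) by (auto simp: subset_iff)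
  then show ?thesis using that by blast
qed

text \<open>In Cauchy's formula the integrand depends continuously on both variables.\<close>

lemma continuous_first_partial:
  fixes f :: "complex \<times> complex \<Rightarrow> complex"
  assumes "open W" and der: "\<And>q. q \<in> W \<Longrightarrow> (f has_derivative (\<lambda>v. fx q * fst v + fy q * snd v)) (at q)"
  shows "continuous_on W fx"
proof (intro continuous_at_imp_continuous_on ballI)
  fix p assume p: "p \<in> W"
  obtain x0 y0 where p0: "p = (x0, y0)" by (cases p)
  obtain r where r: "r > 0" "cball x0 r \<times> cball y0 r \<subseteq> W"
    using cball_times_in_open[OF assms(1)] p p0 by metis
  have "continuous_on W f"
    using der has_derivative_continuous continuous_at_imp_continuous_on by blast
  then have cf: "continuous_on (cball x0 r \<times> cball y0 r) f" using r(2) continuous_on_subset by blast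
  have "continuous_on (ball x0 r \<times> ball y0 r) (\<lambda>q. integral (cbox 0 1)
      (\<lambda>t. f (circlepath x0 r t, snd q) / (circlepath x0 r t - fst q)\<^sup>2 * circle' r t))"
    using continuous_on_cauchy_kernel[OF cf r(1)] by (rule integral_continuous_on_param)
  then have "continuous_on (ball x0 r \<times> ball y0 r) (\<lambda>q. 1 / (2 * of_real pi * \<i>) * integral (cbox 0 1)
      (\<lambda>t. f (circlepath x0 r t, snd q) / (circlepath x0 r t - fst q)\<^sup>2 * circle' r t))"
    by (intro continuous_intros)
  moreover have "fx q = 1 / (2 * of_real pi * \<i>) * integral (cbox 0 1)
      (\<lambda>t. f (circlepath x0 r t, snd q) / (circlepath x0 r t - fst q)\<^sup>2 * circle' r t)"
    if "q \<in> ball x0 r \<times> ball y0 r" for q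
    using cauchy_slice(1)[OF der r(2), of "fst q" "snd q"] that by auto
  ultimately have "continuous_on (ball x0 r \<times> ball y0 r) fx"
    by (simp cong: continuous_on_cong)
  then show "isCont fx p"
    using r(1) p0 by (simp add: continuous_on_eq_continuous_at open_Times)
qed

lemma has_derivative_swap:
  fixes f :: "complex \<times> complex \<Rightarrow> complex"
  assumes "(f has_derivative (\<lambda>v. a * fst v + b * snd v)) (at (prod.swap q))"
  shows "((\<lambda>q. f (prod.swap q)) has_derivative (\<lambda>v. b * fst v + a * snd v)) (at q)"
proof -
  have "(prod.swap has_derivative prod.swap) (at q)"
    unfolding prod.swap_def
    by (rule has_derivative_eq_rhs, (rule derivative_intros)+) (auto simp: fun_eq_iff)
  from has_derivative_compose[OF this assms]
  show ?thesis by (simp add: add.commute prod.swap_def)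
qed

lemma open_swap_image: "open W \<Longrightarrow> open (prod.swap -` (W :: (complex \<times> complex) set))"
  by (rule open_vimage) (auto intro!: continuous_intros simp: prod.swap_def)

lemma continuous_second_partial:
  fixes f :: "complex \<times> complex \<Rightarrow> complex"
  assumes "open W" and der: "\<And>q. q \<in> W \<Longrightarrow> (f has_derivative (\<lambda>v. fx q * fst v + fy q * snd v)) (at q)"
  shows "continuous_on W fy"
proof -
  have "continuous_on (prod.swap -` W) (\<lambda>q. fy (prod.swap q))"
    by (rule continuous_first_partial[of _ "\<lambda>q. f (prod.swap q)" _ "\<lambda>q. fx (prod.swap q)"])
       (use der has_derivative_swap open_swap_image[OF assms(1)] in auto)
  moreover have "continuous_on W prod.swap"
    unfolding prod.swap_def by (intro continuous_intros)
  ultimately have "continuous_on W (\<lambda>q. fy (prod.swap (prod.swap q)))"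
    by (rule continuous_on_compose2) auto
  then show ?thesis by simp
qed

text \<open>The first partial derivative is holomorphic in \<open>x\<close>. Differentiation under Cauchy's integral gives its
derivative in \<open>y\<close>, which is continuous in both variables because \<open>fy\<close> is.\<close>

lemma first_partial_differentiable:
  fixes f :: "complex \<times> complex \<Rightarrow> complex"
  assumes "open W" and der: "\<And>q. q \<in> W \<Longrightarrow> (f has_derivative (\<lambda>v. fx q * fst v + fy q * snd v)) (at q)"
    and p: "p \<in> W"
  shows "\<exists>a b. (fx has_derivative (\<lambda>v. a * fst v + b * snd v)) (at p)"
proof -
  obtain x0 y0 where p0: "p = (x0, y0)" by (cases p)
  obtain r where r: "r > 0" "cball x0 r \<times> cball y0 r \<subseteq> W"
    using cball_times_in_open[OF assms(1)] p p0 by metis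
  let ?X = "ball x0 r" and ?Y = "ball y0 r"
  define fxy where "fxy q = 1 / (2 * of_real pi * \<i>) * integral (cbox 0 1)
      (\<lambda>t. fy (circlepath x0 r t, snd q) / (circlepath x0 r t - fst q)\<^sup>2 * circle' r t)" for q
  have cfy: "continuous_on (cball x0 r \<times> cball y0 r) fy"
    using continuous_second_partial[OF assms(1) der] r(2) continuous_on_subset by blast
  \<comment> \<open>the integrand of the derivative in \<open>y\<close>\<close>
  have kern: "continuous_on ((?X \<times> ?Y) \<times> cbox 0 1)
    (\<lambda>(q, t). fy (circlepath x0 r t, snd q) / (circlepath x0 r t - fst q)\<^sup>2 * circle' r t)"
    by (rule continuous_on_cauchy_kernel[OF cfy r(1)])
  have cfxy: "continuous_on (?X \<times> ?Y) fxy"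
    unfolding fxy_def by (intro continuous_intros integral_continuous_on_param[OF kern])
  have circle: "dist x0 (circlepath x0 r t) = r" for t
    using \<open>r > 0\<close> by (simp add: circlepath dist_norm norm_mult)
  have dy: "((\<lambda>y. fx (x, y)) has_field_derivative fxy (x, y)) (at y within ?Y)" if "x \<in> ?X" "y \<in> ?Y" for x y
  proof -
    have "((\<lambda>y. integral (cbox 0 1) (\<lambda>t. f (circlepath x0 r t, y) / (circlepath x0 r t - x)\<^sup>2 * circle' r t))
       has_field_derivative integral (cbox 0 1)
         (\<lambda>t. fy (circlepath x0 r t, y) / (circlepath x0 r t - x)\<^sup>2 * circle' r t)) (at y within ?Y)"
    proof (rule leibniz_rule_field_derivative[where fx = "\<lambda>y t. fy (circlepath x0 r t, y) / (circlepath x0 r t - x)\<^sup>2 * circle' r t"])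
      fix y t assume y: "y \<in> ?Y"
      have "((\<lambda>y. f (circlepath x0 r t, y)) has_field_derivative fy (circlepath x0 r t, y)) (at y)"
        by (rule slice_derivatives(2)[OF der]) (use r(2) y circle[of t] in auto)
      then show "((\<lambda>y. f (circlepath x0 r t, y) / (circlepath x0 r t - x)\<^sup>2 * circle' r t) has_field_derivative
         fy (circlepath x0 r t, y) / (circlepath x0 r t - x)\<^sup>2 * circle' r t) (at y within ?Y)"
        by (rule has_field_derivative_at_within[OF DERIV_cmult_right[OF DERIV_cdivide]])
    next
      fix y assume "y \<in> ?Y"
      then show "(\<lambda>t. f (circlepath x0 r t, y) / (circlepath x0 r t - x)\<^sup>2 * circle' r t) integrable_on cbox 0 1"
        using cauchy_slice(2)[OF der r(2), of x y] that by auto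
    next
      have c1: "continuous_on (?Y \<times> cbox 0 1) (\<lambda>p. ((x, fst p), snd p))" by (intro continuous_intros)
      have c2: "(\<lambda>p. ((x, fst p), snd p)) ` (?Y \<times> cbox 0 1) \<subseteq> (?X \<times> ?Y) \<times> cbox (0::real) 1"
        using that by auto
      show "continuous_on (?Y \<times> cbox 0 1)
         (\<lambda>(y, t). fy (circlepath x0 r t, y) / (circlepath x0 r t - x)\<^sup>2 * circle' r t)"
        using continuous_on_compose2[OF kern c1 c2] by (simp add: split_beta)
    qed (use that in auto)
    then have "((\<lambda>y. 1 / (2 * of_real pi * \<i>) * integral (cbox 0 1)
         (\<lambda>t. f (circlepath x0 r t, y) / (circlepath x0 r t - x)\<^sup>2 * circle' r t))
       has_field_derivative fxy (x, y)) (at y within ?Y)"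
      unfolding fxy_def fst_conv snd_conv by (rule DERIV_cmult)
    then show ?thesis
      by (rule has_field_derivative_transform_within[OF _ zero_less_one])
         (use cauchy_slice(1)[OF der r(2)] that in auto)
  qed
  have "\<exists>a. ((\<lambda>x. fx (x, y0)) has_field_derivative a) (at x0)"
  proof -
    have d: "((\<lambda>x. f (x, y0)) has_field_derivative fx (z, y0)) (at z)" if "z \<in> ?X" for z
      by (rule slice_derivatives(1)[OF der]) (use r that in auto)
    then have "(\<lambda>x. f (x, y0)) holomorphic_on ?X"
      unfolding holomorphic_on_def
      by (meson field_differentiable_at_within field_differentiable_def)
    then have "deriv (\<lambda>x. f (x, y0)) holomorphic_on ?X" by (rule holomorphic_deriv) simp
    then obtain a where "(deriv (\<lambda>x. f (x, y0)) has_field_derivative a) (at x0)"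
      using r(1) holomorphic_derivI[of _ ?X x0] by (metis centre_in_ball open_ball)
    moreover have "fx (z, y0) = deriv (\<lambda>x. f (x, y0)) z" if "z \<in> ?X" for z
      using DERIV_imp_deriv[OF d[OF that]] by simp
    ultimately have "((\<lambda>x. fx (x, y0)) has_field_derivative a) (at x0)"
      using r(1) by (elim has_field_derivative_transform_within_open[of _ _ _ ?X]) auto
    then show ?thesis ..
  qed
  then obtain a where a: "((\<lambda>x. fx (x, y0)) has_field_derivative a) (at x0)" ..
  have "((\<lambda>(x, y). fx (x, y)) has_derivative (\<lambda>(tx, ty). a * tx + blinfun_mult_right (fxy (x0, y0)) ty))
      (at (x0, y0) within ?X \<times> ?Y)"
  proof (rule has_derivative_partialsI[where fy = "\<lambda>x y. blinfun_mult_right (fxy (x, y))"])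
    show "((\<lambda>x. fx (x, y0)) has_derivative (*) a) (at x0 within ?X)"
      using a has_field_derivative_at_within has_field_derivative_def by blast
    show "((\<lambda>y. fx (x, y)) has_derivative blinfun_apply (blinfun_mult_right (fxy (x, y)))) (at y within ?Y)"
      if "x \<in> ?X" "y \<in> ?Y" for x y
      using dy[OF that] by (simp add: has_field_derivative_def)
    have "continuous_on (?X \<times> ?Y) (\<lambda>q. blinfun_mult_right (fxy q))"
      by (rule bounded_linear.continuous_on[OF bounded_linear_blinfun_mult_right cfxy])
    then show "continuous (at (x0, y0) within ?X \<times> ?Y) (\<lambda>(x, y). blinfun_mult_right (fxy (x, y)))"
      using r(1) by (simp add: continuous_on_eq_continuous_within case_prod_unfold)
  qed (use r(1) in auto)
  then have "(fx has_derivative (\<lambda>v. a * fst v + fxy (x0, y0) * snd v)) (at p)"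
    using r(1) p0 by (simp add: case_prod_unfold at_within_open[OF _ open_Times])
  then show ?thesis by blast
qed

lemma second_partial_differentiable:
  fixes f :: "complex \<times> complex \<Rightarrow> complex"
  assumes "open W" and der: "\<And>q. q \<in> W \<Longrightarrow> (f has_derivative (\<lambda>v. fx q * fst v + fy q * snd v)) (at q)"
    and p: "p \<in> W"
  shows "\<exists>a b. (fy has_derivative (\<lambda>v. a * fst v + b * snd v)) (at p)"
proof -
  have "\<exists>a b. ((\<lambda>q. fy (prod.swap q)) has_derivative (\<lambda>v. a * fst v + b * snd v)) (at (prod.swap p))"
    by (rule first_partial_differentiable[of "prod.swap -` W" "\<lambda>q. f (prod.swap q)" _ "\<lambda>q. fx (prod.swap q)"])
       (use der has_derivative_swap open_swap_image[OF assms(1)] p in auto)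
  then obtain a b where "((\<lambda>q. fy (prod.swap q)) has_derivative (\<lambda>v. a * fst v + b * snd v)) (at (prod.swap p))"
    by blast
  from has_derivative_swap[OF this] show ?thesis by auto
qed

section \<open>Curvature of leaves and cubic forms\<close>

definition det2 :: "complex \<times> complex \<Rightarrow> complex \<times> complex \<Rightarrow> complex" where
  "det2 v w = fst v * snd w - snd v * fst w"

text \<open>The curve \<open>c\<close> is holomorphic near 0 with value \<open>p\<close>, velocity \<open>v\<close> and acceleration \<open>w\<close> at 0.\<close>

definition jet2 :: "(complex \<Rightarrow> complex \<times> complex) \<Rightarrow> complex \<times> complex \<Rightarrow> complex \<times> complex \<Rightarrow> complex \<times> complex \<Rightarrow> bool" where
  "jet2 c p v w \<longleftrightarrow> c 0 = p \<and> (\<exists>d1 d2.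
     (\<forall>\<^sub>F t in nhds 0. ((\<lambda>t. fst (c t)) has_field_derivative d1 t) (at t) \<and>
        ((\<lambda>t. snd (c t)) has_field_derivative d2 t) (at t)) \<and>
     v = (d1 0, d2 0) \<and> (d1 has_field_derivative fst w) (at 0) \<and> (d2 has_field_derivative snd w) (at 0))"

lemma jet2_tendsto:
  assumes "jet2 c p v w"
  shows "(c \<longlongrightarrow> p) (nhds 0)"
proof -
  obtain d1 d2 where c0: "c 0 = p" and ev: "\<forall>\<^sub>F t in nhds 0. ((\<lambda>t. fst (c t)) has_field_derivative d1 t) (at t) \<and>
        ((\<lambda>t. snd (c t)) has_field_derivative d2 t) (at t)"
    using assms unfolding jet2_def by blast
  from eventually_nhds_x_imp_x[OF ev] have "isCont (\<lambda>t. fst (c t)) 0" "isCont (\<lambda>t. snd (c t)) 0" using DERIV_isCont by blast+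
  then have "isCont (\<lambda>t. (fst (c t), snd (c t))) 0" by (rule isCont_Pair)
  then show ?thesis using c0 by (simp add: isCont_def tendsto_nhds_iff)
qed

lemma jet2_if_analytic:
  assumes "(\<lambda>t. fst (c t)) analytic_on {0}" "(\<lambda>t. snd (c t)) analytic_on {0}"
  shows "jet2 c (c 0) (deriv (\<lambda>t. fst (c t)) 0, deriv (\<lambda>t. snd (c t)) 0)
    (deriv (deriv (\<lambda>t. fst (c t))) 0, deriv (deriv (\<lambda>t. snd (c t))) 0)"
proof -
  have *: "(\<forall>\<^sub>F t in nhds 0. (f has_field_derivative deriv f t) (at t)) \<and> (deriv f has_field_derivative deriv (deriv f) 0) (at 0)"
    if an: "f analytic_on {0}" for f :: "complex \<Rightarrow> complex"
  proof -
    obtain S where S: "open S" "0 \<in> S" "f holomorphic_on S" using an analytic_at by blast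
    have "\<forall>\<^sub>F t in nhds 0. t \<in> S" using S by (simp add: eventually_nhds_in_open)
    then have "\<forall>\<^sub>F t in nhds 0. (f has_field_derivative deriv f t) (at t)"
      by eventually_elim (use S holomorphic_derivI in blast)
    moreover have "(deriv f has_field_derivative deriv (deriv f) 0) (at 0)"
      using holomorphic_derivI[OF holomorphic_deriv[OF S(3,1)] S(1,2)] .
    ultimately show ?thesis ..
  qed
  show ?thesis
    unfolding jet2_def
    using *[OF assms(1)] *[OF assms(2)]
    by (intro conjI exI[of _ "deriv (\<lambda>t. fst (c t))"] exI[of _ "deriv (\<lambda>t. snd (c t))"])
       (auto elim: eventually_elim2)
qed

lemma chain_rule_curve:
  fixes f :: "complex \<times> complex \<Rightarrow> complex"
  assumes "(f has_derivative (\<lambda>v. a * fst v + b * snd v)) (at (c t))"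
    and "((\<lambda>t. fst (c t)) has_field_derivative d1) (at t)" "((\<lambda>t. snd (c t)) has_field_derivative d2) (at t)"
  shows "((\<lambda>t. f (c t)) has_field_derivative (a * d1 + b * d2)) (at t)"
proof -
  have "((\<lambda>t. (fst (c t), snd (c t))) has_derivative (\<lambda>h. (d1 * h, d2 * h))) (at t)"
    using assms(2,3) unfolding has_field_derivative_def by (rule has_derivative_Pair)
  then have "(c has_derivative (\<lambda>h. (d1 * h, d2 * h))) (at t)" by simp
  from has_derivative_compose[OF this assms(1)]
  show ?thesis unfolding has_field_derivative_def by (rule has_derivative_eq_rhs) (auto simp: algebra_simps)
qed

definition cubic_form :: "(complex \<times> complex \<Rightarrow> complex) \<Rightarrow> bool" where
  "cubic_form C \<longleftrightarrow> (\<exists>k0 k1 k2 k3. \<forall>a b. C (a, b) = k0 * a ^ 3 + k1 * a\<^sup>2 * b + k2 * a * b\<^sup>2 + k3 * b ^ 3)"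

lemma holomorphic_map_partials:
  assumes "holomorphic_map \<phi> W"
  obtains f1x f1y f2x f2y where
    "\<And>q. q \<in> W \<Longrightarrow> ((\<lambda>q. fst (\<phi> q)) has_derivative (\<lambda>v. f1x q * fst v + f1y q * snd v)) (at q)"
    "\<And>q. q \<in> W \<Longrightarrow> ((\<lambda>q. snd (\<phi> q)) has_derivative (\<lambda>v. f2x q * fst v + f2y q * snd v)) (at q)"
proof -
  define D where "D q = frechet_derivative \<phi> (at q)" for q
  have main: "((\<lambda>q. fst (\<phi> q)) has_derivative (\<lambda>v. fst (D q (1, 0)) * fst v + fst (D q (0, 1)) * snd v)) (at q) \<and>
      ((\<lambda>q. snd (\<phi> q)) has_derivative (\<lambda>v. snd (D q (1, 0)) * fst v + snd (D q (0, 1)) * snd v)) (at q)"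
    if "q \<in> W" for q
  proof -
    obtain D' where D': "(\<phi> has_derivative D') (at q)"
        "\<And>c v. D' (map_prod ((*) c) ((*) c) v) = map_prod ((*) c) ((*) c) (D' v)"
      using assms \<open>q \<in> W\<close> unfolding holomorphic_map_def by blast
    have DD: "D q = D'" unfolding D_def using frechet_derivative_at[OF D'(1)] by simp
    have lin: "D' v = map_prod ((*) (fst v)) ((*) (fst v)) (D' (1, 0)) + map_prod ((*) (snd v)) ((*) (snd v)) (D' (0, 1))" for v
    proof -
      have "v = map_prod ((*) (fst v)) ((*) (fst v)) (1, 0) + map_prod ((*) (snd v)) ((*) (snd v)) (0, 1)"
        by (cases v) simp
      then have "D' v = D' (map_prod ((*) (fst v)) ((*) (fst v)) (1, 0) + map_prod ((*) (snd v)) ((*) (snd v)) (0, 1))"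
        by (rule arg_cong)
      also have "\<dots> = D' (map_prod ((*) (fst v)) ((*) (fst v)) (1, 0)) + D' (map_prod ((*) (snd v)) ((*) (snd v)) (0, 1))"
        by (rule linear_add[OF has_derivative_linear[OF D'(1)]])
      finally show ?thesis unfolding D'(2) .
    qed
    have "(\<lambda>v. fst (D' v)) = (\<lambda>v. fst (D' (1, 0)) * fst v + fst (D' (0, 1)) * snd v)"
      "(\<lambda>v. snd (D' v)) = (\<lambda>v. snd (D' (1, 0)) * fst v + snd (D' (0, 1)) * snd v)"
      by (rule ext, subst lin, simp add: mult.commute)+
    then show ?thesis
      unfolding DD using has_derivative_eq_rhs[OF has_derivative_fst[OF D'(1)]]
        has_derivative_eq_rhs[OF has_derivative_snd[OF D'(1)]] by simp
  qed
  show thesis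
    by (rule that[of "\<lambda>q. fst (D q (1, 0))" "\<lambda>q. fst (D q (0, 1))" "\<lambda>q. snd (D q (1, 0))" "\<lambda>q. snd (D q (0, 1))"])
       (use main in blast)+
qed

text \<open>The chain rule for the second derivative of \<open>f\<close> along a curve with velocity \<open>d\<close> and acceleration \<open>w\<close>;
the quadratic form given by \<open>q11\<close>, \<open>q12\<close>, \<open>q22\<close> is the Hessian of \<open>f\<close> at \<open>p\<close>.\<close>

lemma second_order_transport:
  fixes f fx fy :: "complex \<times> complex \<Rightarrow> complex"
  assumes "open W" "p \<in> W"
    and d: "\<And>q. q \<in> W \<Longrightarrow> (f has_derivative (\<lambda>v. fx q * fst v + fy q * snd v)) (at q)"
  obtains q11 q12 q22 where
    "\<And>c w d1 d2. c 0 = p \<Longrightarrow>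
      \<forall>\<^sub>F t in nhds 0. ((\<lambda>t. fst (c t)) has_field_derivative d1 t) (at t) \<and>
        ((\<lambda>t. snd (c t)) has_field_derivative d2 t) (at t) \<Longrightarrow>
      (d1 has_field_derivative fst w) (at 0) \<Longrightarrow> (d2 has_field_derivative snd w) (at 0) \<Longrightarrow>
      (\<forall>\<^sub>F t in nhds 0. ((\<lambda>t. f (c t)) has_field_derivative fx (c t) * d1 t + fy (c t) * d2 t) (at t)) \<and>
      ((\<lambda>t. fx (c t) * d1 t + fy (c t) * d2 t) has_field_derivative
        fx p * fst w + fy p * snd w + (q11 * (d1 0)\<^sup>2 + q12 * d1 0 * d2 0 + q22 * (d2 0)\<^sup>2)) (at 0)"
proof -
  obtain a1 b1 where fx: "(fx has_derivative (\<lambda>v. a1 * fst v + b1 * snd v)) (at p)"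
    using first_partial_differentiable[OF assms(1) d assms(2)] by blast
  obtain a2 b2 where fy: "(fy has_derivative (\<lambda>v. a2 * fst v + b2 * snd v)) (at p)"
    using second_partial_differentiable[OF assms(1) d assms(2)] by blast
  show thesis
  proof (rule that[of a1 "b1 + a2" b2], intro conjI)
    fix c d1 d2 and w :: "complex \<times> complex"
    assume c0: "c 0 = p" and ev: "\<forall>\<^sub>F t in nhds 0. ((\<lambda>t. fst (c t)) has_field_derivative d1 t) (at t) \<and>
        ((\<lambda>t. snd (c t)) has_field_derivative d2 t) (at t)"
      and dd: "(d1 has_field_derivative fst w) (at 0)" "(d2 has_field_derivative snd w) (at 0)"
    have e0: "((\<lambda>t. fst (c t)) has_field_derivative d1 0) (at 0)" "((\<lambda>t. snd (c t)) has_field_derivative d2 0) (at 0)"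
      using eventually_nhds_x_imp_x[OF ev] by simp_all
    have "jet2 c p (d1 0, d2 0) w" using c0 ev dd unfolding jet2_def by blast
    then have "(c \<longlongrightarrow> p) (nhds 0)" by (rule jet2_tendsto)
    then have "\<forall>\<^sub>F t in nhds 0. c t \<in> W" using assms(1,2) by (rule topological_tendstoD)
    with ev show "\<forall>\<^sub>F t in nhds 0. ((\<lambda>t. f (c t)) has_field_derivative fx (c t) * d1 t + fy (c t) * d2 t) (at t)"
      by eventually_elim (auto intro!: chain_rule_curve d)
    have "((\<lambda>t. fx (c t)) has_field_derivative (a1 * d1 0 + b1 * d2 0)) (at 0)"
      "((\<lambda>t. fy (c t)) has_field_derivative (a2 * d1 0 + b2 * d2 0)) (at 0)"
      by (rule chain_rule_curve[OF _ e0]; use fx fy c0 in simp)+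
    from DERIV_add[OF DERIV_mult[OF this(1) dd(1)] DERIV_mult[OF this(2) dd(2)]]
    show "((\<lambda>t. fx (c t) * d1 t + fy (c t) * d2 t) has_field_derivative
        fx p * fst w + fy p * snd w + (a1 * (d1 0)\<^sup>2 + (b1 + a2) * d1 0 * d2 0 + b2 * (d2 0)\<^sup>2)) (at 0)"
      by (rule DERIV_cong) (simp add: c0 algebra_simps power2_eq_square)
  qed
qed

text \<open>If \<open>L\<close> is the differential and \<open>Q\<close> the Hessian of \<open>\<phi>\<close> at \<open>p\<close>, then the image curve has velocity \<open>L v\<close> and
acceleration \<open>L w + Q v\<close>, so its determinant is \<open>det L * det (v, w) + det (L v, Q v)\<close>. The second summand
is the cubic form \<open>C\<close>.\<close>

lemma biholomorphism_second_order:
  assumes bi: "biholomorphism \<phi> W" and p: "p \<in> W"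
  obtains a b c d C where "a * d - b * c \<noteq> 0" "cubic_form C"
    "\<And>\<gamma> v w. jet2 \<gamma> p v w \<Longrightarrow> \<exists>w'. jet2 (\<lambda>t. \<phi> (\<gamma> t)) (\<phi> p) (a * fst v + b * snd v, c * fst v + d * snd v) w' \<and>
      det2 (a * fst v + b * snd v, c * fst v + d * snd v) w' = (a * d - b * c) * det2 v w + C v"
proof -
  have W: "open W" "open (\<phi> ` W)" "inj_on \<phi> W" "holomorphic_map \<phi> W" "holomorphic_map (inv_into W \<phi>) (\<phi> ` W)"
    using bi by (simp_all add: biholomorphism_def)
  obtain f1x f1y f2x f2y where d1: "\<And>q. q \<in> W \<Longrightarrow> ((\<lambda>q. fst (\<phi> q)) has_derivative (\<lambda>v. f1x q * fst v + f1y q * snd v)) (at q)"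
    and d2: "\<And>q. q \<in> W \<Longrightarrow> ((\<lambda>q. snd (\<phi> q)) has_derivative (\<lambda>v. f2x q * fst v + f2y q * snd v)) (at q)"
    by (rule holomorphic_map_partials[OF W(4)]) (rule that; assumption)
  obtain q11 q12 q22 where t1: "\<And>c w d1 d2. c 0 = p \<Longrightarrow>
      \<forall>\<^sub>F t in nhds 0. ((\<lambda>t. fst (c t)) has_field_derivative d1 t) (at t) \<and>
        ((\<lambda>t. snd (c t)) has_field_derivative d2 t) (at t) \<Longrightarrow>
      (d1 has_field_derivative fst w) (at 0) \<Longrightarrow> (d2 has_field_derivative snd w) (at 0) \<Longrightarrow>
      (\<forall>\<^sub>F t in nhds 0. ((\<lambda>t. fst (\<phi> (c t))) has_field_derivative f1x (c t) * d1 t + f1y (c t) * d2 t) (at t)) \<and>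
      ((\<lambda>t. f1x (c t) * d1 t + f1y (c t) * d2 t) has_field_derivative
        f1x p * fst w + f1y p * snd w + (q11 * (d1 0)\<^sup>2 + q12 * d1 0 * d2 0 + q22 * (d2 0)\<^sup>2)) (at 0)"
    by (rule second_order_transport[OF W(1) p d1]) (assumption, (rule that; assumption))
  obtain r11 r12 r22 where t2: "\<And>c w d1 d2. c 0 = p \<Longrightarrow>
      \<forall>\<^sub>F t in nhds 0. ((\<lambda>t. fst (c t)) has_field_derivative d1 t) (at t) \<and>
        ((\<lambda>t. snd (c t)) has_field_derivative d2 t) (at t) \<Longrightarrow>
      (d1 has_field_derivative fst w) (at 0) \<Longrightarrow> (d2 has_field_derivative snd w) (at 0) \<Longrightarrow>
      (\<forall>\<^sub>F t in nhds 0. ((\<lambda>t. snd (\<phi> (c t))) has_field_derivative f2x (c t) * d1 t + f2y (c t) * d2 t) (at t)) \<and>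
      ((\<lambda>t. f2x (c t) * d1 t + f2y (c t) * d2 t) has_field_derivative
        f2x p * fst w + f2y p * snd w + (r11 * (d1 0)\<^sup>2 + r12 * d1 0 * d2 0 + r22 * (d2 0)\<^sup>2)) (at 0)"
    by (rule second_order_transport[OF W(1) p d2]) (assumption, (rule that; assumption))
  define C where "C v = (f1x p * fst v + f1y p * snd v) * (r11 * (fst v)\<^sup>2 + r12 * fst v * snd v + r22 * (snd v)\<^sup>2)
      - (f2x p * fst v + f2y p * snd v) * (q11 * (fst v)\<^sup>2 + q12 * fst v * snd v + q22 * (snd v)\<^sup>2)" for v :: "complex \<times> complex"
  have "cubic_form C"
    unfolding cubic_form_def C_def
    by (rule exI[of _ "f1x p * r11 - f2x p * q11"], rule exI[of _ "f1x p * r12 + f1y p * r11 - f2x p * q12 - f2y p * q11"],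
        rule exI[of _ "f1x p * r22 + f1y p * r12 - f2x p * q22 - f2y p * q12"], rule exI[of _ "f1y p * r22 - f2y p * q22"])
       (simp add: algebra_simps power2_eq_square power3_eq_cube)
  moreover have "f1x p * f2y p - f1y p * f2x p \<noteq> 0"
  proof
    assume det0: "f1x p * f2y p - f1y p * f2x p = 0"
    obtain D where D: "(inv_into W \<phi> has_derivative D) (at (\<phi> p))"
      using W(5) p unfolding holomorphic_map_def by blast
    define L where "L v = (f1x p * fst v + f1y p * snd v, f2x p * fst v + f2y p * snd v)" for v
    have L: "(\<phi> has_derivative L) (at p)"
      using has_derivative_Pair[OF d1[OF p] d2[OF p]] by (simp add: L_def[abs_def])
    have "((\<lambda>q. inv_into W \<phi> (\<phi> q)) has_derivative (\<lambda>v. D (L v))) (at p)"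
      using has_derivative_compose[OF L D] .
    moreover have "((\<lambda>q. inv_into W \<phi> (\<phi> q)) has_derivative (\<lambda>v. v)) (at p)"
      by (rule has_derivative_transform_within_open[OF has_derivative_ident W(1) p]) (use W(3) in simp)
    \<comment> \<open>the inverse map has a differential that is a left inverse of \<open>L\<close>\<close>
    ultimately have id: "D (L v) = v" for v using has_derivative_unique by metis
    have D0: "D (0, 0) = (0, 0)" using linear_0[OF has_derivative_linear[OF D]] by (simp add: zero_prod_def)
    have "L (f1y p, - f1x p) = (0, 0)" "L (f2y p, - f2x p) = (0, 0)"
      using det0 by (simp_all add: L_def algebra_simps)
    then have "f1y p = 0 \<and> f1x p = 0" "f2y p = 0 \<and> f2x p = 0"
      using id D0 by (metis Pair_inject neg_0_equal_iff_equal neg_equal_0_iff_equal)+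
    then have "L (1, 0) = (0, 0)" by (simp add: L_def)
    then show False using id[of "(1, 0)"] D0 by simp
  qed
  moreover have "\<exists>w'. jet2 (\<lambda>t. \<phi> (\<gamma> t)) (\<phi> p) (f1x p * fst v + f1y p * snd v, f2x p * fst v + f2y p * snd v) w' \<and>
      det2 (f1x p * fst v + f1y p * snd v, f2x p * fst v + f2y p * snd v) w' =
        (f1x p * f2y p - f1y p * f2x p) * det2 v w + C v" if jet: "jet2 \<gamma> p v w" for \<gamma> v w
  proof -
    obtain e1 e2 where e: "\<gamma> 0 = p" "\<forall>\<^sub>F t in nhds 0. ((\<lambda>t. fst (\<gamma> t)) has_field_derivative e1 t) (at t) \<and>
        ((\<lambda>t. snd (\<gamma> t)) has_field_derivative e2 t) (at t)"
        "(e1 has_field_derivative fst w) (at 0)" "(e2 has_field_derivative snd w) (at 0)" and v: "v = (e1 0, e2 0)"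
      using jet unfolding jet2_def by blast
    define w' where "w' = (f1x p * fst w + f1y p * snd w + (q11 * (e1 0)\<^sup>2 + q12 * e1 0 * e2 0 + q22 * (e2 0)\<^sup>2),
       f2x p * fst w + f2y p * snd w + (r11 * (e1 0)\<^sup>2 + r12 * e1 0 * e2 0 + r22 * (e2 0)\<^sup>2))"
    note T1 = t1[OF e] and T2 = t2[OF e]
    have "jet2 (\<lambda>t. \<phi> (\<gamma> t)) (\<phi> p) (f1x p * fst v + f1y p * snd v, f2x p * fst v + f2y p * snd v) w'"
      unfolding jet2_def
    proof (intro conjI exI)
      show "\<forall>\<^sub>F t in nhds 0. ((\<lambda>t. fst (\<phi> (\<gamma> t))) has_field_derivative f1x (\<gamma> t) * e1 t + f1y (\<gamma> t) * e2 t) (at t) \<and>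
          ((\<lambda>t. snd (\<phi> (\<gamma> t))) has_field_derivative f2x (\<gamma> t) * e1 t + f2y (\<gamma> t) * e2 t) (at t)"
        using T1 T2 by (auto elim: eventually_elim2)
    qed (use T1 T2 e(1) v in \<open>simp_all add: w'_def\<close>)
    moreover have "det2 (f1x p * fst v + f1y p * snd v, f2x p * fst v + f2y p * snd v) w' =
        (f1x p * f2y p - f1y p * f2x p) * det2 v w + C v"
      by (simp add: det2_def w'_def C_def v algebra_simps)
    ultimately show ?thesis by blast
  qed
  ultimately show thesis using that by blast
qed

lemma line_has_no_curvature:
  assumes jet: "jet2 c q v w" and L: "complex_line L" and ev: "\<forall>\<^sub>F t in nhds 0. c t \<in> L"
  shows "det2 v w = 0"
proof -
  obtain a b k where ab: "(a, b) \<noteq> (0, 0)" and L': "L = {(x, y). a * x + b * y = k}"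
    using L unfolding complex_line_def by blast
  obtain d1 d2 where d: "\<forall>\<^sub>F t in nhds 0. ((\<lambda>t. fst (c t)) has_field_derivative d1 t) (at t) \<and>
        ((\<lambda>t. snd (c t)) has_field_derivative d2 t) (at t)" "v = (d1 0, d2 0)"
        "(d1 has_field_derivative fst w) (at 0)" "(d2 has_field_derivative snd w) (at 0)"
    using jet unfolding jet2_def by blast
  have "\<forall>\<^sub>F t in nhds 0. \<forall>\<^sub>F s in nhds t. a * fst (c s) + b * snd (c s) = k"
    using ev unfolding L' eventually_eventually by (auto simp: case_prod_unfold)
  with d(1) have first: "\<forall>\<^sub>F t in nhds 0. a * d1 t + b * d2 t = 0"
  proof eventually_elim
    case (elim t)
    have "((\<lambda>s. a * fst (c s) + b * snd (c s)) has_field_derivative a * d1 t + b * d2 t) (at t)"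
      using elim(1) by (intro DERIV_add DERIV_cmult) auto
    moreover have "((\<lambda>s. a * fst (c s) + b * snd (c s)) has_field_derivative 0) (at t)"
      by (subst DERIV_cong_ev[OF refl elim(2) refl]) simp
    ultimately show ?case by (rule DERIV_unique)
  qed
  have "((\<lambda>t. a * d1 t + b * d2 t) has_field_derivative a * fst w + b * snd w) (at 0)"
    using d(3,4) by (intro DERIV_add DERIV_cmult)
  moreover have "((\<lambda>t. a * d1 t + b * d2 t) has_field_derivative 0) (at 0)"
    by (subst DERIV_cong_ev[OF refl first refl]) simp
  ultimately have second: "a * fst w + b * snd w = 0" by (rule DERIV_unique)
  have first0: "a * fst v + b * snd v = 0" using eventually_nhds_x_imp_x[OF first] d(2) by simp
  have "a * det2 v w = (a * fst v + b * snd v) * snd w - snd v * (a * fst w + b * snd w)"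
    "b * det2 v w = fst v * (a * fst w + b * snd w) - (a * fst v + b * snd v) * fst w"
    by (simp_all add: det2_def algebra_simps)
  then show ?thesis using ab first0 second by auto
qed

text \<open>The logarithmic differential of \<open>U j\<close> is \<open>dlog_x j x dx + dlog_y j y dy\<close>.\<close>

definition dlog_x :: "nat \<Rightarrow> complex \<Rightarrow> complex" where
  "dlog_x j x = of_int (letter_exponents j 0 ! 0) / x + of_int (letter_exponents j 0 ! 2) / (x - 1)"

definition dlog_y :: "nat \<Rightarrow> complex \<Rightarrow> complex" where
  "dlog_y j y = of_int (letter_exponents j 0 ! 1) / y + of_int (letter_exponents j 0 ! 3) / (y - 1)"

definition dlog_x' :: "nat \<Rightarrow> complex \<Rightarrow> complex" where
  "dlog_x' j x = - of_int (letter_exponents j 0 ! 0) / x\<^sup>2 - of_int (letter_exponents j 0 ! 2) / (x - 1)\<^sup>2"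

definition dlog_y' :: "nat \<Rightarrow> complex \<Rightarrow> complex" where
  "dlog_y' j y = - of_int (letter_exponents j 0 ! 1) / y\<^sup>2 - of_int (letter_exponents j 0 ! 3) / (y - 1)\<^sup>2"

definition leaf_direction :: "nat \<Rightarrow> complex \<times> complex \<Rightarrow> complex \<times> complex" where
  "leaf_direction j p = (- dlog_y j (snd p), dlog_x j (fst p))"

text \<open>The value of \<open>det (c', c'')\<close> for a parametrisation \<open>c\<close> of the leaf with velocity \<open>leaf_direction j p\<close>.\<close>

definition leaf_curvature :: "nat \<Rightarrow> complex \<times> complex \<Rightarrow> complex" where
  "leaf_curvature j p = dlog_x' j (fst p) * (dlog_y j (snd p))\<^sup>2 + dlog_y' j (snd p) * (dlog_x j (fst p))\<^sup>2"

lemma log_derivative_U: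
  assumes "p \<in> off_axes" "j \<in> {1..9}"
  shows "Ux j p * a + Uy j p * b = U j p * (dlog_x j (fst p) * a + dlog_y j (snd p) * b)"
proof -
  have M: "letter_exponents j 0 ! 4 = 0" "letter_exponents j 0 ! 5 = 0"
    using assms(2) unfolding web_index_cases by (auto simp: letter_exponents_def)
  have "U j p \<noteq> 0"
    using assms unfolding web_index_cases by (cases p) (auto simp: off_axes_def)
  with letter_pullback[OF assms, of 0 "(a, b)"] show ?thesis
    by (cases p) (simp add: M sum_lessThan_6 dlog_form_def dlog_x_def dlog_y_def field_simps del: U.simps)
qed

text \<open>Differentiating \<open>dlog_x (x t) * x' t + dlog_y (y t) * y' t = 0\<close> once more along the leaf expresses
the acceleration through the velocity, up to multiples of the velocity, which do not change the
determinant.\<close>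

lemma leaf_curve_curvature:
  assumes p: "p \<in> off_axes" and j: "j \<in> {1..9}" and nz: "leaf_direction j p \<noteq> (0, 0)"
    and jet: "jet2 c p v w" and v: "v \<noteq> (0, 0)" and leaf: "\<forall>\<^sub>F t in nhds 0. U j (c t) = U j p"
  shows "\<exists>\<mu>. \<mu> \<noteq> 0 \<and> v = (\<mu> * fst (leaf_direction j p), \<mu> * snd (leaf_direction j p)) \<and>
    det2 v w = \<mu> ^ 3 * leaf_curvature j p"
proof -
  obtain x y where xy: "p = (x, y)" by (cases p)
  let ?P = "dlog_x j x" and ?R = "dlog_y j y"
  obtain d1 d2 where d: "\<forall>\<^sub>F t in nhds 0. ((\<lambda>t. fst (c t)) has_field_derivative d1 t) (at t) \<and>
        ((\<lambda>t. snd (c t)) has_field_derivative d2 t) (at t)" "v = (d1 0, d2 0)"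
        "(d1 has_field_derivative fst w) (at 0)" "(d2 has_field_derivative snd w) (at 0)" and c0: "c 0 = p"
    using jet unfolding jet2_def by blast
  have "\<forall>\<^sub>F t in nhds 0. c t \<in> off_axes"
    using jet2_tendsto[OF jet] open_off_axes p by (rule topological_tendstoD)
  moreover have "\<forall>\<^sub>F t in nhds 0. \<forall>\<^sub>F s in nhds t. U j (c s) = U j p"
    using leaf by (simp add: eventually_eventually)
  ultimately have first: "\<forall>\<^sub>F t in nhds 0. dlog_x j (fst (c t)) * d1 t + dlog_y j (snd (c t)) * d2 t = 0"
    using d(1)
  proof eventually_elim
    case (elim t)
    have "((\<lambda>s. U j (c s)) has_field_derivative Ux j (c t) * d1 t + Uy j (c t) * d2 t) (at t)"
      using elim by (intro chain_rule_curve has_derivative_U[OF j off_axes_not_polar[OF _ j]]) auto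
    moreover have "((\<lambda>s. U j (c s)) has_field_derivative 0) (at t)"
      by (subst DERIV_cong_ev[OF refl elim(2) refl]) simp
    ultimately have "Ux j (c t) * d1 t + Uy j (c t) * d2 t = 0" by (rule DERIV_unique)
    moreover have "U j (c t) \<noteq> 0"
      using elim(1) j unfolding web_index_cases by (cases "c t") (auto simp: off_axes_def)
    ultimately show ?case using log_derivative_U[OF elim(1) j, of "d1 t" "d2 t"] by simp
  qed
  have first0: "?P * d1 0 + ?R * d2 0 = 0"
    using eventually_nhds_x_imp_x[OF first] c0 xy by simp
  have g: "x \<noteq> 0" "y \<noteq> 0" "x - 1 \<noteq> 0" "y - 1 \<noteq> 0" using p by (auto simp: xy off_axes_def)
  have e0: "((\<lambda>t. fst (c t)) has_field_derivative d1 0) (at 0)" "((\<lambda>t. snd (c t)) has_field_derivative d2 0) (at 0)"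
    using eventually_nhds_x_imp_x[OF d(1)] by simp_all
  have pole: "((\<lambda>z. k / (z - e)) has_field_derivative - k / (z0 - e)\<^sup>2) (at z0)" if "z0 - e \<noteq> 0" for k e z0 :: complex
    using that by (auto intro!: derivative_eq_intros simp: power2_eq_square)
  have dP: "(dlog_x j has_field_derivative dlog_x' j x) (at x)"
    using DERIV_add[OF pole[of x 0 "of_int (letter_exponents j 0 ! 0)"] pole[of x 1 "of_int (letter_exponents j 0 ! 2)"]] g
    by (simp add: dlog_x_def[abs_def] dlog_x'_def)
  have dR: "(dlog_y j has_field_derivative dlog_y' j y) (at y)"
    using DERIV_add[OF pole[of y 0 "of_int (letter_exponents j 0 ! 1)"] pole[of y 1 "of_int (letter_exponents j 0 ! 3)"]] g
    by (simp add: dlog_y_def[abs_def] dlog_y'_def)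
  have "((\<lambda>t. dlog_x j (fst (c t))) has_field_derivative dlog_x' j x * d1 0) (at 0)"
    by (rule DERIV_chain2[of "dlog_x j"]) (use dP e0 c0 xy in simp_all)
  moreover have "((\<lambda>t. dlog_y j (snd (c t))) has_field_derivative dlog_y' j y * d2 0) (at 0)"
    by (rule DERIV_chain2[of "dlog_y j"]) (use dR e0 c0 xy in simp_all)
  ultimately have "((\<lambda>t. dlog_x j (fst (c t)) * d1 t + dlog_y j (snd (c t)) * d2 t) has_field_derivative
      (dlog_x' j x * d1 0 * d1 0 + fst w * ?P) + (dlog_y' j y * d2 0 * d2 0 + snd w * ?R)) (at 0)"
    using DERIV_add[OF DERIV_mult DERIV_mult, OF _ d(3) _ d(4)] c0 xy by fastforce
  moreover have "((\<lambda>t. dlog_x j (fst (c t)) * d1 t + dlog_y j (snd (c t)) * d2 t) has_field_derivative 0) (at 0)"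
    by (subst DERIV_cong_ev[OF refl first refl]) simp
  ultimately have second: "(dlog_x' j x * d1 0 * d1 0 + fst w * ?P) + (dlog_y' j y * d2 0 * d2 0 + snd w * ?R) = 0"
    by (rule DERIV_unique)
  have "\<exists>\<mu>. d1 0 = - (\<mu> * ?R) \<and> d2 0 = \<mu> * ?P"
  proof (cases "?P = 0")
    case True
    then have "?R \<noteq> 0" using nz by (simp add: leaf_direction_def xy)
    then show ?thesis using first0 True by (intro exI[of _ "- d1 0 / ?R"]) auto
  next
    case False
    then have "d1 0 = - (d2 0 / ?P * ?R)" using first0 by (simp add: field_simps eq_neg_iff_add_eq_0)
    then show ?thesis using False by (intro exI[of _ "d2 0 / ?P"]) auto
  qed
  then obtain \<mu> where \<mu>: "d1 0 = - (\<mu> * ?R)" "d2 0 = \<mu> * ?P" by blast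
  have "\<mu> \<noteq> 0" using v \<mu> d(2) by auto
  moreover have "det2 v w = \<mu> ^ 3 * leaf_curvature j p"
  proof -
    have "det2 v w = - (\<mu> * (fst w * ?P + snd w * ?R))"
      by (simp add: det2_def d(2) \<mu> algebra_simps)
    also have "fst w * ?P + snd w * ?R = - (dlog_x' j x * (d1 0)\<^sup>2 + dlog_y' j y * (d2 0)\<^sup>2)"
      using second by (simp add: power2_eq_square algebra_simps eq_neg_iff_add_eq_0)
    finally show ?thesis
      by (simp add: \<mu> leaf_curvature_def xy algebra_simps power2_eq_square power3_eq_cube)
  qed
  ultimately show ?thesis
    using \<mu> d(2) by (intro exI[of _ \<mu>]) (simp add: leaf_direction_def xy)
qed

text \<open>Complete \<open>U j\<close> by a linear function to a local coordinate system; the leaf is a coordinate line.\<close>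

lemma leaf_curve_exists:
  assumes p: "p \<in> off_axes" and j: "j \<in> {1..9}" and nz: "leaf_direction j p \<noteq> (0, 0)"
  shows "\<exists>c v w. jet2 c p v w \<and> v \<noteq> (0, 0) \<and> (\<forall>\<^sub>F t in nhds 0. U j (c t) = U j p)"
proof -
  have "U j p \<noteq> 0" using p j unfolding web_index_cases by (cases p) (auto simp: off_axes_def)
  then have UU: "Ux j p \<noteq> 0 \<or> Uy j p \<noteq> 0"
    using nz log_derivative_U[OF p j, of 1 0] log_derivative_U[OF p j, of 0 1] by (auto simp: leaf_direction_def)
  \<comment> \<open>a linear function independent of the differential of \<open>U j\<close> at \<open>p\<close>\<close>
  obtain s r :: complex where sr: "Ux j p * r - Uy j p * s \<noteq> 0"
    using UU by (metis diff_zero mult.right_neutral mult_zero_right diff_0 neg_equal_0_iff_equal)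
  let ?f = "\<lambda>q. s * fst q + r * snd (q :: complex \<times> complex)"
  have dU: "\<And>q. q \<in> off_axes \<Longrightarrow> (U j has_derivative (\<lambda>v. Ux j q * fst v + Uy j q * snd v)) (at q)"
    using has_derivative_U[OF j off_axes_not_polar[OF _ j]] .
  have df: "\<And>q. q \<in> off_axes \<Longrightarrow> (?f has_derivative (\<lambda>v. s * fst v + r * snd v)) (at q)"
    by (rule has_derivative_eq_rhs, (rule derivative_intros)+) auto
  have cont: "continuous_on off_axes (Ux j)" "continuous_on off_axes (Uy j)"
    using isCont_Ux[OF _ j] continuous_at_imp_continuous_on by blast+
  from local_biholomorphism[OF open_off_axes p dU df cont continuous_on_const continuous_on_const sr]
  obtain W where W: "p \<in> W" "W \<subseteq> off_axes" "biholomorphism (\<lambda>q. (U j q, ?f q)) W" by blast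
  define \<phi> where "\<phi> = (\<lambda>q. (U j q, ?f q))"
  define \<psi> where "\<psi> = inv_into W \<phi>"
  have bi: "open (\<phi> ` W)" "inj_on \<phi> W" "holomorphic_map \<psi> (\<phi> ` W)"
    using W(3) by (simp_all add: biholomorphism_def \<phi>_def \<psi>_def)
  define c where "c t = \<psi> (U j p, ?f p + t)" for t
  have c0: "c 0 = p" using inv_into_f_f[OF bi(2) W(1)] by (simp add: c_def \<psi>_def \<phi>_def)
  define S where "S = {t. (U j p, ?f p + t) \<in> \<phi> ` W}"
  have S: "open S" "0 \<in> S"
  proof -
    have "S = (\<lambda>t. (U j p, ?f p + t)) -` (\<phi> ` W)" by (auto simp: S_def)
    then show "open S" using bi(1) by (auto intro!: open_vimage continuous_intros)
    show "0 \<in> S" using W(1) by (auto simp: S_def \<phi>_def)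
  qed
  have \<phi>c: "\<phi> (c t) = (U j p, ?f p + t)" if "t \<in> S" for t
    using f_inv_into_f[of "(U j p, ?f p + t)" \<phi> W] that by (simp add: S_def c_def \<psi>_def)
  obtain g1 g2 h1 h2 where gh: "\<And>q. q \<in> \<phi> ` W \<Longrightarrow> ((\<lambda>q. fst (\<psi> q)) has_derivative (\<lambda>v. g1 q * fst v + g2 q * snd v)) (at q)"
    "\<And>q. q \<in> \<phi> ` W \<Longrightarrow> ((\<lambda>q. snd (\<psi> q)) has_derivative (\<lambda>v. h1 q * fst v + h2 q * snd v)) (at q)"
    by (rule holomorphic_map_partials[OF bi(3)]) (rule that; assumption)
  have line: "((\<lambda>t. fst (U j p, ?f p + t)) has_field_derivative 0) (at t)" "((\<lambda>t. snd (U j p, ?f p + t)) has_field_derivative 1) (at t)" for t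
    by (auto intro!: derivative_eq_intros)
  have dc: "((\<lambda>t. fst (c t)) has_field_derivative g2 (U j p, ?f p + t)) (at t)"
    "((\<lambda>t. snd (c t)) has_field_derivative h2 (U j p, ?f p + t)) (at t)" if "t \<in> S" for t
    using chain_rule_curve[OF gh(1) line, of t] chain_rule_curve[OF gh(2) line, of t] that
    by (simp_all add: S_def c_def)
  have an: "(\<lambda>t. fst (c t)) analytic_on {0}" "(\<lambda>t. snd (c t)) analytic_on {0}"
    using dc S unfolding analytic_at by (metis holomorphic_on_open)+
  note jet = jet2_if_analytic[OF an, unfolded c0]
  have "(deriv (\<lambda>t. fst (c t)) 0, deriv (\<lambda>t. snd (c t)) 0) \<noteq> (0, 0)"
  proof
    assume "(deriv (\<lambda>t. fst (c t)) 0, deriv (\<lambda>t. snd (c t)) 0) = (0, 0)"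
    then have z: "((\<lambda>t. fst (c t)) has_field_derivative 0) (at 0)" "((\<lambda>t. snd (c t)) has_field_derivative 0) (at 0)"
      using dc[OF S(2)] by (metis DERIV_imp_deriv Pair_inject)+
    have "((\<lambda>t. s * fst (c t) + r * snd (c t)) has_field_derivative s * 0 + r * 0) (at 0)"
      by (intro DERIV_add DERIV_cmult z)
    moreover have "((\<lambda>t. s * fst (c t) + r * snd (c t)) has_field_derivative 1) (at 0)"
    proof (rule has_field_derivative_transform_within_open[OF _ S])
      show "((\<lambda>t. ?f p + t) has_field_derivative 1) (at 0)" by (auto intro!: derivative_eq_intros)
      show "?f p + t = s * fst (c t) + r * snd (c t)" if "t \<in> S" for t
        using \<phi>c[OF that] by (simp add: \<phi>_def)
    qed
    ultimately show False using DERIV_unique by fastforce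
  qed
  moreover have "\<forall>\<^sub>F t in nhds 0. U j (c t) = U j p"
  proof -
    have "\<forall>\<^sub>F t in nhds 0. t \<in> S" using S by (simp add: eventually_nhds_in_open)
    then show ?thesis by eventually_elim (use \<phi>c in \<open>simp add: \<phi>_def\<close>)
  qed
  ultimately show ?thesis using jet by blast
qed

text \<open>A cubic form that, on the tangent vector of each leaf through \<open>p\<close>, takes the value of \<open>det (c', c'')\<close>.\<close>

definition cubic_at :: "nat set \<Rightarrow> complex \<times> complex \<Rightarrow> bool" where
  "cubic_at T p \<longleftrightarrow> (\<exists>C. cubic_form C \<and> (\<forall>j\<in>T. C (leaf_direction j p) = leaf_curvature j p))"

lemma cubic_form_scale:
  assumes "cubic_form C"
  shows "C (k * a, k * b) = k ^ 3 * C (a, b)"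
  using assms unfolding cubic_form_def by (auto simp: algebra_simps power2_eq_square power3_eq_cube)

lemma cubic_form_linear_substitution:
  assumes "cubic_form C"
  shows "cubic_form (\<lambda>v. C (a * fst v + b * snd v, c * fst v + d * snd v))"
proof -
  obtain k0 k1 k2 k3 where k: "\<And>a b. C (a, b) = k0 * a ^ 3 + k1 * a\<^sup>2 * b + k2 * a * b\<^sup>2 + k3 * b ^ 3"
    using assms unfolding cubic_form_def by blast
  show ?thesis
    unfolding cubic_form_def k
    by (rule exI[of _ "k0 * a ^ 3 + k1 * a\<^sup>2 * c + k2 * a * c\<^sup>2 + k3 * c ^ 3"],
        rule exI[of _ "3 * k0 * a\<^sup>2 * b + k1 * (a\<^sup>2 * d + 2 * a * b * c) + k2 * (b * c\<^sup>2 + 2 * a * c * d) + 3 * k3 * c\<^sup>2 * d"],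
        rule exI[of _ "3 * k0 * a * b\<^sup>2 + k1 * (b\<^sup>2 * c + 2 * a * b * d) + k2 * (a * d\<^sup>2 + 2 * b * c * d) + 3 * k3 * c * d\<^sup>2"],
        rule exI[of _ "k0 * b ^ 3 + k1 * b\<^sup>2 * d + k2 * b * d\<^sup>2 + k3 * d ^ 3"])
       (simp add: algebra_simps power2_eq_square power3_eq_cube)
qed

lemma cubic_form_combination:
  assumes "cubic_form C" "cubic_form C'"
  shows "cubic_form (\<lambda>v. r * C v + s * C' v)"
proof -
  obtain k0 k1 k2 k3 where k: "\<And>a b. C (a, b) = k0 * a ^ 3 + k1 * a\<^sup>2 * b + k2 * a * b\<^sup>2 + k3 * b ^ 3"
    using assms(1) unfolding cubic_form_def by blast
  obtain l0 l1 l2 l3 where l: "\<And>a b. C' (a, b) = l0 * a ^ 3 + l1 * a\<^sup>2 * b + l2 * a * b\<^sup>2 + l3 * b ^ 3"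
    using assms(2) unfolding cubic_form_def by blast
  show ?thesis
    unfolding cubic_form_def k l
    by (rule exI[of _ "r * k0 + s * l0"], rule exI[of _ "r * k1 + s * l1"],
        rule exI[of _ "r * k2 + s * l2"], rule exI[of _ "r * k3 + s * l3"])
       (simp add: algebra_simps)
qed

lemma cubic_at_mono: "cubic_at T p \<Longrightarrow> S \<subseteq> T \<Longrightarrow> cubic_at S p"
  unfolding cubic_at_def by blast

lemma leaf_direction_nonzero:
  assumes "p \<in> off_axes" "p \<in> regular_locus J" "J \<subseteq> {1..9}" "i \<in> J" "j \<in> J" "i \<noteq> j"
  shows "leaf_direction j p \<noteq> (0, 0)"
proof
  assume *: "leaf_direction j p = (0, 0)"
  have "j \<in> {1..9}" using assms by blast
  from log_derivative_U[OF assms(1) this, of 1 0] log_derivative_U[OF assms(1) this, of 0 1] *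
  have "jacobian i j p = 0" by (simp add: leaf_direction_def jacobian_def)
  then show False using jacobian_nonzero[OF assms(2-6)] by blast
qed

text \<open>Lines have \<open>det (c', c'') = 0\<close>, so transport by \<open>\<phi>\<close> gives \<open>0 = det L * \<kappa> + C v\<close> for the leaf of each
foliation, with the same cubic form \<open>C\<close>.\<close>

lemma cubic_at_if_linearised:
  assumes bi: "biholomorphism \<phi> W" and p: "p \<in> W" "p \<in> off_axes" and J: "J \<subseteq> {1..9}"
    and nz: "\<And>j. j \<in> J \<Longrightarrow> leaf_direction j p \<noteq> (0, 0)"
    and lines: "\<And>j. j \<in> J \<Longrightarrow> carries_to_lines \<phi> W (U j)"
  shows "cubic_at J p"
proof -
  obtain a b c d C where det: "a * d - b * c \<noteq> 0" and C: "cubic_form C"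
    and tr: "\<And>\<gamma> v w. jet2 \<gamma> p v w \<Longrightarrow> \<exists>w'. jet2 (\<lambda>t. \<phi> (\<gamma> t)) (\<phi> p) (a * fst v + b * snd v, c * fst v + d * snd v) w' \<and>
      det2 (a * fst v + b * snd v, c * fst v + d * snd v) w' = (a * d - b * c) * det2 v w + C v"
    by (rule biholomorphism_second_order[OF bi p(1)]) (rule that; assumption)
  define C' where "C' v = - 1 / (a * d - b * c) * C v + 0 * C v" for v
  have "cubic_form C'" unfolding C'_def by (rule cubic_form_combination[OF C C])
  moreover have "C' (leaf_direction j p) = leaf_curvature j p" if j: "j \<in> J" for j
  proof -
    have j9: "j \<in> {1..9}" using j J by blast
    obtain \<gamma> v w where \<gamma>: "jet2 \<gamma> p v w" "v \<noteq> (0, 0)" "\<forall>\<^sub>F t in nhds 0. U j (\<gamma> t) = U j p"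
      using leaf_curve_exists[OF p(2) j9 nz[OF j]] by blast
    obtain \<mu> where \<mu>: "\<mu> \<noteq> 0" "v = (\<mu> * fst (leaf_direction j p), \<mu> * snd (leaf_direction j p))"
      "det2 v w = \<mu> ^ 3 * leaf_curvature j p"
      using leaf_curve_curvature[OF p(2) j9 nz[OF j] \<gamma>] by blast
    obtain w' where w': "jet2 (\<lambda>t. \<phi> (\<gamma> t)) (\<phi> p) (a * fst v + b * snd v, c * fst v + d * snd v) w'"
      "det2 (a * fst v + b * snd v, c * fst v + d * snd v) w' = (a * d - b * c) * det2 v w + C v"
      using tr[OF \<gamma>(1)] by blast
    obtain L where L: "complex_line L" "\<forall>\<^sub>F q in nhds p. U j q = U j p \<longleftrightarrow> \<phi> q \<in> L"
      using lines[OF j] p(1) unfolding carries_to_lines_def by blast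
    have "\<forall>\<^sub>F t in nhds 0. U j (\<gamma> t) = U j p \<longleftrightarrow> \<phi> (\<gamma> t) \<in> L"
      by (rule eventually_compose_filterlim[OF L(2) jet2_tendsto[OF \<gamma>(1)]])
    then have "\<forall>\<^sub>F t in nhds 0. \<phi> (\<gamma> t) \<in> L" using \<gamma>(3) by eventually_elim blast
    from line_has_no_curvature[OF w'(1) L(1) this] w'(2)
    have "(a * d - b * c) * (\<mu> ^ 3 * leaf_curvature j p) + C v = 0" using \<mu>(3) by simp
    moreover have "C v = \<mu> ^ 3 * C (leaf_direction j p)"
      unfolding \<mu>(2) using cubic_form_scale[OF C, of \<mu> "fst (leaf_direction j p)" "snd (leaf_direction j p)"] by simp
    ultimately have "\<mu> ^ 3 * ((a * d - b * c) * leaf_curvature j p + C (leaf_direction j p)) = 0"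
      by (simp add: algebra_simps)
    then have "(a * d - b * c) * leaf_curvature j p + C (leaf_direction j p) = 0" using \<mu>(1) by simp
    then have "C (leaf_direction j p) = - ((a * d - b * c) * leaf_curvature j p)"
      by (simp add: eq_neg_iff_add_eq_0 add.commute)
    then show ?thesis using det by (simp add: C'_def)
  qed
  ultimately show ?thesis unfolding cubic_at_def by blast
qed

text \<open>The interpolating cubic form of the source, multiplied by \<open>det L\<close> and corrected by the cubic form of \<open>\<phi>\<close>,
interpolates for the image directions after substitution of the inverse of \<open>L\<close>.\<close>

lemma cubic_at_transport:
  assumes bi: "biholomorphism \<phi> W" and p: "p \<in> W" "p \<in> off_axes" "\<phi> p \<in> off_axes"
    and S: "S \<subseteq> {1..9}" "\<sigma> ` S \<subseteq> {1..9}"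
    and nz: "\<And>j. j \<in> S \<Longrightarrow> leaf_direction j p \<noteq> (0, 0)"
    and nz': "\<And>j. j \<in> S \<Longrightarrow> leaf_direction (\<sigma> j) (\<phi> p) \<noteq> (0, 0)"
    and leaves: "\<And>j. j \<in> S \<Longrightarrow> carries_foliation \<phi> W (U j) (U (\<sigma> j))"
    and cubic: "cubic_at S p"
  shows "cubic_at (\<sigma> ` S) (\<phi> p)"
proof -
  obtain C0 where C0: "cubic_form C0" "\<And>j. j \<in> S \<Longrightarrow> C0 (leaf_direction j p) = leaf_curvature j p"
    using cubic unfolding cubic_at_def by blast
  obtain a b c d C where det: "a * d - b * c \<noteq> 0" and C: "cubic_form C"
    and tr: "\<And>\<gamma> v w. jet2 \<gamma> p v w \<Longrightarrow> \<exists>w'. jet2 (\<lambda>t. \<phi> (\<gamma> t)) (\<phi> p) (a * fst v + b * snd v, c * fst v + d * snd v) w' \<and>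
      det2 (a * fst v + b * snd v, c * fst v + d * snd v) w' = (a * d - b * c) * det2 v w + C v"
    by (rule biholomorphism_second_order[OF bi p(1)]) (rule that; assumption)
  define \<Delta> where "\<Delta> = a * d - b * c"
  have \<Delta>: "\<Delta> \<noteq> 0" using det by (simp add: \<Delta>_def)
  define E where "E v = \<Delta> * C0 v + 1 * C v" for v
  have E: "cubic_form E" unfolding E_def by (rule cubic_form_combination[OF C0(1) C])
  define C1 where "C1 v = E (d / \<Delta> * fst v + - b / \<Delta> * snd v, - c / \<Delta> * fst v + a / \<Delta> * snd v)" for v
  have "cubic_form C1" unfolding C1_def by (rule cubic_form_linear_substitution[OF E])
  moreover have "C1 (leaf_direction (\<sigma> j) (\<phi> p)) = leaf_curvature (\<sigma> j) (\<phi> p)" if j: "j \<in> S" for j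
  proof -
    have j9: "j \<in> {1..9}" "\<sigma> j \<in> {1..9}" using j S by blast+
    obtain \<gamma> v w where \<gamma>: "jet2 \<gamma> p v w" "v \<noteq> (0, 0)" "\<forall>\<^sub>F t in nhds 0. U j (\<gamma> t) = U j p"
      using leaf_curve_exists[OF p(2) j9(1) nz[OF j]] by blast
    obtain \<mu> where \<mu>: "\<mu> \<noteq> 0" "v = (\<mu> * fst (leaf_direction j p), \<mu> * snd (leaf_direction j p))"
      "det2 v w = \<mu> ^ 3 * leaf_curvature j p"
      using leaf_curve_curvature[OF p(2) j9(1) nz[OF j] \<gamma>] by blast
    define v' where "v' = (a * fst v + b * snd v, c * fst v + d * snd v)"
    obtain w' where w': "jet2 (\<lambda>t. \<phi> (\<gamma> t)) (\<phi> p) v' w'" "det2 v' w' = \<Delta> * det2 v w + C v"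
      using tr[OF \<gamma>(1)] by (auto simp: v'_def \<Delta>_def)
    \<comment> \<open>Cramer's rule\<close>
    have recover: "(d / \<Delta> * fst v' + - b / \<Delta> * snd v', - c / \<Delta> * fst v' + a / \<Delta> * snd v') = v"
    proof -
      have "d * fst v' - b * snd v' = \<Delta> * fst v" "a * snd v' - c * fst v' = \<Delta> * snd v"
        by (simp_all add: v'_def \<Delta>_def algebra_simps)
      moreover have "d / \<Delta> * fst v' + - b / \<Delta> * snd v' = (d * fst v' - b * snd v') / \<Delta>"
        "- c / \<Delta> * fst v' + a / \<Delta> * snd v' = (a * snd v' - c * fst v') / \<Delta>"
        by (simp_all add: diff_divide_distrib)
      ultimately show ?thesis using \<Delta> by (simp add: prod_eq_iff)
    qed
    have v'0: "v' \<noteq> (0, 0)"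
    proof
      assume "v' = (0, 0)"
      then have "v = (0, 0)" using recover by simp
      then show False using \<gamma>(2) by blast
    qed
    have "\<forall>\<^sub>F q in nhds p. U j q = U j p \<longleftrightarrow> U (\<sigma> j) (\<phi> q) = U (\<sigma> j) (\<phi> p)"
      using leaves[OF j] p(1) unfolding carries_foliation_def by blast
    from eventually_compose_filterlim[OF this jet2_tendsto[OF \<gamma>(1)]]
    have "\<forall>\<^sub>F t in nhds 0. U (\<sigma> j) (\<phi> (\<gamma> t)) = U (\<sigma> j) (\<phi> p)"
      using \<gamma>(3) by eventually_elim blast
    from leaf_curve_curvature[OF p(3) j9(2) nz'[OF j] w'(1) v'0 this]
    obtain \<mu>' where \<mu>': "\<mu>' \<noteq> 0" "v' = (\<mu>' * fst (leaf_direction (\<sigma> j) (\<phi> p)), \<mu>' * snd (leaf_direction (\<sigma> j) (\<phi> p)))"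
      "det2 v' w' = \<mu>' ^ 3 * leaf_curvature (\<sigma> j) (\<phi> p)" by blast
    have "C0 v = \<mu> ^ 3 * leaf_curvature j p"
      unfolding \<mu>(2) using cubic_form_scale[OF C0(1), of \<mu> "fst (leaf_direction j p)" "snd (leaf_direction j p)"]
        C0(2)[OF j] by simp
    then have "det2 v' w' = E v" unfolding w'(2) \<mu>(3) E_def by simp
    also have "E v = C1 v'" unfolding C1_def recover ..
    also have "C1 v' = \<mu>' ^ 3 * C1 (leaf_direction (\<sigma> j) (\<phi> p))"
      unfolding \<mu>'(2) using cubic_form_scale[OF \<open>cubic_form C1\<close>, of \<mu>' "fst (leaf_direction (\<sigma> j) (\<phi> p))"
        "snd (leaf_direction (\<sigma> j) (\<phi> p))"] by simp
    finally show ?thesis using \<mu>'(1,3) by simp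
  qed
  ultimately show ?thesis unfolding cubic_at_def by blast
qed

text \<open>Polynomial representatives of the leaf directions; \<open>leaf_value\<close> contains the corresponding curvatures
and \<open>leaf_scale\<close> the factors of proportionality.\<close>

definition leaf_vector :: "nat \<Rightarrow> complex \<times> complex \<Rightarrow> complex \<times> complex" where
  "leaf_vector j = (\<lambda>(x, y). [(0, 1), (1, 0), (x, y), (1 - x, 1 - y), (x * (1 - x), y * (1 - y)), (x, - y),
     (x * (1 - x), 1 - y), (1 - x, y * (1 - y)), (x * (1 - x) * (1 + y), y * (1 - y) * (1 + x))] ! (j - 1))"

definition leaf_value :: "nat \<Rightarrow> complex \<times> complex \<Rightarrow> complex" where
  "leaf_value j = (\<lambda>(x, y). [0, 0, 0, 0, 2 * x * y * (1 - x) * (1 - y) * (x - y), 2 * x * y,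
     - (2 * x * (1 - x) ^ 2 * (1 - y)), 2 * y * (1 - x) * (1 - y) ^ 2,
     2 * x * y * (1 - x) * (1 - y) * (x - y) * (2 + x + y)] ! (j - 1))"

definition leaf_scale :: "nat \<Rightarrow> complex \<times> complex \<Rightarrow> complex" where
  "leaf_scale j = (\<lambda>(x, y). [1 / x, - 1 / y, 1 / (x * y), 1 / ((1 - x) * (1 - y)), 1 / (x * y * (1 - x) * (1 - y)),
     - 1 / (x * y), 1 / (x * (1 - x) * (1 - y)), 1 / (y * (1 - x) * (1 - y)), 1 / (x * y * (1 - x) * (1 - y))] ! (j - 1))"

lemma leaf_data_rescaled:
  assumes "(x, y) \<in> off_axes" "j \<in> {1..9}"
  shows "leaf_scale j (x, y) \<noteq> 0"
    and "leaf_direction j (x, y) = (leaf_scale j (x, y) * fst (leaf_vector j (x, y)), leaf_scale j (x, y) * snd (leaf_vector j (x, y)))"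
    and "leaf_curvature j (x, y) = leaf_scale j (x, y) ^ 3 * leaf_value j (x, y)"
proof -
  have g: "x \<noteq> 0" "y \<noteq> 0" "x - 1 \<noteq> 0" "y - 1 \<noteq> 0" "1 - x \<noteq> 0" "1 - y \<noteq> 0" using assms(1) by (auto simp: off_axes_def)
  note defs = leaf_scale_def leaf_vector_def leaf_value_def leaf_direction_def leaf_curvature_def dlog_x_def dlog_y_def dlog_x'_def dlog_y'_def letter_exponents_def
  show "leaf_scale j (x, y) \<noteq> 0"
    using assms(2) g unfolding web_index_cases by (elim disjE) (simp_all add: defs)
  show "leaf_direction j (x, y) = (leaf_scale j (x, y) * fst (leaf_vector j (x, y)), leaf_scale j (x, y) * snd (leaf_vector j (x, y)))"
    using assms(2) g unfolding web_index_cases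
    by (elim disjE) (simp add: defs; (simp add: divide_simps)?; (simp add: algebra_simps)?)+
  show "leaf_curvature j (x, y) = leaf_scale j (x, y) ^ 3 * leaf_value j (x, y)"
    using assms(2) g unfolding web_index_cases
    by (elim disjE) (simp add: defs; (simp add: divide_simps power2_eq_square power3_eq_cube)?; (simp add: algebra_simps)?)+
qed

lemma cubic_form_rescaled:
  assumes "cubic_form C" "(x, y) \<in> off_axes" "j \<in> {1..9}" "C (leaf_direction j (x, y)) = leaf_curvature j (x, y)"
  shows "C (leaf_vector j (x, y)) = leaf_value j (x, y)"
proof -
  note L = leaf_data_rescaled[OF assms(2,3)]
  have "leaf_scale j (x, y) ^ 3 * C (leaf_vector j (x, y)) = leaf_scale j (x, y) ^ 3 * leaf_value j (x, y)"
    using assms(4) unfolding L(2,3)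
    using cubic_form_scale[OF assms(1), of "leaf_scale j (x, y)" "fst (leaf_vector j (x, y))" "snd (leaf_vector j (x, y))"] by simp
  then show ?thesis using L(1) by simp
qed

lemma cubic_at_coefficients:
  assumes "(x, y) \<in> off_axes" "T \<subseteq> {1..9}" "cubic_at T (x, y)"
  obtains k0 k1 k2 k3 where
    "\<And>j. j \<in> T \<Longrightarrow>
      k0 * fst (leaf_vector j (x, y)) ^ 3 + k1 * (fst (leaf_vector j (x, y)))\<^sup>2 * snd (leaf_vector j (x, y))
      + k2 * fst (leaf_vector j (x, y)) * (snd (leaf_vector j (x, y)))\<^sup>2 + k3 * snd (leaf_vector j (x, y)) ^ 3 = leaf_value j (x, y)"
proof -
  obtain C where C: "cubic_form C" "\<And>j. j \<in> T \<Longrightarrow> C (leaf_direction j (x, y)) = leaf_curvature j (x, y)"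
    using assms(3) unfolding cubic_at_def by blast
  obtain k0 k1 k2 k3 where k: "\<And>a b. C (a, b) = k0 * a ^ 3 + k1 * a\<^sup>2 * b + k2 * a * b\<^sup>2 + k3 * b ^ 3"
    using C(1) unfolding cubic_form_def by blast
  show thesis
  proof (rule that)
    fix j assume j: "j \<in> T"
    then have "j \<in> {1..9}" using assms(2) by blast
    from cubic_form_rescaled[OF C(1) assms(1) this C(2)[OF j]] k[of "fst (leaf_vector j (x, y))" "snd (leaf_vector j (x, y))"]
    show "k0 * fst (leaf_vector j (x, y)) ^ 3 + k1 * (fst (leaf_vector j (x, y)))\<^sup>2 * snd (leaf_vector j (x, y))
          + k2 * fst (leaf_vector j (x, y)) * (snd (leaf_vector j (x, y)))\<^sup>2 + k3 * snd (leaf_vector j (x, y)) ^ 3 = leaf_value j (x, y)"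
      by simp
  qed
qed

text \<open>The first, second and fourth leaf direction are zeros of the form. Its scale is fixed by the fifth
foliation, and the eighth condition then holds as well.\<close>

lemma cubic_at_12458:
  assumes "(x, y) \<in> off_axes"
  shows "cubic_at {1, 2, 4, 5, 8} (x, y)"
proof -
  define m where "m = 2 / ((1 - x) * (1 - y))"
  define C where "C v = m * (fst v * snd v * ((1 - y) * fst v - (1 - x) * snd v))" for v :: "complex \<times> complex"
  have g: "x \<noteq> 0" "y \<noteq> 0" "1 - x \<noteq> 0" "1 - y \<noteq> 0" using assms by (auto simp: off_axes_def)
  have C: "cubic_form C"
    unfolding cubic_form_def C_def
    by (rule exI[of _ 0], rule exI[of _ "m * (1 - y)"], rule exI[of _ "- m * (1 - x)"], rule exI[of _ 0])
       (simp add: algebra_simps power2_eq_square)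
  have V: "C (leaf_vector j (x, y)) = leaf_value j (x, y)" if "j \<in> {1, 2, 4, 5, 8}" for j
  proof -
    have *: "m * ((1 - x) * (1 - y) * z) = 2 * z" for z using g by (simp add: m_def)
    have e4: "fst (leaf_vector 4 (x, y)) * snd (leaf_vector 4 (x, y)) * ((1 - y) * fst (leaf_vector 4 (x, y)) - (1 - x) * snd (leaf_vector 4 (x, y))) = (1 - x) * (1 - y) * 0"
      by (simp add: leaf_vector_def algebra_simps)
    have e5: "fst (leaf_vector 5 (x, y)) * snd (leaf_vector 5 (x, y)) * ((1 - y) * fst (leaf_vector 5 (x, y)) - (1 - x) * snd (leaf_vector 5 (x, y))) =
        (1 - x) * (1 - y) * (x * y * (1 - x) * (1 - y) * (x - y))"
      by (simp add: leaf_vector_def algebra_simps)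
    have e8: "fst (leaf_vector 8 (x, y)) * snd (leaf_vector 8 (x, y)) * ((1 - y) * fst (leaf_vector 8 (x, y)) - (1 - x) * snd (leaf_vector 8 (x, y))) =
        (1 - x) * (1 - y) * (y * (1 - x) * (1 - y) ^ 2)"
      by (simp add: leaf_vector_def algebra_simps power2_eq_square)
    have "C (leaf_vector 1 (x, y)) = leaf_value 1 (x, y)" "C (leaf_vector 2 (x, y)) = leaf_value 2 (x, y)" by (simp_all add: C_def leaf_vector_def leaf_value_def)
    moreover have "C (leaf_vector 4 (x, y)) = leaf_value 4 (x, y)" unfolding C_def e4 * by (simp add: leaf_value_def)
    moreover have "C (leaf_vector 5 (x, y)) = leaf_value 5 (x, y)" unfolding C_def e5 * by (simp add: leaf_value_def)
    moreover have "C (leaf_vector 8 (x, y)) = leaf_value 8 (x, y)" unfolding C_def e8 * by (simp add: leaf_value_def)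
    ultimately show ?thesis using that by blast
  qed
  have "C (leaf_direction j (x, y)) = leaf_curvature j (x, y)" if j: "j \<in> {1, 2, 4, 5, 8}" for j
  proof -
    have "j \<in> {1..9}" using j by auto
    note L = leaf_data_rescaled[OF assms this]
    show ?thesis unfolding L(2,3)
      using cubic_form_scale[OF C, of "leaf_scale j (x, y)" "fst (leaf_vector j (x, y))" "snd (leaf_vector j (x, y))"] V[OF j] by simp
  qed
  with C show ?thesis unfolding cubic_at_def by blast
qed

text \<open>A cubic form vanishing on the directions of the four straight leaves is zero, while the fifth leaf is
curved.\<close>

lemma not_cubic_at_12345:
  assumes "(x, y) \<in> off_axes" "x \<noteq> y"
  shows "\<not> cubic_at {1, 2, 3, 4, 5} (x, y)"
proof
  assume c: "cubic_at {1, 2, 3, 4, 5} (x, y)"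
  obtain k0 k1 k2 k3 where E: "\<And>j. j \<in> {1, 2, 3, 4, 5} \<Longrightarrow>
      k0 * fst (leaf_vector j (x, y)) ^ 3 + k1 * (fst (leaf_vector j (x, y)))\<^sup>2 * snd (leaf_vector j (x, y))
      + k2 * fst (leaf_vector j (x, y)) * (snd (leaf_vector j (x, y)))\<^sup>2 + k3 * snd (leaf_vector j (x, y)) ^ 3 = leaf_value j (x, y)"
    by (rule cubic_at_coefficients[OF assms(1) _ c]) (simp, (rule that; assumption))
  have g: "x \<noteq> 0" "y \<noteq> 0" "1 - x \<noteq> 0" "1 - y \<noteq> 0" "x - y \<noteq> 0" using assms by (auto simp: off_axes_def)
  have k3: "k3 = 0" using E[of 1] by (simp add: leaf_vector_def leaf_value_def)
  have k0: "k0 = 0" using E[of 2] by (simp add: leaf_vector_def leaf_value_def)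
  have "x * y * (k1 * x + k2 * y) = 0"
    using E[of 3] by (simp add: leaf_vector_def leaf_value_def k0 k3 algebra_simps power2_eq_square)
  then have e3: "k1 * x + k2 * y = 0" using g by simp
  have "(1 - x) * (1 - y) * (k1 * (1 - x) + k2 * (1 - y)) = 0"
    using E[of 4] by (simp add: leaf_vector_def leaf_value_def k0 k3 algebra_simps power2_eq_square)
  then have e4: "k1 * (1 - x) + k2 * (1 - y) = 0" using g by simp
  have "k1 + k2 = 0" using e3 e4 by (simp add: algebra_simps)
  then have "k2 = - k1" by (simp add: eq_neg_iff_add_eq_0 add.commute)
  then have "k1 * (x - y) = 0" using e3 by (simp add: algebra_simps)
  then have "k1 = 0" "k2 = 0" using g \<open>k2 = - k1\<close> by auto
  then have "leaf_value 5 (x, y) = 0" using E[of 5] by (simp add: k0 k3 leaf_vector_def)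
  then show False using g by (simp add: leaf_value_def)
qed

text \<open>For five directions in the plane there is one linear relation between the values of all cubic forms,
with coefficients \<open>1 / (\<Prod> det (v i, v k))\<close> over \<open>k \<noteq> i\<close>. This lemma and the five after it apply it to the five
foliations that remain when one of 1, 3, 5, 6, 7, 9 is omitted; the factors in front of the brackets
are these coefficients with the denominators cleared.\<close>

lemma cubic_at_omit_1:
  assumes "(x, y) \<in> off_axes" "x \<noteq> y" "x * y \<noteq> 1" "cubic_at {3, 5, 6, 7, 9} (x, y)"
  shows "- 12 * y - 4 * x + 32 * x * y - 4 * x * y ^ 2 - 12 * x ^ 2 * y = 0"
proof -
  obtain k0 k1 k2 k3 where E: "\<And>j. j \<in> {3, 5, 6, 7, 9} \<Longrightarrow>
      k0 * fst (leaf_vector j (x, y)) ^ 3 + k1 * (fst (leaf_vector j (x, y)))\<^sup>2 * snd (leaf_vector j (x, y))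
      + k2 * fst (leaf_vector j (x, y)) * (snd (leaf_vector j (x, y)))\<^sup>2 + k3 * snd (leaf_vector j (x, y)) ^ 3 = leaf_value j (x, y)"
    by (rule cubic_at_coefficients[OF assms(1) _ assms(4)]) (simp, (rule that; assumption))
  let ?C = "\<lambda>a b. k0 * a ^ 3 + k1 * a\<^sup>2 * b + k2 * a * b\<^sup>2 + k3 * b ^ 3"
  have "x * y * (1 - x) * (1 - y) ^ 2 * (x - y) * (1 - x * y) * (- 12 * y - 4 * x + 32 * x * y - 4 * x * y ^ 2 - 12 * x ^ 2 * y)
      = ((1 - x) ^ 2 * (1 - y) ^ 3 * (1 - x * y) ^ 2 * (2 - x - y) * 2) * ((0) - ?C (x) (y))
      + ((1 - x * y) ^ 2 * (1 - 2 * y + x * y) * (- 8)) * ((2 * x * y * (1 - x) * (1 - y) * (x - y)) - ?C (x * (1 - x)) (y * (1 - y)))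
      + ((1 - x) ^ 2 * (1 - y) ^ 3 * (x - y) ^ 2 * (1 - 2 * y + x * y) * (- 2)) * ((2 * x * y) - ?C (x) (- y))
      + (y ^ 3 * (x - y) ^ 2 * (2 - x - y) * (- 8)) * ((- (2 * x * (1 - x) ^ 2 * (1 - y))) - ?C (x * (1 - x)) (1 - y))
      + ((1 - y) * (2 - x - y) * (1 - 2 * y + x * y) * 2) * ((2 * x * y * (1 - x) * (1 - y) * (x - y) * (2 + x + y)) - ?C (x * (1 - x) * (1 + y)) (y * (1 - y) * (1 + x)))"
    by algebra
  also have "\<dots> = 0"
    using E[of 3] E[of 5] E[of 6] E[of 7] E[of 9] by (simp add: leaf_vector_def leaf_value_def)
  finally show ?thesis using assms(1-3) by (auto simp: off_axes_def)
qed

lemma cubic_at_omit_3: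
  assumes "(x, y) \<in> off_axes" "x \<noteq> y" "x * y \<noteq> 1" "cubic_at {1, 5, 6, 7, 9} (x, y)"
  shows "6 - 4 * x - 2 * x * y = 0"
proof -
  obtain k0 k1 k2 k3 where E: "\<And>j. j \<in> {1, 5, 6, 7, 9} \<Longrightarrow>
      k0 * fst (leaf_vector j (x, y)) ^ 3 + k1 * (fst (leaf_vector j (x, y)))\<^sup>2 * snd (leaf_vector j (x, y))
      + k2 * fst (leaf_vector j (x, y)) * (snd (leaf_vector j (x, y)))\<^sup>2 + k3 * snd (leaf_vector j (x, y)) ^ 3 = leaf_value j (x, y)"
    by (rule cubic_at_coefficients[OF assms(1) _ assms(4)]) (simp, (rule that; assumption))
  let ?C = "\<lambda>a b. k0 * a ^ 3 + k1 * a\<^sup>2 * b + k2 * a * b\<^sup>2 + k3 * b ^ 3"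
  have "x * y * (1 - x) * (1 - y) ^ 2 * (x - y) * (1 - x * y) * (6 - 4 * x - 2 * x * y)
      = (y ^ 2 * (1 - y) ^ 3 * (x - y) * (1 - x * y) ^ 2 * (2 - x - y) * 2) * (- k3)
      + ((1 - x * y) ^ 2 * (1 + y) * (- 2)) * ((2 * x * y * (1 - x) * (1 - y) * (x - y)) - ?C (x * (1 - x)) (y * (1 - y)))
      + ((1 - x) ^ 3 * (1 - y) ^ 3 * (x - y) * (1 + y)) * ((2 * x * y) - ?C (x) (- y))
      + (y ^ 2 * (x - y) * (1 + y) * (2 - x - y) * (- 2)) * ((- (2 * x * (1 - x) ^ 2 * (1 - y))) - ?C (x * (1 - x)) (1 - y))
      + ((1 - y) * (2 - x - y)) * ((2 * x * y * (1 - x) * (1 - y) * (x - y) * (2 + x + y)) - ?C (x * (1 - x) * (1 + y)) (y * (1 - y) * (1 + x)))"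
    by algebra
  also have "\<dots> = 0"
    using E[of 1] E[of 5] E[of 6] E[of 7] E[of 9] by (simp add: leaf_vector_def leaf_value_def)
  finally show ?thesis using assms(1-3) by (auto simp: off_axes_def)
qed

lemma cubic_at_omit_5:
  assumes "(x, y) \<in> off_axes" "x \<noteq> y" "x * y \<noteq> 1" "cubic_at {1, 3, 6, 7, 9} (x, y)"
  shows "12 + 4 * x * y = 0"
proof -
  obtain k0 k1 k2 k3 where E: "\<And>j. j \<in> {1, 3, 6, 7, 9} \<Longrightarrow>
      k0 * fst (leaf_vector j (x, y)) ^ 3 + k1 * (fst (leaf_vector j (x, y)))\<^sup>2 * snd (leaf_vector j (x, y))
      + k2 * fst (leaf_vector j (x, y)) * (snd (leaf_vector j (x, y)))\<^sup>2 + k3 * snd (leaf_vector j (x, y)) ^ 3 = leaf_value j (x, y)"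
    by (rule cubic_at_coefficients[OF assms(1) _ assms(4)]) (simp, (rule that; assumption))
  let ?C = "\<lambda>a b. k0 * a ^ 3 + k1 * a\<^sup>2 * b + k2 * a * b\<^sup>2 + k3 * b ^ 3"
  have "x * y * (1 - x) * (1 - y) * (x - y) * (1 - x * y) * (12 + 4 * x * y)
      = (y ^ 2 * (1 - y) * (x - y) * (1 - x * y) ^ 2 * (1 - 2 * y + x * y) * 8) * (- k3)
      + ((1 - x) ^ 2 * (1 - y) * (1 - x * y) ^ 2 * (1 + y) * (- 2)) * ((0) - ?C (x) (y))
      + ((1 - x) ^ 2 * (1 - y) * (x - y) * (1 + y) * (1 - 2 * y + x * y) * 2) * ((2 * x * y) - ?C (x) (- y))
      + (y ^ 2 * (x - y) * (1 + y) * (- 8)) * ((- (2 * x * (1 - x) ^ 2 * (1 - y))) - ?C (x * (1 - x)) (1 - y))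
      + ((1 - 2 * y + x * y) * 2) * ((2 * x * y * (1 - x) * (1 - y) * (x - y) * (2 + x + y)) - ?C (x * (1 - x) * (1 + y)) (y * (1 - y) * (1 + x)))"
    by algebra
  also have "\<dots> = 0"
    using E[of 1] E[of 3] E[of 6] E[of 7] E[of 9] by (simp add: leaf_vector_def leaf_value_def)
  finally show ?thesis using assms(1-3) by (auto simp: off_axes_def)
qed

lemma cubic_at_omit_6:
  assumes "(x, y) \<in> off_axes" "x \<noteq> y" "x * y \<noteq> 1" "cubic_at {1, 3, 5, 7, 9} (x, y)"
  shows "6 * y - 2 * x - 4 * x * y = 0"
proof -
  obtain k0 k1 k2 k3 where E: "\<And>j. j \<in> {1, 3, 5, 7, 9} \<Longrightarrow>
      k0 * fst (leaf_vector j (x, y)) ^ 3 + k1 * (fst (leaf_vector j (x, y)))\<^sup>2 * snd (leaf_vector j (x, y))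
      + k2 * fst (leaf_vector j (x, y)) * (snd (leaf_vector j (x, y)))\<^sup>2 + k3 * snd (leaf_vector j (x, y)) ^ 3 = leaf_value j (x, y)"
    by (rule cubic_at_coefficients[OF assms(1) _ assms(4)]) (simp, (rule that; assumption))
  let ?C = "\<lambda>a b. k0 * a ^ 3 + k1 * a\<^sup>2 * b + k2 * a * b\<^sup>2 + k3 * b ^ 3"
  have "x * y * (1 - x) * (1 - y) ^ 2 * (x - y) * (1 - x * y) * (6 * y - 2 * x - 4 * x * y)
      = (y ^ 2 * (1 - y) ^ 3 * (x - y) ^ 2 * (1 - x * y) * (1 - 2 * y + x * y) * (- 2)) * (- k3)
      + ((1 - x) ^ 3 * (1 - y) ^ 3 * (1 - x * y) * (1 + y) * (- 1)) * ((0) - ?C (x) (y))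
      + ((1 - x * y) * (1 + y) * (1 - 2 * y + x * y) * 2) * ((2 * x * y * (1 - x) * (1 - y) * (x - y)) - ?C (x * (1 - x)) (y * (1 - y)))
      + (y ^ 2 * (x - y) ^ 2 * (1 + y) * 2) * ((- (2 * x * (1 - x) ^ 2 * (1 - y))) - ?C (x * (1 - x)) (1 - y))
      + ((1 - y) * (1 - 2 * y + x * y) * (- 1)) * ((2 * x * y * (1 - x) * (1 - y) * (x - y) * (2 + x + y)) - ?C (x * (1 - x) * (1 + y)) (y * (1 - y) * (1 + x)))"
    by algebra
  also have "\<dots> = 0"
    using E[of 1] E[of 3] E[of 5] E[of 7] E[of 9] by (simp add: leaf_vector_def leaf_value_def)
  finally show ?thesis using assms(1-3) by (auto simp: off_axes_def)
qed

lemma cubic_at_omit_7: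
  assumes "(x, y) \<in> off_axes" "x \<noteq> y" "x * y \<noteq> 1" "cubic_at {1, 3, 5, 6, 9} (x, y)"
  shows "12 * y + 4 * x = 0"
proof -
  obtain k0 k1 k2 k3 where E: "\<And>j. j \<in> {1, 3, 5, 6, 9} \<Longrightarrow>
      k0 * fst (leaf_vector j (x, y)) ^ 3 + k1 * (fst (leaf_vector j (x, y)))\<^sup>2 * snd (leaf_vector j (x, y))
      + k2 * fst (leaf_vector j (x, y)) * (snd (leaf_vector j (x, y)))\<^sup>2 + k3 * snd (leaf_vector j (x, y)) ^ 3 = leaf_value j (x, y)"
    by (rule cubic_at_coefficients[OF assms(1) _ assms(4)]) (simp, (rule that; assumption))
  let ?C = "\<lambda>a b. k0 * a ^ 3 + k1 * a\<^sup>2 * b + k2 * a * b\<^sup>2 + k3 * b ^ 3"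
  have "x * y * (1 - x) * (1 - y) * (x - y) * (1 - x * y) * (12 * y + 4 * x)
      = (y ^ 3 * (1 - y) * (x - y) ^ 2 * (1 - x * y) * (2 - x - y) * 8) * (- k3)
      + ((1 - x) ^ 2 * (1 - y) * (1 - x * y) * (1 + y) * (2 - x - y) * (- 2)) * ((0) - ?C (x) (y))
      + ((1 - x * y) * (1 + y) * 8) * ((2 * x * y * (1 - x) * (1 - y) * (x - y)) - ?C (x * (1 - x)) (y * (1 - y)))
      + ((1 - x) ^ 2 * (1 - y) * (x - y) ^ 2 * (1 + y) * 2) * ((2 * x * y) - ?C (x) (- y))
      + ((2 - x - y) * (- 2)) * ((2 * x * y * (1 - x) * (1 - y) * (x - y) * (2 + x + y)) - ?C (x * (1 - x) * (1 + y)) (y * (1 - y) * (1 + x)))"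
    by algebra
  also have "\<dots> = 0"
    using E[of 1] E[of 3] E[of 5] E[of 6] E[of 9] by (simp add: leaf_vector_def leaf_value_def)
  finally show ?thesis using assms(1-3) by (auto simp: off_axes_def)
qed

lemma cubic_at_omit_9:
  assumes "(x, y) \<in> off_axes" "x \<noteq> y" "x * y \<noteq> 1" "cubic_at {1, 3, 5, 6, 7} (x, y)"
  shows "6 - 2 * x = 0"
proof -
  obtain k0 k1 k2 k3 where E: "\<And>j. j \<in> {1, 3, 5, 6, 7} \<Longrightarrow>
      k0 * fst (leaf_vector j (x, y)) ^ 3 + k1 * (fst (leaf_vector j (x, y)))\<^sup>2 * snd (leaf_vector j (x, y))
      + k2 * fst (leaf_vector j (x, y)) * (snd (leaf_vector j (x, y)))\<^sup>2 + k3 * snd (leaf_vector j (x, y)) ^ 3 = leaf_value j (x, y)"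
    by (rule cubic_at_coefficients[OF assms(1) _ assms(4)]) (simp, (rule that; assumption))
  let ?C = "\<lambda>a b. k0 * a ^ 3 + k1 * a\<^sup>2 * b + k2 * a * b\<^sup>2 + k3 * b ^ 3"
  have "x * y * (1 - x) * (1 - y) ^ 2 * (x - y) * (1 - x * y) * (6 - 2 * x)
      = (y ^ 2 * (1 - y) ^ 2 * (x - y) * (1 - x * y) * (2 - x - y) * (1 - 2 * y + x * y) * 2) * (- k3)
      + ((1 - x) ^ 2 * (1 - y) ^ 2 * (1 - x * y) * (2 - x - y) * (- 1)) * ((0) - ?C (x) (y))
      + ((1 - x * y) * (1 - 2 * y + x * y) * 2) * ((2 * x * y * (1 - x) * (1 - y) * (x - y)) - ?C (x * (1 - x)) (y * (1 - y)))
      + ((1 - x) ^ 2 * (1 - y) ^ 2 * (x - y) * (1 - 2 * y + x * y)) * ((2 * x * y) - ?C (x) (- y))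
      + (y ^ 2 * (x - y) * (2 - x - y) * (- 2)) * ((- (2 * x * (1 - x) ^ 2 * (1 - y))) - ?C (x * (1 - x)) (1 - y))"
    by algebra
  also have "\<dots> = 0"
    using E[of 1] E[of 3] E[of 5] E[of 6] E[of 7] by (simp add: leaf_vector_def leaf_value_def)
  finally show ?thesis using assms(1-3) by (auto simp: off_axes_def)
qed

text \<open>On a line parallel to the first axis an open set has infinitely many points.\<close>

lemma open_set_avoids_polynomial_zeros:
  fixes Q :: "complex \<Rightarrow> complex poly"
  assumes "open N" "(x0, y0) \<in> N" "\<And>x y. (x, y) \<in> N \<Longrightarrow> poly (Q y) x = 0"
  shows "Q y0 = 0"
proof (rule poly_eq_0_if_eventually)
  have "open ((\<lambda>x. (x, y0)) -` N)" using assms(1) by (intro open_vimage) (auto intro!: continuous_intros)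
  then have "\<forall>\<^sub>F x in nhds x0. x \<in> (\<lambda>x. (x, y0)) -` N" using assms(2) by (intro eventually_nhds_in_open) auto
  then show "\<forall>\<^sub>F x in nhds x0. poly (Q y0) x = 0" by eventually_elim (use assms(3) in auto)
qed

lemma no_cubic_on_open_set:
  assumes N: "open N" "N \<noteq> {}" "N \<subseteq> regular_locus {1, 3, 5, 6, 7, 9}" and m: "m \<in> {1, 3, 5, 6, 7, 9}"
    and cubic: "\<And>q. q \<in> N \<Longrightarrow> cubic_at ({1, 3, 5, 6, 7, 9} - {m}) q"
  shows False
proof -
  obtain x0 y0 where p0: "(x0, y0) \<in> N" using N(2) by auto
  have reg: "(x, y) \<in> off_axes" "x \<noteq> y" "x * y \<noteq> 1" if "(x, y) \<in> N" for x y
    using regular_13567[of x y "{1, 3, 5, 6, 7, 9}"] N(3) that by auto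
  have y0: "y0 \<noteq> 0" using reg(1)[OF p0] by (simp add: off_axes_def)
  note key = open_set_avoids_polynomial_zeros[OF N(1) p0]
  consider "m = 1" | "m = 3" | "m = 5" | "m = 6" | "m = 7" | "m = 9" using m by auto
  then show False
  proof cases
    case 1
    then have "{1, 3, 5, 6, 7, 9} - {m} = {3, 5, 6, 7, 9}" by auto
    with cubic have "cubic_at {3, 5, 6, 7, 9} (x, y)" if "(x, y) \<in> N" for x y using that by metis
    then have "poly [:- 12 * y, - 4 + 32 * y - 4 * y\<^sup>2, - 12 * y:] x = 0" if "(x, y) \<in> N" for x y
      using cubic_at_omit_1[OF reg[OF that]] that by (simp add: algebra_simps power2_eq_square)
    from key[of "\<lambda>y. [:- 12 * y, - 4 + 32 * y - 4 * y\<^sup>2, - 12 * y:]", OF this] show False using y0 by simp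
  next
    case 2
    then have "{1, 3, 5, 6, 7, 9} - {m} = {1, 5, 6, 7, 9}" by auto
    with cubic have "cubic_at {1, 5, 6, 7, 9} (x, y)" if "(x, y) \<in> N" for x y using that by metis
    then have "poly [:6, - 4 - 2 * y:] x = 0" if "(x, y) \<in> N" for x y
      using cubic_at_omit_3[OF reg[OF that]] that by (simp add: algebra_simps power2_eq_square)
    from key[of "\<lambda>y. [:6, - 4 - 2 * y:]", OF this] show False by simp
  next
    case 3
    then have "{1, 3, 5, 6, 7, 9} - {m} = {1, 3, 6, 7, 9}" by auto
    with cubic have "cubic_at {1, 3, 6, 7, 9} (x, y)" if "(x, y) \<in> N" for x y using that by metis
    then have "poly [:12, 4 * y:] x = 0" if "(x, y) \<in> N" for x y
      using cubic_at_omit_5[OF reg[OF that]] that by (simp add: algebra_simps power2_eq_square)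
    from key[of "\<lambda>y. [:12, 4 * y:]", OF this] show False by simp
  next
    case 4
    then have "{1, 3, 5, 6, 7, 9} - {m} = {1, 3, 5, 7, 9}" by auto
    with cubic have "cubic_at {1, 3, 5, 7, 9} (x, y)" if "(x, y) \<in> N" for x y using that by metis
    then have "poly [:6 * y, - 2 - 4 * y:] x = 0" if "(x, y) \<in> N" for x y
      using cubic_at_omit_6[OF reg[OF that]] that by (simp add: algebra_simps power2_eq_square)
    from key[of "\<lambda>y. [:6 * y, - 2 - 4 * y:]", OF this] show False using y0 by simp
  next
    case 5
    then have "{1, 3, 5, 6, 7, 9} - {m} = {1, 3, 5, 6, 9}" by auto
    with cubic have "cubic_at {1, 3, 5, 6, 9} (x, y)" if "(x, y) \<in> N" for x y using that by metis
    then have "poly [:12 * y, 4:] x = 0" if "(x, y) \<in> N" for x y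
      using cubic_at_omit_7[OF reg[OF that]] that by (simp add: algebra_simps power2_eq_square)
    from key[of "\<lambda>y. [:12 * y, 4:]", OF this] show False by simp
  next
    case 6
    then have "{1, 3, 5, 6, 7, 9} - {m} = {1, 3, 5, 6, 7}" by auto
    with cubic have "cubic_at {1, 3, 5, 6, 7} (x, y)" if "(x, y) \<in> N" for x y using that by metis
    then have "poly [:6, - 2:] x = 0" if "(x, y) \<in> N" for x y
      using cubic_at_omit_9[OF reg[OF that]] that by (simp add: algebra_simps power2_eq_square)
    from key[of "\<lambda>y. [:6, - 2:]", OF this] show False by simp
  qed
qed

lemma linearisable_imp_cubic:
  assumes lin: "linearisable_at J \<omega>" and J: "J \<subseteq> {1..9}" "i \<in> J" "j \<in> J" "i \<noteq> j"
    and off_axes: "\<And>p. p \<in> regular_locus J \<Longrightarrow> p \<in> off_axes"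
  obtains W where "open W" "\<omega> \<in> W" "W \<subseteq> regular_locus J" "\<And>p. p \<in> W \<Longrightarrow> cubic_at J p"
proof -
  obtain \<phi> W where W: "\<omega> \<in> W" "W \<subseteq> regular_locus J" "biholomorphism \<phi> W"
    and lines: "\<forall>j\<in>J. carries_to_lines \<phi> W (U j)"
    using lin unfolding linearisable_at_def by blast
  have "cubic_at J p" if p: "p \<in> W" for p
  proof (rule cubic_at_if_linearised[OF W(3) p off_axes J(1)])
    show reg: "p \<in> regular_locus J" using p W(2) by blast
    show "leaf_direction l p \<noteq> (0, 0)" if "l \<in> J" for l
    proof (cases "l = i")
      case True
      then show ?thesis using leaf_direction_nonzero[OF off_axes[OF reg] reg J(1,3) J(2)] J(4) by auto
    next
      case False
      then show ?thesis using leaf_direction_nonzero[OF off_axes[OF reg] reg J(1,2) that] by auto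
    qed
    show "carries_to_lines \<phi> W (U l)" if "l \<in> J" for l using lines that by blast
  qed
  moreover have "open W" using W(3) by (simp add: biholomorphism_def)
  ultimately show thesis using that W by blast
qed

text \<open>These five foliations form Bol's web.\<close>

lemma not_linearisable_if_contains_12345:
  assumes J: "J \<subseteq> {1..9}" "{1, 2, 3, 4, 5} \<subseteq> J"
  shows "\<not> linearisable_at J \<omega>"
proof
  assume lin: "linearisable_at J \<omega>"
  have sub: "{1, 2, 4, 5} \<subseteq> J" "1 \<in> J" "2 \<in> J" using J(2) by auto
  have off_axes: "p \<in> off_axes" "fst p \<noteq> snd p" if "p \<in> regular_locus J" for p
    using regular_1245[of "fst p" "snd p" J] that J(1) sub by auto
  obtain W where W: "open W" "\<omega> \<in> W" "W \<subseteq> regular_locus J" "\<And>p. p \<in> W \<Longrightarrow> cubic_at J p"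
    using linearisable_imp_cubic[OF lin J(1) sub(2,3) _ off_axes(1)] by auto
  have "\<omega> \<in> regular_locus J" using W(2,3) by blast
  moreover have "cubic_at {1, 2, 3, 4, 5} \<omega>" using cubic_at_mono[OF W(4)[OF W(2)] J(2)] .
  ultimately show False
    using not_cubic_at_12345[of "fst \<omega>" "snd \<omega>"] off_axes[of \<omega>] by auto
qed

lemma not_linearisable_135679: "\<not> linearisable_at {1, 3, 5, 6, 7, 9} \<omega>"
proof
  let ?J = "{1, 3, 5, 6, 7, 9 :: nat}"
  assume lin: "linearisable_at ?J \<omega>"
  have off_axes: "p \<in> off_axes" if "p \<in> regular_locus ?J" for p
    using regular_13567[of "fst p" "snd p" ?J] that by auto
  obtain W where W: "open W" "\<omega> \<in> W" "W \<subseteq> regular_locus ?J" "\<And>p. p \<in> W \<Longrightarrow> cubic_at ?J p"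
    using linearisable_imp_cubic[OF lin, of 1 3] off_axes by auto
  show False
  proof (rule no_cubic_on_open_set[OF W(1) _ W(3), of 9])
    show "W \<noteq> {}" using W(2) by blast
    show "9 \<in> ?J" by simp
    show "cubic_at (?J - {9}) q" if "q \<in> W" for q
      by (rule cubic_at_mono[OF W(4)[OF that] Diff_subset])
  qed
qed

text \<open>The five foliations other than 3 of the first web admit an interpolating cubic form everywhere; an
equivalence would carry them to five foliations of the second web.\<close>

lemma not_equivalent_123458_135679: "\<not> equivalent_webs {1, 2, 3, 4, 5, 8} {1, 3, 5, 6, 7, 9}"
proof
  let ?J = "{1, 2, 3, 4, 5, 8 :: nat}" and ?J' = "{1, 3, 5, 6, 7, 9 :: nat}" and ?S = "{1, 2, 4, 5, 8 :: nat}"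
  assume "equivalent_webs ?J ?J'"
  then obtain \<phi> W \<sigma> where W: "W \<noteq> {}" "W \<subseteq> regular_locus ?J" "biholomorphism \<phi> W" "\<phi> ` W \<subseteq> regular_locus ?J'"
    and \<sigma>: "bij_betw \<sigma> ?J ?J'" and leaves: "\<forall>j\<in>?J. carries_foliation \<phi> W (U j) (U (\<sigma> j))"
    unfolding equivalent_webs_def by blast
  \<comment> \<open>the image of the third foliation is the one that the image of \<open>{1, 2, 4, 5, 8}\<close> omits\<close>
  define m where "m = \<sigma> 3"
  have m: "m \<in> ?J'" using \<sigma> unfolding m_def by (rule bij_betwE[THEN bspec]) simp
  have img: "\<sigma> ` ?S = ?J' - {m}"
  proof -
    have "?S = ?J - {3}" by auto
    moreover have "\<sigma> ` (?J - {3}) = \<sigma> ` ?J - \<sigma> ` {3}"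
      using \<sigma> by (intro inj_on_image_set_diff[of \<sigma> ?J]) (auto simp: bij_betw_def)
    ultimately show ?thesis using \<sigma> by (simp add: bij_betw_def m_def)
  qed
  have off_axes: "p \<in> off_axes" if "p \<in> regular_locus ?J" for p
    using regular_1245[of "fst p" "snd p" ?J] that by auto
  have off_axes': "p \<in> off_axes" if "p \<in> regular_locus ?J'" for p
    using regular_13567[of "fst p" "snd p" ?J'] that by auto
  have nz: "leaf_direction j p \<noteq> (0, 0)" if "p \<in> regular_locus ?J" "j \<in> ?J" for p j
  proof (cases "j = 1")
    case True
    then show ?thesis using leaf_direction_nonzero[OF off_axes[OF that(1)] that(1), of 2 j] by simp
  next
    case False
    then show ?thesis using leaf_direction_nonzero[OF off_axes[OF that(1)] that(1), of 1 j] that(2) by simp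
  qed
  have nz': "leaf_direction j p \<noteq> (0, 0)" if "p \<in> regular_locus ?J'" "j \<in> ?J'" for p j
  proof (cases "j = 1")
    case True
    then show ?thesis using leaf_direction_nonzero[OF off_axes'[OF that(1)] that(1), of 3 j] by simp
  next
    case False
    then show ?thesis using leaf_direction_nonzero[OF off_axes'[OF that(1)] that(1), of 1 j] that(2) by simp
  qed
  have "cubic_at (?J' - {m}) (\<phi> p)" if p: "p \<in> W" for p
  proof -
    have reg: "p \<in> regular_locus ?J" "\<phi> p \<in> regular_locus ?J'" using p W by auto
    have \<sigma>J: "\<sigma> j \<in> ?J'" if "j \<in> ?S" for j
      using \<sigma> that by (intro bij_betwE[THEN bspec, of \<sigma> ?J ?J' j]) auto
    have "cubic_at (\<sigma> ` ?S) (\<phi> p)"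
    proof (rule cubic_at_transport[OF W(3) p off_axes[OF reg(1)] off_axes'[OF reg(2)]])
      show "?S \<subseteq> {1..9}" by auto
      show "\<sigma> ` ?S \<subseteq> {1..9}" unfolding img by auto
      show "cubic_at ?S p" using cubic_at_12458[of "fst p" "snd p"] off_axes[OF reg(1)] by simp
      fix j assume j: "j \<in> ?S"
      then have jJ: "j \<in> ?J" by auto
      show "leaf_direction j p \<noteq> (0, 0)" by (rule nz[OF reg(1) jJ])
      show "leaf_direction (\<sigma> j) (\<phi> p) \<noteq> (0, 0)" by (rule nz'[OF reg(2) \<sigma>J[OF j]])
      show "carries_foliation \<phi> W (U j) (U (\<sigma> j))" using leaves jJ by blast
    qed
    then show ?thesis unfolding img .
  qed
  then have cub: "cubic_at (?J' - {m}) q" if "q \<in> \<phi> ` W" for q using that by blast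
  have "open (\<phi> ` W)" using W(3) by (simp add: biholomorphism_def)
  then show False
    by (rule no_cubic_on_open_set[OF _ _ W(4) m cub]) (use W(1) in auto)
qed

section \<open>The five webs\<close>

lemma subwebs:
  "{1..9::nat} - {6, 9} = {1, 2, 3, 4, 5, 7, 8}"
  "{1..9::nat} - {6, 7, 9} = {1, 2, 3, 4, 5, 8}"
  "{1..9::nat} - {2, 4, 8} = {1, 3, 5, 6, 7, 9}"
  "{1..9::nat} - {3, 6, 9} = {1, 2, 4, 5, 7, 8}"
  by auto

theorem proposition2:
  shows "(is_web 9 \<K> \<and> exceptional_web \<K>) \<and>
    (is_web 7 (T_hat {6, 9}) \<and> exceptional_web (T_hat {6, 9})) \<and>
    (is_web 6 (T_hat {6, 7, 9}) \<and> exceptional_web (T_hat {6, 7, 9})) \<and>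
    (is_web 6 (T_hat {2, 4, 8}) \<and> exceptional_web (T_hat {2, 4, 8})) \<and>
    \<not> equivalent_webs (T_hat {6, 7, 9}) (T_hat {2, 4, 8}) \<and>
    (is_web 6 (T_hat {3, 6, 9}) \<and> maximal_rank_web (T_hat {3, 6, 9}) \<and>
     hexagonal_web (T_hat {3, 6, 9}))"
proof (intro conjI)
  show "is_web 9 \<K>" by (rule is_web_if) auto
  show "is_web 7 (T_hat {6, 9})" "is_web 6 (T_hat {6, 7, 9})" "is_web 6 (T_hat {2, 4, 8})"
    "is_web 6 (T_hat {3, 6, 9})"
    by (rule is_web_if; simp add: subwebs)+
  show "exceptional_web \<K>"
  proof -
    have "set [1, 2, 3, 4, 5, 6, 7, 8, 9 :: nat] = \<K>" by auto
    note maximal_rank_123456789[unfolded this]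
    then show ?thesis
      using not_linearisable_if_contains_12345[of \<K>] by (auto simp: exceptional_web_def)
  qed
  show "exceptional_web (T_hat {6, 9})"
    unfolding subwebs exceptional_web_def
    using maximal_rank_1234578 not_linearisable_if_contains_12345[of "{1, 2, 3, 4, 5, 7, 8}"] by auto
  show "exceptional_web (T_hat {6, 7, 9})"
    unfolding subwebs exceptional_web_def
    using maximal_rank_123458 not_linearisable_if_contains_12345[of "{1, 2, 3, 4, 5, 8}"] by auto
  show "exceptional_web (T_hat {2, 4, 8})"
    unfolding subwebs exceptional_web_def using maximal_rank_135679 not_linearisable_135679 by auto
  show "\<not> equivalent_webs (T_hat {6, 7, 9}) (T_hat {2, 4, 8})"
    unfolding subwebs by (rule not_equivalent_123458_135679)
  show "maximal_rank_web (T_hat {3, 6, 9})"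
    unfolding subwebs maximal_rank_web_def using maximal_rank_124578 by auto
  show "hexagonal_web (T_hat {3, 6, 9})"
    unfolding subwebs by (rule hexagonal_web_124578)
qed


end
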